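(* Let $p$ be a prime, let $K$ and $L$ be $\mathbb{Z}_p$-complexes and let $I(K)$, $I(L)$ be their Smith indices. (1) If $I_p(K)=I(K)-1$ and $I_p(L)=I(L)-1$, then $I(K*L)\leq I(K)+I(L)-1$. (2) If $p=2$, $I_2(K)=I(K)$ and $I_2(L)=I(L)$, then $I_2(K*L)=I(K*L)=I(K)+I(L)$. (3) If $p=2$, $I_2(K)=I(K)-1$ and $I_2(L)=I(L)$, then $I(K*L)=I(K)+I(L)$ or $I(K*L)=I(K)+I(L)-1$; and both cases are possible, i.e. there exist pairs $(K,L)$ satisfying these hypotheses for which the first equality holds, and pairs for which the second holds. (4) Let $p>2$, $I_p(K)=I(K)$ and $I_p(L)=I(L)$, and put $n_K=I(K)-1$, $n_L=I(L)-1$. If $n_K,n_L>0$, $n_K$ is even and $A^{n_K}(K)$ has a dual which is boundary-equivariant modulo $p$ (or the same with the roles of $K$ and $L$ exchanged), then $I_p(K*L)=I(K*L)=I(K)+I(L)$.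
   Context: All simplicial complexes are finite. A $\mathbb{Z}_p$-complex is a simplicial complex $K$ with a simplicial automorphism $t$, $t^p=\mathrm{id}$, such that $t^k\sigma\neq\sigma$ for every non-empty simplex $\sigma$ and every $k\not\equiv0 \pmod p$. The join $K*L$ is a $\mathbb{Z}_p$-complex via the action of $t$ on the vertices of each factor. $C_*(K)$, $C^*(K)$ are the integral simplicial chain and cochain complexes (dimensions $\geq 0$); $t$ also denotes the induced maps; $d=1-t$, $s=1+t+\cdots+t^{p-1}$. Let $C^i_d(K)=\ker(d)=\mathrm{im}(s)\subset C^i(K)$ and $C^i_s(K)=\ker(s)=\mathrm{im}(d)\subset C^i(K)$; these are subcomplexes with cohomologies $H^i_d(K)$, $H^i_s(K)$. A resolution of $1$ is a sequence $\phi_j\in C^j(K)$, $j\ge 0$, with $s\phi_0=1$ (the cochain with value $1$ on each vertex), $\delta\phi_j=d\phi_{j+1}$ for $j$ even, $\delta\phi_j=s\phi_{j+1}$ for $j$ odd. The $j$-th Smith class $A^j(K)$ is $[s\phi_j]\in H^j_d(K)$ if $j$ is even and $[d\phi_j]\in H^j_s(K)$ if $j$ is odd; it is independent of the resolution. Its reduction modulo $n$ is its image under coefficient reduction $\mathbb{Z}\to\mathbb{Z}/n$ (in the cohomology of $C^*_d(K)\otimes\mathbb{Z}/n$, resp. $C^*_s(K)\otimes\mathbb{Z}/n$). The Smith index $I(K)$ is the smallest $n\geq0$ with $A^n(K)=0$; $I_p(K)$ is the smallest $n\ge 0$ such that the reduction of $A^n(K)$ modulo $p$ is zero. One always has $I(K)-1\le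 I_p(K)\le I(K)$. For $j$ even and $A^j(K)=[s\phi]$, a chain $c\in C_j(K)$ is a dual of $A^j(K)$ if $s\partial c\equiv0 \pmod p$ and $\phi(sc)\not\equiv0\pmod p$. It is boundary-equivariant modulo $q$ if $d\partial c\equiv 0\pmod q$. *)

theory Defs
  imports
    "HOL-Algebra.Coset"
    "HOL-Combinatorics.Permutations"
    "HOL-Computational_Algebra.Primes"
begin

section \<open>Finite simplicial complexes with a free \<open>\<int>\<^sub>p\<close>-action\<close>

text \<open>Complexes are abstract and contain the empty simplex; the complex without vertices
  is \<open>{{}}\<close>.\<close>

definition abstract_complex :: "'a set set \<Rightarrow> bool" where
  "abstract_complex K \<longleftrightarrow>
     finite K \<and> (\<forall>\<sigma>\<in>K. finite \<sigma>) \<and> {} \<in> K \<and> (\<forall>\<sigma>\<in>K. \<forall>\<tau>. \<tau> \<subseteq> \<sigma> \<longrightarrow> \<tau> \<in> K)"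

text \<open>The vertex map is extended by the identity to points of the type that are not vertices
  of \<open>K\<close>; this is what \<open>permutes\<close> says.\<close>

definition Zp_complex :: "nat \<Rightarrow> 'a set set \<Rightarrow> ('a \<Rightarrow> 'a) \<Rightarrow> bool" where
  "Zp_complex p K t \<longleftrightarrow>
     abstract_complex K \<and>
     t permutes \<Union>K \<and> (`) t ` K = K \<and> t ^^ p = id \<and>
     (\<forall>\<sigma>\<in>K. \<forall>k. \<sigma> \<noteq> {} \<and> \<not> p dvd k \<longrightarrow> (t ^^ k) ` \<sigma> \<noteq> \<sigma>)"

text \<open>The generator acts on the join of \<open>(K, t)\<close> and \<open>(L, u)\<close> by \<open>map_sum t u\<close>.\<close>

definition complex_join :: "'a set set \<Rightarrow> 'b set set \<Rightarrow> ('a + 'b) set set" where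
  "complex_join K L = {\<sigma> <+> \<tau> | \<sigma> \<tau>. \<sigma> \<in> K \<and> \<tau> \<in> L}"


section \<open>Oriented chains and cochains\<close>

text \<open>A list \<open>[v\<^sub>0, \<dots>, v\<^sub>j]\<close> of distinct vertices of a simplex stands for the oriented simplex
  it determines.\<close>

definition ordered_simplices :: "'a set set \<Rightarrow> nat \<Rightarrow> 'a list set" where
  "ordered_simplices K j = {xs. distinct xs \<and> set xs \<in> K \<and> length xs = Suc j}"

text \<open>Both integral \<open>j\<close>-chains and integral \<open>j\<close>-cochains of the finite complex \<open>K\<close> are
  represented by the integer-valued functions on oriented \<open>j\<close>-simplices that change sign
  with the orientation. A chain \<open>c\<close> is the formal sum in which the oriented simplex \<open>xs\<close> has
  coefficient \<open>c xs\<close> (one orientation being chosen for each simplex); a cochain \<open>\<phi>\<close> takes the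
  value \<open>\<phi> xs\<close> on \<open>xs\<close>.\<close>

definition alternating_functions :: "'a set set \<Rightarrow> nat \<Rightarrow> ('a list \<Rightarrow> int) set" where
  "alternating_functions K j =
     {f. (\<forall>xs. xs \<notin> ordered_simplices K j \<longrightarrow> f xs = 0) \<and>
         (\<forall>xs \<pi>. \<pi> permutes {..<length xs} \<longrightarrow> f (permute_list \<pi> xs) = sign \<pi> * f xs)}"

abbreviation chains :: "'a set set \<Rightarrow> nat \<Rightarrow> ('a list \<Rightarrow> int) set" where
  "chains \<equiv> alternating_functions"

abbreviation cochains :: "'a set set \<Rightarrow> nat \<Rightarrow> ('a list \<Rightarrow> int) set" where
  "cochains \<equiv> alternating_functions"

definition coboundary :: "'a set set \<Rightarrow> ('a list \<Rightarrow> int) \<Rightarrow> 'a list \<Rightarrow> int" where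
  "coboundary K \<phi> xs =
     (if distinct xs \<and> set xs \<in> K
      then (\<Sum>i<length xs. (- 1) ^ i * \<phi> (take i xs @ drop (Suc i) xs)) else 0)"

text \<open>The coefficient of \<open>xs\<close> in \<open>\<partial>[v\<^sub>0, \<dots>, v\<^sub>j] = (\<Sum>i\<le>j. (-1)\<^sup>i [v\<^sub>0, \<dots>, v\<^sub>i omitted, \<dots>, v\<^sub>j])\<close>
  is the sum over all vertices \<open>v\<close> of the coefficients of \<open>v # xs\<close> in \<open>[v\<^sub>0, \<dots>, v\<^sub>j]\<close>. There are no
  chains in degree \<open>-1\<close>, so the boundary of a \<open>0\<close>-chain is zero.\<close>

definition boundary :: "'a set set \<Rightarrow> ('a list \<Rightarrow> int) \<Rightarrow> 'a list \<Rightarrow> int" where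
  "boundary K c xs = (if xs = [] then 0 else (\<Sum>v\<in>\<Union>K. c (v # xs)))"

text \<open>The product \<open>\<phi> xs * c xs\<close> does not depend on the chosen orientation \<open>xs\<close> of \<open>\<sigma>\<close>.\<close>

definition cochain_eval :: "'a set set \<Rightarrow> nat \<Rightarrow> ('a list \<Rightarrow> int) \<Rightarrow> ('a list \<Rightarrow> int) \<Rightarrow> int" where
  "cochain_eval K j \<phi> c =
     (\<Sum>\<sigma> | \<sigma> \<in> K \<and> card \<sigma> = Suc j.
        let xs = (SOME xs. distinct xs \<and> set xs = \<sigma>) in \<phi> xs * c xs)"

definition chain_map :: "('a \<Rightarrow> 'a) \<Rightarrow> ('a list \<Rightarrow> int) \<Rightarrow> 'a list \<Rightarrow> int" where
  "chain_map t c xs = c (map (inv_into UNIV t) xs)"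

definition cochain_map :: "('a \<Rightarrow> 'a) \<Rightarrow> ('a list \<Rightarrow> int) \<Rightarrow> 'a list \<Rightarrow> int" where
  "cochain_map t \<phi> xs = \<phi> (map t xs)"

text \<open>The operators \<open>1 - T\<close> and \<open>1 + T + \<dots> + T\<^sup>p\<^sup>-\<^sup>1\<close>, used with \<open>T = chain_map t\<close> and
  \<open>T = cochain_map t\<close>.\<close>

definition op_d :: "(('x \<Rightarrow> int) \<Rightarrow> 'x \<Rightarrow> int) \<Rightarrow> ('x \<Rightarrow> int) \<Rightarrow> 'x \<Rightarrow> int" where
  "op_d T f x = f x - T f x"

definition op_s :: "nat \<Rightarrow> (('x \<Rightarrow> int) \<Rightarrow> 'x \<Rightarrow> int) \<Rightarrow> ('x \<Rightarrow> int) \<Rightarrow> 'x \<Rightarrow> int" where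
  "op_s p T f x = (\<Sum>k<p. (T ^^ k) f x)"


section \<open>Cohomology of cochain complexes of abelian groups\<close>

text \<open>A cochain complex is given by groups \<open>G j\<close>, \<open>j \<ge> 0\<close>, with maps \<open>\<delta> j\<close> from \<open>G j\<close> to
  \<open>G (Suc j)\<close>. The groups are written multiplicatively, as everywhere in HOL-Algebra.\<close>

definition cocycles ::
    "(nat \<Rightarrow> ('c, 'm) monoid_scheme) \<Rightarrow> (nat \<Rightarrow> 'c \<Rightarrow> 'c) \<Rightarrow> nat \<Rightarrow> 'c set" where
  "cocycles G \<delta> j = kernel (G j) (G (Suc j)) (\<delta> j)"

definition coboundaries ::
    "(nat \<Rightarrow> ('c, 'm) monoid_scheme) \<Rightarrow> (nat \<Rightarrow> 'c \<Rightarrow> 'c) \<Rightarrow> nat \<Rightarrow> 'c set" where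
  "coboundaries G \<delta> j = (case j of 0 \<Rightarrow> {\<one>\<^bsub>G 0\<^esub>} | Suc i \<Rightarrow> \<delta> i ` carrier (G i))"

definition cohomology ::
    "(nat \<Rightarrow> ('c, 'm) monoid_scheme) \<Rightarrow> (nat \<Rightarrow> 'c \<Rightarrow> 'c) \<Rightarrow> nat \<Rightarrow> 'c set monoid" where
  "cohomology G \<delta> j = (G j)\<lparr>carrier := cocycles G \<delta> j\<rparr> Mod coboundaries G \<delta> j"

definition cohomology_class ::
    "(nat \<Rightarrow> ('c, 'm) monoid_scheme) \<Rightarrow> (nat \<Rightarrow> 'c \<Rightarrow> 'c) \<Rightarrow> nat \<Rightarrow> 'c \<Rightarrow> 'c set" where
  "cohomology_class G \<delta> j x = coboundaries G \<delta> j #>\<^bsub>G j\<^esub> x"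

text \<open>If \<open>f\<close> is a homomorphism into \<open>H\<close> that maps a subgroup into the subgroup \<open>N\<close> of \<open>H\<close>, then
  \<open>quotient_map H N f\<close> is the homomorphism of quotient groups induced by \<open>f\<close>, as a map of
  cosets.\<close>

definition quotient_map ::
    "('d, 'm) monoid_scheme \<Rightarrow> 'd set \<Rightarrow> ('c \<Rightarrow> 'd) \<Rightarrow> 'c set \<Rightarrow> 'd set" where
  "quotient_map H N f X = N <#>\<^bsub>H\<^esub> (f ` X)"

text \<open>For an abelian group \<open>G\<close>, the group \<open>G \<otimes> \<int>/n\<close> is realised as \<open>G/nG\<close>, and the coefficient
  reduction \<open>G \<rightarrow> G \<otimes> \<int>/n\<close> as the quotient map.\<close>

definition multiples :: "nat \<Rightarrow> ('c, 'm) monoid_scheme \<Rightarrow> 'c set" where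
  "multiples n G = {x [^]\<^bsub>G\<^esub> n | x. x \<in> carrier G}"

definition tensor_group ::
    "nat \<Rightarrow> (nat \<Rightarrow> ('c, 'm) monoid_scheme) \<Rightarrow> nat \<Rightarrow> 'c set monoid" where
  "tensor_group n G j = G j Mod multiples n (G j)"

definition tensor_map ::
    "nat \<Rightarrow> (nat \<Rightarrow> ('c, 'm) monoid_scheme) \<Rightarrow> (nat \<Rightarrow> 'c \<Rightarrow> 'c) \<Rightarrow> nat \<Rightarrow> 'c set \<Rightarrow> 'c set"
  where
  "tensor_map n G \<delta> j = quotient_map (G (Suc j)) (multiples n (G (Suc j))) (\<delta> j)"

definition reduce_class ::
    "nat \<Rightarrow> (nat \<Rightarrow> ('c, 'm) monoid_scheme) \<Rightarrow> (nat \<Rightarrow> 'c \<Rightarrow> 'c) \<Rightarrow> nat \<Rightarrow> 'c set \<Rightarrow> 'c set set"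
  where
  "reduce_class n G \<delta> j =
     quotient_map (tensor_group n G j)
       (coboundaries (tensor_group n G) (tensor_map n G \<delta>) j)
       (\<lambda>x. multiples n (G j) #>\<^bsub>G j\<^esub> x)"


section \<open>Smith classes and Smith indices\<close>

definition cochain_group :: "'a set set \<Rightarrow> nat \<Rightarrow> ('a list \<Rightarrow> int) monoid" where
  "cochain_group K j =
     \<lparr>carrier = cochains K j, monoid.mult = (\<lambda>\<phi> \<psi> xs. \<phi> xs + \<psi> xs), one = (\<lambda>xs. 0)\<rparr>"

definition cochain_group_d ::
    "'a set set \<Rightarrow> ('a \<Rightarrow> 'a) \<Rightarrow> nat \<Rightarrow> ('a list \<Rightarrow> int) monoid" where
  "cochain_group_d K t j = (cochain_group K j)
     \<lparr>carrier := {\<phi> \<in> cochains K j. op_d (cochain_map t) \<phi> = (\<lambda>xs. 0)}\<rparr>"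

definition cochain_group_s ::
    "nat \<Rightarrow> 'a set set \<Rightarrow> ('a \<Rightarrow> 'a) \<Rightarrow> nat \<Rightarrow> ('a list \<Rightarrow> int) monoid" where
  "cochain_group_s p K t j = (cochain_group K j)
     \<lparr>carrier := {\<phi> \<in> cochains K j. op_s p (cochain_map t) \<phi> = (\<lambda>xs. 0)}\<rparr>"

definition unit_cochain :: "'a set set \<Rightarrow> 'a list \<Rightarrow> int" where
  "unit_cochain K xs = (if xs \<in> ordered_simplices K 0 then 1 else 0)"

definition resolution_of_1 ::
    "nat \<Rightarrow> 'a set set \<Rightarrow> ('a \<Rightarrow> 'a) \<Rightarrow> (nat \<Rightarrow> 'a list \<Rightarrow> int) \<Rightarrow> bool" where
  "resolution_of_1 p K t \<phi> \<longleftrightarrow>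
     (\<forall>j. \<phi> j \<in> cochains K j) \<and>
     op_s p (cochain_map t) (\<phi> 0) = unit_cochain K \<and>
     (\<forall>j. even j \<longrightarrow> coboundary K (\<phi> j) = op_d (cochain_map t) (\<phi> (Suc j))) \<and>
     (\<forall>j. odd j \<longrightarrow> coboundary K (\<phi> j) = op_s p (cochain_map t) (\<phi> (Suc j)))"

text \<open>The cochain complex whose \<open>j\<close>-th cohomology group contains the \<open>j\<close>-th Smith class.\<close>

definition smith_complex ::
    "nat \<Rightarrow> 'a set set \<Rightarrow> ('a \<Rightarrow> 'a) \<Rightarrow> nat \<Rightarrow> nat \<Rightarrow> ('a list \<Rightarrow> int) monoid" where
  "smith_complex p K t j = (if even j then cochain_group_d K t else cochain_group_s p K t)"

definition smith_cohomology ::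
    "nat \<Rightarrow> 'a set set \<Rightarrow> ('a \<Rightarrow> 'a) \<Rightarrow> nat \<Rightarrow> ('a list \<Rightarrow> int) set monoid" where
  "smith_cohomology p K t j = cohomology (smith_complex p K t j) (\<lambda>_. coboundary K) j"

definition smith_cocycle ::
    "nat \<Rightarrow> ('a \<Rightarrow> 'a) \<Rightarrow> nat \<Rightarrow> ('a list \<Rightarrow> int) \<Rightarrow> 'a list \<Rightarrow> int" where
  "smith_cocycle p t j \<phi> =
     (if even j then op_s p (cochain_map t) \<phi> else op_d (cochain_map t) \<phi>)"

text \<open>The description is sound because the class does not depend on the resolution.\<close>

definition smith_class ::
    "nat \<Rightarrow> 'a set set \<Rightarrow> ('a \<Rightarrow> 'a) \<Rightarrow> nat \<Rightarrow> ('a list \<Rightarrow> int) set" where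
  "smith_class p K t j =
     (THE A. \<exists>\<phi>. resolution_of_1 p K t \<phi> \<and>
        A = cohomology_class (smith_complex p K t j) (\<lambda>_. coboundary K) j
              (smith_cocycle p t j (\<phi> j)))"

definition smith_cohomology_mod ::
    "nat \<Rightarrow> nat \<Rightarrow> 'a set set \<Rightarrow> ('a \<Rightarrow> 'a) \<Rightarrow> nat \<Rightarrow> ('a list \<Rightarrow> int) set set monoid" where
  "smith_cohomology_mod n p K t j =
     cohomology (tensor_group n (smith_complex p K t j))
       (tensor_map n (smith_complex p K t j) (\<lambda>_. coboundary K)) j"

definition smith_class_mod ::
    "nat \<Rightarrow> nat \<Rightarrow> 'a set set \<Rightarrow> ('a \<Rightarrow> 'a) \<Rightarrow> nat \<Rightarrow> ('a list \<Rightarrow> int) set set" where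
  "smith_class_mod n p K t j =
     reduce_class n (smith_complex p K t j) (\<lambda>_. coboundary K) j (smith_class p K t j)"

definition smith_index :: "nat \<Rightarrow> 'a set set \<Rightarrow> ('a \<Rightarrow> 'a) \<Rightarrow> nat" where
  "smith_index p K t = (LEAST n. smith_class p K t n = \<one>\<^bsub>smith_cohomology p K t n\<^esub>)"

definition smith_index_p :: "nat \<Rightarrow> 'a set set \<Rightarrow> ('a \<Rightarrow> 'a) \<Rightarrow> nat" where
  "smith_index_p p K t =
     (LEAST n. smith_class_mod p p K t n = \<one>\<^bsub>smith_cohomology_mod p p K t n\<^esub>)"

text \<open>Duals are considered for even \<open>j\<close> only. If \<open>s\<partial>c\<close> vanishes modulo \<open>p\<close>, then the residue
  of \<open>\<phi>(sc)\<close> modulo \<open>p\<close> is the same for all \<open>\<phi>\<close> such that the Smith class is \<open>[s\<phi>]\<close>.\<close>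

definition smith_dual ::
    "nat \<Rightarrow> 'a set set \<Rightarrow> ('a \<Rightarrow> 'a) \<Rightarrow> nat \<Rightarrow> ('a list \<Rightarrow> int) \<Rightarrow> bool" where
  "smith_dual p K t j c \<longleftrightarrow>
     even j \<and> c \<in> chains K j \<and>
     (\<forall>xs. int p dvd op_s p (chain_map t) (boundary K c) xs) \<and>
     (\<exists>\<phi>\<in>cochains K j.
        smith_class p K t j =
          cohomology_class (cochain_group_d K t) (\<lambda>_. coboundary K) j
            (op_s p (cochain_map t) \<phi>) \<and>
        \<not> int p dvd cochain_eval K j \<phi> (op_s p (chain_map t) c))"

definition boundary_equivariant_mod ::
    "nat \<Rightarrow> 'a set set \<Rightarrow> ('a \<Rightarrow> 'a) \<Rightarrow> ('a list \<Rightarrow> int) \<Rightarrow> bool" where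
  "boundary_equivariant_mod q K t c \<longleftrightarrow>
     (\<forall>xs. int q dvd op_d (chain_map t) (boundary K c) xs)"

end

theory Submission
  imports Defs "HOL-Combinatorics.Multiset_Permutations"
begin

text \<open>
  A resolution of 1 is encoded as one alternating function \<open>F\<close> on vertex lists with \<open>F []
  = 1\<close>: the value on a list of length \<open>n + 1\<close> belongs to degree \<open>n\<close>, the
  empty list to the augmentation, and the coboundary of \<open>F\<close> is \<open>s F\<close> or \<open>d
  F\<close> according to the parity of the length. Since \<open>ker d = im s\<close> and \<open>ker s = im
  d\<close>, the class \<open>A\<^sup>n\<close> vanishes iff some resolution vanishes on all lists longer
  than \<open>n\<close>. Resolutions \<open>F\<close> of \<open>K\<close> and \<open>G\<close> of
  \<open>L\<close> have the join \<open>F(x) G(y)\<close>, \<open>F(t x) G(y)\<close> or the sum of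
  \<open>F(t\<^sup>k x) G(u\<^sup>l y)\<close> over \<open>l < k < p\<close>, depending on the parities of
  the lengths of \<open>x\<close> and \<open>y\<close>.

  Truncated resolutions thus bound the index of the join from above by the sum of the indices; in (1), the top
  terms of both resolutions can be chosen as values of \<open>s\<close> or \<open>p - s\<close>, which makes
  the top class of the join vanish. For the lower bounds, functionals modulo \<open>p\<close> that are dual to
  the Smith classes of \<open>K\<close> and \<open>L\<close> are multiplied to a functional that detects the
  Smith class of the join. In (4), the boundary-equivariant dual is what makes the product vanish on
  coboundaries.

  For the examples in (3), \<open>K\<close> consists of two projective planes with a common line, the double
  cover of the Moore space with first homology of order four. Its join with two points attains the upper value.
  The Klein bottle has a class \<open>y\<close> of order two, so that \<open>2 y\<close> is a coboundary,
  and this suffices to lower the index of its join with \<open>K\<close> by one.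
\<close>

text \<open>The triangular sum over l < k enters because a diagonal shift changes it by exactly s on
  the first factor minus s on the second. The integral and the mod p vanishing of a class differ by
  one degree at most: s s = p s and d (p - s) = p d let a factor p be absorbed by a cochain that is
  closed, and this cochain ends the resolution one step later. The obstacle for lower bounds is that
  the relations of the join involve d or s of the diagonal action, while the functionals of K and L
  kill coboundaries of one factor only. Averaging a diagonal relation over one factor turns d into d
  on the other factor and s on this one. Hence a class of even degree, whose functional is only
  known to kill s of coboundaries, must be paired with one that kills d of coboundaries. For p = 2
  this is automatic, as s and d agree modulo 2; for p > 2 it is the boundary-equivariance of the
  dual. The lower bounds for the examples are parity arguments on the loop 0, 1, 5, 6, which the
  involution turns by half its length: the values at a vertex and its image add up to 1, while an
  even value around the loop would make this sum even.\<close>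

definition simplex_list :: "'a set set \<Rightarrow> 'a list \<Rightarrow> bool" where
  "simplex_list K xs \<longleftrightarrow> distinct xs \<and> set xs \<in> K"

text \<open>Only adjacent swaps are demanded. They generate all permutations, and a condition on
  neighbours in every context is easy to carry through inductions on lists.\<close>

definition alternating :: "('a list \<Rightarrow> int) \<Rightarrow> bool" where
  "alternating f \<longleftrightarrow> (\<forall>xs a b ys. f (xs @ a # b # ys) = - f (xs @ b # a # ys))"

text \<open>One function carries all degrees at once. As the empty list represents the empty
  simplex, its value is unconstrained; this is the augmentation degree, which the cochain groups
  themselves lack.\<close>

definition alt :: "'a set set \<Rightarrow> ('a list \<Rightarrow> int) set" where
  "alt K = {f. alternating f \<and> (\<forall>xs. \<not> simplex_list K xs \<longrightarrow> f xs = 0)}"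

definition alt_n :: "'a set set \<Rightarrow> nat \<Rightarrow> ('a list \<Rightarrow> int) set" where
  "alt_n K n = {f \<in> alt K. \<forall>xs. length xs \<noteq> n \<longrightarrow> f xs = 0}"

lemma alternatingD: "alternating f \<Longrightarrow> f (xs @ a # b # ys) = - f (xs @ b # a # ys)"
  unfolding alternating_def by blast

lemma alt_alternating: "f \<in> alt K \<Longrightarrow> alternating f"
  and alt_outside: "f \<in> alt K \<Longrightarrow> \<not> simplex_list K xs \<Longrightarrow> f xs = 0"
  by (auto simp: alt_def)

lemma alt_n_alt: "f \<in> alt_n K n \<Longrightarrow> f \<in> alt K"
  and alt_n_outside: "f \<in> alt_n K n \<Longrightarrow> length xs \<noteq> n \<Longrightarrow> f xs = 0"
  by (auto simp: alt_n_def)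


subsection \<open>Adjacent swaps generate all permutations\<close>

lemma permute_list_adjacent:
  assumes "Suc i < length xs"
  shows "permute_list (transpose i (Suc i)) xs =
           take i xs @ xs ! Suc i # xs ! i # drop (Suc (Suc i)) xs"
proof (rule nth_equalityI)
  show "length (permute_list (transpose i (Suc i)) xs) =
      length (take i xs @ xs ! Suc i # xs ! i # drop (Suc (Suc i)) xs)"
    using assms by simp
next
  fix j assume j: "j < length (permute_list (transpose i (Suc i)) xs)"
  then have "permute_list (transpose i (Suc i)) xs ! j = xs ! transpose i (Suc i) j"
    by (simp add: permute_list_def)
  also have "\<dots> = (take i xs @ xs ! Suc i # xs ! i # drop (Suc (Suc i)) xs) ! j"
  proof -
    consider "j < i" | "j = i" | "j = Suc i" | "j > Suc i" by linarith
    then show ?thesis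
    proof cases
      case 4
      then obtain k where "j = Suc (Suc (i + k))" using less_iff_Suc_add[of "Suc i" j] by auto
      then show ?thesis using assms j by (simp add: nth_append transpose_def)
    qed (use assms j in \<open>simp_all add: nth_append transpose_def\<close>)
  qed
  finally show "permute_list (transpose i (Suc i)) xs ! j =
      (take i xs @ xs ! Suc i # xs ! i # drop (Suc (Suc i)) xs) ! j" .
qed

lemma split_at_two:
  assumes "Suc i < length xs"
  shows "xs = take i xs @ xs ! i # xs ! Suc i # drop (Suc (Suc i)) xs"
  using assms by (metis Cons_nth_drop_Suc Suc_lessD append_take_drop_id)

lemma alternating_adjacent:
  assumes "alternating f" "Suc i < length xs"
  shows "f (permute_list (transpose i (Suc i)) xs) = - f xs"
  unfolding permute_list_adjacent[OF assms(2)]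
  by (subst alternatingD[OF assms(1)], subst split_at_two[OF assms(2), symmetric]) simp

text \<open>Conjugation by an adjacent swap shortens the distance by one. The signs of the two outer
  swaps cancel, so the sign is that of the shorter transposition.\<close>

lemma alternating_transpose:
  assumes "alternating f" "i < j" "j < length xs"
  shows "f (permute_list (transpose i j) xs) = - f xs"
  using assms(2,3)
proof (induction "j - i" arbitrary: i xs)
  case 0
  then show ?case by simp
next
  case (Suc d)
  show ?case
  proof (cases "j = Suc i")
    case True
    then show ?thesis using alternating_adjacent[OF assms(1)] Suc.prems by simp
  next
    case False
    with Suc.prems have ij: "Suc i < j" by simp
    let ?s = "transpose i (Suc i)" and ?r = "transpose (Suc i) j"
    have eq: "transpose i j = ?s \<circ> ?r \<circ> ?s"
      using ij by (auto simp: fun_eq_iff transpose_def)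
    have s: "?s permutes {..<length xs}" and r: "?r permutes {..<length xs}"
      using ij Suc.prems by (auto intro!: permutes_swap_id)
    have "permute_list (transpose i j) xs = permute_list ?s (permute_list ?r (permute_list ?s xs))"
      unfolding eq by (simp add: permute_list_compose s r permutes_compose)
    then have "f (permute_list (transpose i j) xs) = - f (permute_list ?r (permute_list ?s xs))"
      using alternating_adjacent[OF assms(1), of i "permute_list ?r (permute_list ?s xs)"]
        ij Suc.prems by simp
    also have "\<dots> = f (permute_list ?s xs)"
      using Suc.hyps(1)[of "Suc i" "permute_list ?s xs"] Suc.hyps(2) ij Suc.prems by simp
    also have "\<dots> = - f xs"
      using alternating_adjacent[OF assms(1), of i xs] ij Suc.prems by simp
    finally show ?thesis .
  qed
qed

lemma alternating_permute:
  assumes "alternating f" "\<pi> permutes {..<length xs}"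
  shows "f (permute_list \<pi> xs) = sign \<pi> * f xs"
  using finite_lessThan assms(2)
proof (induction rule: permutes_rev_induct)
  case id
  then show ?case by (simp add: sign_id permute_list_id)
next
  case (swap a b q)
  show ?case
  proof (cases "a = b")
    case True
    then show ?thesis using swap by (simp add: fun.map_id)
  next
    case False
    have tr: "transpose a b permutes {..<length xs}"
      using swap by (simp add: permutes_swap_id)
    have pq: "permutation q" "permutation (transpose a b)"
      using swap permutation_permutes by (auto simp: permutation_swap_id)
    have sgn: "sign (q \<circ> transpose a b) = - sign q"
      using sign_compose[OF pq] False by (simp add: sign_swap_id)
    have "permute_list (q \<circ> transpose a b) xs = permute_list (transpose a b) (permute_list q xs)"
      using tr by (simp add: permute_list_compose)
    moreover have "f (permute_list (transpose a b) (permute_list q xs)) = - f (permute_list q xs)"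
    proof (cases "a < b")
      case True
      then show ?thesis using alternating_transpose[OF assms(1)] swap by simp
    next
      case F: False
      then have "b < a" using False by simp
      then show ?thesis using alternating_transpose[OF assms(1), of b a "permute_list q xs"] swap
        by (simp add: transpose_commute)
    qed
    ultimately show ?thesis unfolding sgn using swap.IH by (simp only: mult_minus_left)
  qed
qed

text \<open>Dimension \<open>j\<close> is list length \<open>j + 1\<close>; this shift explains the
  \<open>Suc\<close> in most statements about degrees below.\<close>

lemma alternating_functions_eq_alt_n: "alternating_functions K j = alt_n K (Suc j)"
proof (intro equalityI subsetI)
  fix f assume f: "f \<in> alternating_functions K j"
  have "alternating f"
    unfolding alternating_def
  proof (intro allI)
    fix xs a b and ys :: "'a list"
    let ?l = "xs @ b # a # ys" and ?i = "length xs"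
    have "transpose ?i (Suc ?i) permutes {..<length ?l}" by (simp add: permutes_swap_id)
    then have "f (permute_list (transpose ?i (Suc ?i)) ?l) = sign (transpose ?i (Suc ?i)) * f ?l"
      using f unfolding alternating_functions_def by blast
    then show "f (xs @ a # b # ys) = - f ?l"
      by (subst (asm) permute_list_adjacent) (simp_all add: sign_swap_id nth_append)
  qed
  then show "f \<in> alt_n K (Suc j)"
    using f by (auto simp: alternating_functions_def alt_n_def alt_def ordered_simplices_def
        simplex_list_def)
next
  fix f assume "f \<in> alt_n K (Suc j)"
  then show "f \<in> alternating_functions K j"
    using alternating_permute[of f]
    by (auto simp: alternating_functions_def alt_n_def alt_def ordered_simplices_def
        simplex_list_def)
qed

text \<open>Both factors change by the same sign, whose square is 1. This makes the ordering chosen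
  by \<open>SOME\<close> in \<open>cochain_eval\<close> immaterial.\<close>

lemma alternating_same_set:
  assumes "alternating f" "alternating g" "distinct xs" "distinct ys" "set xs = set ys"
  shows "f xs * g xs = f ys * g ys"
proof -
  have "mset xs = mset ys" using assms by (simp add: set_eq_iff_mset_eq_distinct)
  then obtain \<pi> where p: "\<pi> permutes {..<length ys}" "permute_list \<pi> ys = xs"
    using mset_eq_permutation by metis
  have "sign \<pi> * sign \<pi> = 1" by (rule sign_idempotent)
  then show ?thesis
    using alternating_permute[OF assms(1) p(1)] alternating_permute[OF assms(2) p(1)] p(2)
    by (metis (no_types, opaque_lifting) mult.assoc mult.commute mult_1)
qed


subsection \<open>The coboundary on lists\<close>

text \<open>The coboundary formula without the test for a simplex. Without it the recursion
  \<open>list_cob_Cons\<close> holds for all lists, and the standard identities become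
  inductions.\<close>

definition list_cob :: "('a list \<Rightarrow> int) \<Rightarrow> 'a list \<Rightarrow> int" where
  "list_cob f xs = (\<Sum>i<length xs. (- 1) ^ i * f (take i xs @ drop (Suc i) xs))"

lemma list_cob_Nil [simp]: "list_cob f [] = 0"
  by (simp add: list_cob_def)

lemma list_cob_Cons: "list_cob f (x # xs) = f xs - list_cob (\<lambda>ys. f (x # ys)) xs"
  unfolding list_cob_def length_Cons sum.lessThan_Suc_shift
  by (simp add: sum_negf)

lemma list_cob_cong:
  assumes "\<And>ys. length ys + 1 = length xs \<Longrightarrow> set ys \<subseteq> set xs \<Longrightarrow> f ys = g ys"
  shows "list_cob f xs = list_cob g xs"
  unfolding list_cob_def
proof (rule sum.cong[OF refl])
  fix i assume "i \<in> {..<length xs}"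
  then show "(- 1) ^ i * f (take i xs @ drop (Suc i) xs) = (- 1) ^ i * g (take i xs @ drop (Suc i) xs)"
    using assms[of "take i xs @ drop (Suc i) xs"] set_take_subset[of i xs] set_drop_subset[of "Suc i" xs]
    by auto
qed

lemma list_cob_add: "list_cob (\<lambda>xs. f xs + g xs) xs = list_cob f xs + list_cob g xs"
  by (simp add: list_cob_def sum.distrib algebra_simps)

lemma list_cob_diff: "list_cob (\<lambda>xs. f xs - g xs) xs = list_cob f xs - list_cob g xs"
  by (simp add: list_cob_def sum_subtractf algebra_simps)

lemma list_cob_cmult: "list_cob (\<lambda>xs. c * f xs) xs = c * list_cob f xs"
  unfolding list_cob_def sum_distrib_left by (simp add: mult.left_commute)

lemma list_cob_mult_const: "list_cob (\<lambda>xs. f xs * c) xs = list_cob f xs * c"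
  unfolding list_cob_def sum_distrib_right by (simp add: mult.assoc)

lemma list_cob_zero: "list_cob (\<lambda>xs. 0) xs = 0"
  by (simp add: list_cob_def)

lemma list_cob_sum: "list_cob (\<lambda>xs. \<Sum>k\<in>A. f k xs) xs = (\<Sum>k\<in>A. list_cob (f k) xs)"
  unfolding list_cob_def sum_distrib_left by (rule sum.swap)

lemma list_cob_map: "list_cob (\<lambda>xs. f (map g xs)) xs = list_cob f (map g xs)"
  by (simp add: list_cob_def take_map drop_map)

lemma list_cob_list_cob: "list_cob (list_cob f) xs = 0"
proof (induction xs arbitrary: f)
  case (Cons x xs)
  have "list_cob (list_cob f) (x # xs) =
      list_cob f xs - list_cob (\<lambda>ys. f ys - list_cob (\<lambda>zs. f (x # zs)) ys) xs"
    by (simp add: list_cob_Cons)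
  then show ?case
    by (simp add: list_cob_diff Cons.IH)
qed simp

text \<open>The Leibniz rule for concatenation, from which the coboundary of a join is read off when
  \<open>us\<close> comes from the first factor and \<open>vs\<close> from the second.\<close>

lemma list_cob_append:
  "list_cob f (us @ vs) =
     list_cob (\<lambda>us'. f (us' @ vs)) us + (- 1) ^ length us * list_cob (\<lambda>vs'. f (us @ vs')) vs"
proof (induction us arbitrary: f)
  case (Cons u us)
  then show ?case
    by (simp add: list_cob_Cons)
qed simp

lemma alternating_list_cob:
  assumes "alternating f"
  shows "alternating (list_cob f)"
proof -
  \<comment> \<open>The hypothesis fixes the pair \<open>a\<close>, \<open>b\<close> and varies the
    context, so that it passes to \<open>\<lambda>ys. f (x # ys)\<close> in the induction.\<close>
  have swap: "list_cob f (xs @ a # b # ys) + list_cob f (xs @ b # a # ys) = 0"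
    if "\<And>xs ys. f (xs @ a # b # ys) + f (xs @ b # a # ys) = 0" for f xs a b and ys :: "'a list"
    using that
  proof (induction xs arbitrary: f)
    case Nil
    have "list_cob (\<lambda>ys. f (a # b # ys) + f (b # a # ys)) ys = 0"
      using Nil[of "[]"] by (simp add: list_cob_zero)
    then show ?case by (simp add: list_cob_Cons list_cob_add list_cob_diff)
  next
    case (Cons x xs)
    have "list_cob (\<lambda>ys. f (x # ys)) (xs @ a # b # ys) +
        list_cob (\<lambda>ys. f (x # ys)) (xs @ b # a # ys) = 0"
      using Cons.IH[of "\<lambda>ys. f (x # ys)"] Cons.prems by (metis append_Cons)
    then show ?case using Cons.prems[of xs ys] by (simp add: list_cob_Cons)
  qed
  show ?thesis
    unfolding alternating_def
  proof (intro allI)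
    fix xs a b and ys :: "'a list"
    have "f (xs @ a # b # ys) + f (xs @ b # a # ys) = 0" for xs ys
      using alternatingD[OF assms, of xs a b ys] by simp
    from swap[OF this, of xs ys]
    show "list_cob f (xs @ a # b # ys) = - list_cob f (xs @ b # a # ys)" by simp
  qed
qed

lemma coboundary_eq: "coboundary K f xs = (if simplex_list K xs then list_cob f xs else 0)"
  by (simp add: coboundary_def simplex_list_def list_cob_def)

lemma simplex_list_swap: "simplex_list K (xs @ a # b # ys) = simplex_list K (xs @ b # a # ys)"
  by (auto simp: simplex_list_def insert_commute)

lemma coboundary_alt:
  assumes "f \<in> alt K"
  shows "coboundary K f \<in> alt K"
proof -
  have "coboundary K f (xs @ a # b # ys) = - coboundary K f (xs @ b # a # ys)" for xs a b ys
    unfolding coboundary_eq simplex_list_swap[of K xs a b ys]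
      alternatingD[OF alternating_list_cob[OF alt_alternating[OF assms]], of xs a b ys]
    by (cases "simplex_list K (xs @ b # a # ys)") simp_all
  then have "alternating (coboundary K f)"
    unfolding alternating_def by blast
  then show ?thesis
    by (simp add: alt_def coboundary_eq)
qed

lemma simplex_list_subface:
  assumes "abstract_complex K" "simplex_list K xs"
  shows "simplex_list K (take i xs @ drop (Suc i) xs)"
proof -
  have "set (take i xs @ drop (Suc i) xs) \<subseteq> set xs"
    using set_take_subset[of i xs] set_drop_subset[of "Suc i" xs] by auto
  moreover have "distinct (take i xs @ drop (Suc i) xs)"
    using assms(2) by (auto simp: simplex_list_def dest: set_take_disj_set_drop_if_distinct[of xs i "Suc i"])
  ultimately show ?thesis
    using assms by (auto simp: simplex_list_def abstract_complex_def)
qed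

lemma coboundary_coboundary:
  assumes "abstract_complex K"
  shows "coboundary K (coboundary K f) xs = 0"
proof (cases "simplex_list K xs")
  case True
  have "list_cob (coboundary K f) xs = list_cob (list_cob f) xs"
    unfolding list_cob_def[of _ xs]
    by (simp add: coboundary_eq simplex_list_subface[OF assms True])
  then show ?thesis by (simp add: coboundary_eq list_cob_list_cob)
qed (simp add: coboundary_eq)

subsection \<open>Operators of the group ring\<close>

definition norm_op :: "nat \<Rightarrow> ('a \<Rightarrow> 'a) \<Rightarrow> ('a list \<Rightarrow> int) \<Rightarrow> 'a list \<Rightarrow> int" where
  "norm_op p t f xs = (\<Sum>k<p. f (map (t ^^ k) xs))"

definition diff_op :: "('a \<Rightarrow> 'a) \<Rightarrow> ('a list \<Rightarrow> int) \<Rightarrow> 'a list \<Rightarrow> int" where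
  "diff_op t f xs = f xs - f (map t xs)"

text \<open>Indexed by list length: at length \<open>n\<close> the resolution equation uses
  \<open>res_op p t n\<close>, whereas the Smith cocycle of degree \<open>n\<close> is formed with
  \<open>res_op p t (Suc n)\<close> and lies in the kernel of \<open>res_op p t n\<close>.\<close>

definition res_op :: "nat \<Rightarrow> ('a \<Rightarrow> 'a) \<Rightarrow> nat \<Rightarrow> ('a list \<Rightarrow> int) \<Rightarrow> 'a list \<Rightarrow> int" where
  "res_op p t n = (if odd n then norm_op p t else diff_op t)"

lemma cochain_map_funpow: "(cochain_map t ^^ k) f xs = f (map (t ^^ k) xs)"
proof (induction k arbitrary: xs)
  case (Suc k)
  have "(cochain_map t ^^ Suc k) f xs = (cochain_map t ^^ k) f (map t xs)"
    by (simp add: cochain_map_def)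
  also have "\<dots> = f (map (t ^^ k) (map t xs))" by (rule Suc)
  finally show ?case by (simp add: funpow_swap1 comp_def)
qed simp

lemma op_s_cochain_map: "op_s p (cochain_map t) = norm_op p t"
  by (simp add: fun_eq_iff op_s_def norm_op_def cochain_map_funpow)

lemma op_d_cochain_map: "op_d (cochain_map t) = diff_op t"
  by (simp add: fun_eq_iff op_d_def diff_op_def cochain_map_def)

lemma sum_shift_periodic:
  fixes h :: "nat \<Rightarrow> 'b::ab_group_add"
  assumes "h p = h 0"
  shows "(\<Sum>k<p. h (Suc k)) = (\<Sum>k<p. h k)"
  using sum.lessThan_Suc[of h p] sum.lessThan_Suc_shift[of h p] assms by simp

section \<open>Linear structure of alternating functions\<close>

lemma alternating_lincomb:
  "alternating f \<Longrightarrow> alternating g \<Longrightarrow> alternating (\<lambda>xs. a * f xs + b * g xs)"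
  unfolding alternating_def by (metis (no_types, lifting) minus_add_distrib mult_minus_right)

lemma alt_lincomb: "f \<in> alt K \<Longrightarrow> g \<in> alt K \<Longrightarrow> (\<lambda>xs. a * f xs + b * g xs) \<in> alt K"
  using alternating_lincomb[of f g a b] by (auto simp: alt_def)

lemma alt_zero: "(\<lambda>xs. 0) \<in> alt K"
  by (simp add: alt_def alternating_def)

lemma alt_add: "f \<in> alt K \<Longrightarrow> g \<in> alt K \<Longrightarrow> (\<lambda>xs. f xs + g xs) \<in> alt K"
  using alt_lincomb[of f K g 1 1] by simp

lemma alt_diff: "f \<in> alt K \<Longrightarrow> g \<in> alt K \<Longrightarrow> (\<lambda>xs. f xs - g xs) \<in> alt K"
  using alt_lincomb[of f K g 1 "-1"] by simp

lemma alt_cmult: "f \<in> alt K \<Longrightarrow> (\<lambda>xs. c * f xs) \<in> alt K"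
  using alt_lincomb[of f K f c 0] by simp

lemma alt_sum: "(\<And>k. k \<in> A \<Longrightarrow> f k \<in> alt K) \<Longrightarrow> (\<lambda>xs. \<Sum>k\<in>A. f k xs) \<in> alt K"
  by (induction A rule: infinite_finite_induct) (simp_all add: alt_zero alt_add)

lemma alt_restrict:
  assumes f: "f \<in> alt K" and P: "\<And>xs ys. mset xs = mset ys \<Longrightarrow> P xs = P ys"
  shows "(\<lambda>xs. if P xs then f xs else 0) \<in> alt K"
proof -
  have "(if P (xs @ a # b # ys) then f (xs @ a # b # ys) else 0) =
      - (if P (xs @ b # a # ys) then f (xs @ b # a # ys) else 0)" for xs a b ys
    using alternatingD[OF alt_alternating[OF f], of xs a b ys]
      P[of "xs @ a # b # ys" "xs @ b # a # ys"] by auto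
  then have "alternating (\<lambda>xs. if P xs then f xs else 0)"
    unfolding alternating_def by blast
  then show ?thesis using alt_outside[OF f] by (simp add: alt_def)
qed

definition part :: "nat \<Rightarrow> ('a list \<Rightarrow> int) \<Rightarrow> 'a list \<Rightarrow> int" where
  "part n f xs = (if length xs = n then f xs else 0)"

lemma part_alt_n: "f \<in> alt K \<Longrightarrow> part n f \<in> alt_n K n"
  using alt_restrict[of f K "\<lambda>xs. length xs = n", OF _ arg_cong[OF mset_eq_length, of _ _ "\<lambda>k. k = n"]]
  by (simp add: alt_n_def part_def[abs_def])

lemma alt_n_add: "f \<in> alt_n K n \<Longrightarrow> g \<in> alt_n K n \<Longrightarrow> (\<lambda>xs. f xs + g xs) \<in> alt_n K n"
  and alt_n_diff: "f \<in> alt_n K n \<Longrightarrow> g \<in> alt_n K n \<Longrightarrow> (\<lambda>xs. f xs - g xs) \<in> alt_n K n"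
  and alt_n_cmult: "f \<in> alt_n K n \<Longrightarrow> (\<lambda>xs. c * f xs) \<in> alt_n K n"
  and alt_n_zero: "(\<lambda>xs. 0) \<in> alt_n K n"
  by (auto simp: alt_n_def alt_add alt_diff alt_cmult alt_zero)

lemma coboundary_alt_n:
  assumes "f \<in> alt_n K n"
  shows "coboundary K f \<in> alt_n K (Suc n)"
proof -
  have "list_cob f xs = 0" if "length xs \<noteq> Suc n" for xs
  proof -
    have "list_cob f xs = list_cob (\<lambda>xs. 0) xs"
      by (rule list_cob_cong) (use that alt_n_outside[OF assms] in auto)
    then show ?thesis by (simp add: list_cob_zero)
  qed
  then show ?thesis
    using coboundary_alt[OF alt_n_alt[OF assms]] by (auto simp: alt_n_def coboundary_eq)
qed

lemma coboundary_part: "coboundary K (part n f) xs = (if length xs = Suc n then coboundary K f xs else 0)"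
proof -
  have "list_cob (part n f) xs = list_cob f xs" if "length xs = Suc n"
    by (rule list_cob_cong) (use that in \<open>auto simp: part_def\<close>)
  moreover have "list_cob (part n f) xs = 0" if "length xs \<noteq> Suc n"
  proof -
    have "list_cob (part n f) xs = list_cob (\<lambda>xs. 0) xs"
      by (rule list_cob_cong) (use that in \<open>auto simp: part_def\<close>)
    then show ?thesis by (simp add: list_cob_zero)
  qed
  ultimately show ?thesis by (simp add: coboundary_eq)
qed

lemma coboundary_add: "coboundary K (\<lambda>xs. f xs + g xs) xs = coboundary K f xs + coboundary K g xs"
  and coboundary_diff: "coboundary K (\<lambda>xs. f xs - g xs) xs = coboundary K f xs - coboundary K g xs"
  and coboundary_cmult: "coboundary K (\<lambda>xs. c * f xs) xs = c * coboundary K f xs"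
  and coboundary_zero: "coboundary K (\<lambda>xs. 0) xs = 0"
  by (simp_all add: coboundary_eq list_cob_add list_cob_diff list_cob_cmult list_cob_zero)

lemma coboundary_sum: "coboundary K (\<lambda>xs. \<Sum>k\<in>A. f k xs) xs = (\<Sum>k\<in>A. coboundary K (f k) xs)"
  by (simp add: coboundary_eq list_cob_sum)

lemma res_op_add: "res_op p t n (\<lambda>xs. f xs + g xs) xs = res_op p t n f xs + res_op p t n g xs"
  and res_op_diff: "res_op p t n (\<lambda>xs. f xs - g xs) xs = res_op p t n f xs - res_op p t n g xs"
  and res_op_cmult: "res_op p t n (\<lambda>xs. c * f xs) xs = c * res_op p t n f xs"
  and res_op_zero: "res_op p t n (\<lambda>xs. 0) xs = 0"
  by (simp_all add: res_op_def norm_op_def diff_op_def sum.distrib sum_subtractf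
      sum_distrib_left algebra_simps)

lemma res_op_Suc_Suc [simp]: "res_op p t (Suc (Suc n)) = res_op p t n"
  by (simp add: res_op_def)

lemma res_op_cong: "(\<And>ys. length ys = length xs \<Longrightarrow> f ys = g ys) \<Longrightarrow> res_op p t n f xs = res_op p t n g xs"
  by (simp add: res_op_def norm_op_def diff_op_def)


subsection \<open>Free actions\<close>

locale Zp_action =
  fixes p :: nat and K :: "'a set set" and t :: "'a \<Rightarrow> 'a"
  assumes Zp: "Zp_complex p K t" and p_pos: "0 < p"
begin

lemma complex: "abstract_complex K"
  and t_permutes: "t permutes \<Union>K"
  and t_image: "(`) t ` K = K"
  and t_period: "t ^^ p = id"
  and t_free: "\<sigma> \<in> K \<Longrightarrow> \<sigma> \<noteq> {} \<Longrightarrow> \<not> p dvd k \<Longrightarrow> (t ^^ k) ` \<sigma> \<noteq> \<sigma>"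
  using Zp unfolding Zp_complex_def by blast+

lemma empty_in: "{} \<in> K" and finite_K: "finite K" and finite_simplex: "\<sigma> \<in> K \<Longrightarrow> finite \<sigma>"
  using complex unfolding abstract_complex_def by blast+

lemma t_bij: "bij t"
  using t_permutes by (rule permutes_bij)

lemma t_inj: "inj t" and t_pow_inj: "inj (t ^^ k)"
  using t_bij by (simp_all add: bij_is_inj inj_fn)

lemma t_image_in [simp]: "t ` \<sigma> \<in> K \<longleftrightarrow> \<sigma> \<in> K"
proof
  assume "t ` \<sigma> \<in> K"
  then obtain \<tau> where "\<tau> \<in> K" "t ` \<sigma> = t ` \<tau>" using t_image by blast
  then show "\<sigma> \<in> K" using inj_image_eq_iff[OF t_inj] by metis
qed (use t_image in blast)

lemma t_pow_image_in [simp]: "(t ^^ k) ` \<sigma> \<in> K \<longleftrightarrow> \<sigma> \<in> K"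
proof (induction k)
  case (Suc k)
  have "(t ^^ Suc k) ` \<sigma> = t ` (t ^^ k) ` \<sigma>" by (simp add: image_comp comp_def)
  then show ?case using Suc by simp
qed simp

lemma simplex_list_map [simp]:
  "simplex_list K (map t xs) \<longleftrightarrow> simplex_list K xs"
  "simplex_list K (map (t ^^ k) xs) \<longleftrightarrow> simplex_list K xs"
  by (simp_all add: simplex_list_def distinct_map inj_on_subset[OF t_inj]
      inj_on_subset[OF t_pow_inj])

lemma t_pow_mod: "t ^^ (k + p) = t ^^ k"
  by (simp add: funpow_add t_period)

lemma alternating_translate: "alternating f \<Longrightarrow> alternating (\<lambda>xs. f (map g xs))"
  unfolding alternating_def map_append list.map by blast

lemma alt_translate: "f \<in> alt K \<Longrightarrow> (\<lambda>xs. f (map (t ^^ k) xs)) \<in> alt K"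
  using alternating_translate[of f "t ^^ k"] by (simp add: alt_def)

lemma res_op_alt:
  assumes "f \<in> alt K"
  shows "res_op p t n f \<in> alt K"
proof -
  have "(\<lambda>xs. \<Sum>k<p. f (map (t ^^ k) xs)) \<in> alt K"
    by (intro alt_sum alt_translate assms)
  moreover have "(\<lambda>xs. f xs - f (map (t ^^ 1) xs)) \<in> alt K"
    by (intro alt_diff alt_translate assms)
  ultimately show ?thesis
    by (auto simp: res_op_def norm_op_def[abs_def] diff_op_def[abs_def])
qed

lemma res_op_alt_n: "f \<in> alt_n K n \<Longrightarrow> res_op p t m f \<in> alt_n K n"
  using res_op_alt[of f m] by (auto simp: alt_n_def res_op_def norm_op_def diff_op_def)

lemma coboundary_translate:
  "coboundary K (\<lambda>xs. f (map t xs)) xs = coboundary K f (map t xs)"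
  "coboundary K (\<lambda>xs. f (map (t ^^ k) xs)) xs = coboundary K f (map (t ^^ k) xs)"
  by (simp_all add: coboundary_eq list_cob_map)

lemma coboundary_res_op: "coboundary K (res_op p t n f) xs = res_op p t n (coboundary K f) xs"
  by (simp add: res_op_def norm_op_def[abs_def] diff_op_def[abs_def] coboundary_sum
      coboundary_diff coboundary_translate)

lemma norm_op_map_t: "norm_op p t f (map t xs) = norm_op p t f xs"
proof -
  have "norm_op p t f (map t xs) = (\<Sum>k<p. f (map (t ^^ Suc k) xs))"
    by (simp add: norm_op_def funpow_swap1 comp_def)
  also have "\<dots> = norm_op p t f xs"
    unfolding norm_op_def by (rule sum_shift_periodic) (simp add: t_period)
  finally show ?thesis .
qed

lemma norm_op_diff_op: "norm_op p t (diff_op t f) xs = 0"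
proof -
  have "norm_op p t (diff_op t f) xs = norm_op p t f xs - norm_op p t (\<lambda>xs. f (map t xs)) xs"
    by (simp add: norm_op_def diff_op_def sum_subtractf)
  also have "norm_op p t (\<lambda>xs. f (map t xs)) xs = norm_op p t f (map t xs)"
    by (simp add: norm_op_def funpow_swap1 comp_def)
  finally show ?thesis by (simp add: norm_op_map_t)
qed

lemma res_op_res_op: "res_op p t n (res_op p t (Suc n) f) xs = 0"
  by (auto simp: res_op_def norm_op_diff_op diff_op_def norm_op_map_t)

lemma norm_op_pow: "norm_op p t f (map (t ^^ k) xs) = norm_op p t f xs"
proof (induction k)
  case (Suc k)
  have "map (t ^^ Suc k) xs = map t (map (t ^^ k) xs)" by simp
  then show ?case using Suc norm_op_map_t[of f "map (t ^^ k) xs"] by metis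
qed simp

lemma norm_op_norm_op: "norm_op p t (norm_op p t f) xs = int p * norm_op p t f xs"
  by (subst norm_op_def) (simp add: norm_op_pow)


subsection \<open>Exactness\<close>

definition orb :: "'a set \<Rightarrow> 'a set set" where "orb \<sigma> = range (\<lambda>k. (t ^^ k) ` \<sigma>)"

text \<open>The choice is made from the orbit as a set, hence is the same for all simplices of the
  orbit.\<close>

definition rep :: "'a set \<Rightarrow> 'a set" where "rep \<sigma> = (SOME \<tau>. \<tau> \<in> orb \<sigma>)"

text \<open>The number of steps to the chosen simplex of the orbit; position 0 is a fundamental
  domain. It depends on the vertex set only, so conditions on it preserve alternation.\<close>

definition pos :: "'a list \<Rightarrow> nat" where
  "pos xs = (LEAST k. (t ^^ k) ` set xs = rep (set xs))"

lemma orb_t: "orb (t ` \<sigma>) = orb \<sigma>"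
proof -
  have 1: "(t ^^ k) ` t ` \<sigma> = (t ^^ Suc k) ` \<sigma>" for k
    by (simp add: image_comp funpow_Suc_right del: funpow.simps)
  have 2: "(t ^^ k) ` \<sigma> = (t ^^ (k + p - 1)) ` t ` \<sigma>" for k
    using p_pos unfolding 1 by (simp add: t_pow_mod del: funpow.simps)
  show ?thesis
    unfolding orb_def
  proof (intro equalityI image_subsetI)
    fix k
    show "(t ^^ k) ` t ` \<sigma> \<in> range (\<lambda>k. (t ^^ k) ` \<sigma>)" unfolding 1 by blast
    show "(t ^^ k) ` \<sigma> \<in> range (\<lambda>k. (t ^^ k) ` t ` \<sigma>)" unfolding 2[of k] by blast
  qed
qed

lemma rep_t: "rep (set (map t xs)) = rep (set xs)"
  by (simp add: rep_def orb_t)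

lemma pos_props:
  shows "pos xs < p" "(t ^^ pos xs) ` set xs = rep (set xs)"
proof -
  have "rep (set xs) \<in> orb (set xs)"
    unfolding rep_def by (rule someI[of _ "set xs"]) (auto simp: orb_def intro: range_eqI[of _ _ 0])
  then obtain k where k: "rep (set xs) = (t ^^ k) ` set xs" by (auto simp: orb_def)
  have "t ^^ k = t ^^ (k mod p)"
  proof (induction k rule: less_induct)
    case (less k)
    show ?case
    proof (cases "k < p")
      case False
      then have "t ^^ k = t ^^ (k - p)" using t_pow_mod[of "k - p"] by simp
      then show ?thesis using less[of "k - p"] False p_pos by (simp add: le_mod_geq)
    qed simp
  qed
  then have k': "(t ^^ (k mod p)) ` set xs = rep (set xs)" using k by simp
  show "(t ^^ pos xs) ` set xs = rep (set xs)"
    unfolding pos_def using k' by (rule LeastI)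
  have "pos xs \<le> k mod p" unfolding pos_def using k' by (rule Least_le)
  then show "pos xs < p" using p_pos by (meson mod_less_divisor le_less_trans)
qed

text \<open>Here freeness enters: two different steps below \<open>p\<close> with equal image would
  give a power of \<open>t\<close>, with exponent not divisible by \<open>p\<close>, that fixes a
  non-empty simplex.\<close>

lemma pos_unique:
  assumes "simplex_list K xs" "xs \<noteq> []" "j < p" "(t ^^ j) ` set xs = rep (set xs)"
  shows "j = pos xs"
proof -
  have *: "i = j" if "i \<le> j" "j < p" "(t ^^ i) ` set xs = (t ^^ j) ` set xs" for i j
  proof (rule ccontr)
    assume "i \<noteq> j"
    then have ij: "0 < j - i" "j - i < p" using that by auto
    have "(t ^^ i) ` (t ^^ (j - i)) ` set xs = (t ^^ i) ` set xs"
      using that by (simp add: image_comp funpow_add[symmetric])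
    then have "(t ^^ (j - i)) ` set xs = set xs"
      using inj_image_eq_iff[OF t_pow_inj] by metis
    moreover have "\<not> p dvd (j - i)" using ij by (simp add: nat_dvd_not_less)
    ultimately show False using t_free assms(1,2) by (auto simp: simplex_list_def)
  qed
  show ?thesis
    using *[of j "pos xs"] *[of "pos xs" j] pos_props[of xs] assms by (metis nle_le)
qed

lemma pos_t:
  assumes "simplex_list K xs" "xs \<noteq> []"
  shows "pos (map t xs) = (if pos xs = 0 then p - 1 else pos xs - 1)"
proof (rule sym, rule pos_unique)
  show "simplex_list K (map t xs)" "map t xs \<noteq> []" using assms by auto
  show "(if pos xs = 0 then p - 1 else pos xs - 1) < p" using p_pos pos_props[of xs] by auto
  have 1: "(t ^^ k) ` set (map t xs) = (t ^^ Suc k) ` set xs" for k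
    by (simp add: image_comp funpow_Suc_right del: funpow.simps)
  show "(t ^^ (if pos xs = 0 then p - 1 else pos xs - 1)) ` set (map t xs) = rep (set (map t xs))"
    unfolding 1 rep_t using pos_props(2)[of xs] p_pos t_period by (auto simp del: funpow.simps)
qed

lemma pos_pow_eq_0:
  assumes "simplex_list K xs" "xs \<noteq> []" "k < p"
  shows "pos (map (t ^^ k) xs) = 0 \<longleftrightarrow> k = pos xs"
proof -
  have rep: "rep (set (map (t ^^ k) xs)) = rep (set xs)" for k
  proof (induction k)
    case (Suc k)
    have "map (t ^^ Suc k) xs = map t (map (t ^^ k) xs)" by simp
    then show ?case using Suc rep_t[of "map (t ^^ k) xs"] by metis
  qed simp
  have "pos (map (t ^^ k) xs) = 0 \<longleftrightarrow> (t ^^ k) ` set xs = rep (set xs)"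
    using pos_props(2)[of "map (t ^^ k) xs"] pos_unique[of "map (t ^^ k) xs" 0] assms rep[of k] p_pos
    by fastforce
  then show ?thesis using pos_unique[OF assms] pos_props(2)[of xs] by metis
qed

text \<open>The kernel of d is the image of s: cut \<open>f\<close> down to the fundamental domain;
  as each simplex has exactly one translate there, the norm restores \<open>f\<close>. The condition
  \<open>0 < n\<close> keeps away the empty list, which is a fixed point.\<close>

lemma exact_norm:
  assumes f: "f \<in> alt_n K n" and n: "0 < n" and inv: "\<And>xs. f (map t xs) = f xs"
  obtains g where "g \<in> alt_n K n" "\<And>xs. norm_op p t g xs = f xs"
proof
  let ?g = "\<lambda>xs. if pos xs = 0 then f xs else 0"
  have P: "pos xs = pos ys" if "mset xs = mset ys" for xs ys
    using mset_eq_setD[OF that] by (simp add: pos_def)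
  have "?g \<in> alt K"
    by (rule alt_restrict[OF alt_n_alt[OF f]]) (metis P)
  then show "?g \<in> alt_n K n"
    using alt_n_outside[OF f] by (simp add: alt_n_def)
  have inv_pow: "f (map (t ^^ k) xs) = f xs" for k xs
  proof (induction k)
    case (Suc k)
    have "map (t ^^ Suc k) xs = map t (map (t ^^ k) xs)" by simp
    then show ?case using Suc inv by metis
  qed simp
  show "norm_op p t ?g xs = f xs" for xs
  proof (cases "simplex_list K xs \<and> xs \<noteq> []")
    case True
    have "norm_op p t ?g xs = (\<Sum>k<p. if k = pos xs then f xs else 0)"
      unfolding norm_op_def using True by (intro sum.cong) (auto simp: pos_pow_eq_0 inv_pow)
    also have "\<dots> = f xs" using pos_props(1)[of xs] by simp
    finally show ?thesis .
  next
    case False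
    then have "f xs = 0"
      using n alt_outside[OF alt_n_alt[OF f]] alt_n_outside[OF f, of "[]"] by auto
    then have "f (map (t ^^ k) xs) = 0" for k using inv_pow by simp
    then show ?thesis using \<open>f xs = 0\<close> unfolding norm_op_def by (intro trans[OF sum.neutral]) auto
  qed
qed

text \<open>The kernel of s is the image of d: sum \<open>f\<close> along the way from a simplex to
  the representative of its orbit; one step along the orbit drops one summand.\<close>

lemma exact_diff:
  assumes f: "f \<in> alt_n K n" and n: "0 < n" and inv: "\<And>xs. norm_op p t f xs = 0"
  obtains g where "g \<in> alt_n K n" "\<And>xs. diff_op t g xs = f xs"
proof
  let ?g = "\<lambda>xs. \<Sum>l<pos xs. f (map (t ^^ l) xs)"
  \<comment> \<open>A sum with varying bound becomes a fixed sum of restricted translates, which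
    shows that it is alternating.\<close>
  have eq: "?g = (\<lambda>xs. \<Sum>l<p. if l < pos xs then f (map (t ^^ l) xs) else 0)"
  proof
    fix xs
    have "{..<pos xs} = {l \<in> {..<p}. l < pos xs}" using pos_props(1)[of xs] by auto
    then show "?g xs = (\<Sum>l<p. if l < pos xs then f (map (t ^^ l) xs) else 0)"
      using sum.inter_filter[of "{..<p}" "\<lambda>l. f (map (t ^^ l) xs)" "\<lambda>l. l < pos xs"] by simp
  qed
  have P: "pos xs = pos ys" if "mset xs = mset ys" for xs ys
    using mset_eq_setD[OF that] by (simp add: pos_def)
  have "?g \<in> alt K"
    unfolding eq
  proof (rule alt_sum)
    fix l
    show "(\<lambda>xs. if l < pos xs then f (map (t ^^ l) xs) else 0) \<in> alt K"
      by (rule alt_restrict[OF alt_translate[OF alt_n_alt[OF f]], of "\<lambda>xs. l < pos xs"])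
        (metis P)
  qed
  then show "?g \<in> alt_n K n" using alt_n_outside[OF f] by (simp add: alt_n_def)
  show "diff_op t ?g xs = f xs" for xs
  proof (cases "simplex_list K xs \<and> xs \<noteq> []")
    case True
    have 1: "f (map (t ^^ l) (map t xs)) = f (map (t ^^ Suc l) xs)" for l
      by (simp add: funpow_swap1 comp_def)
    have 2: "?g (map t xs) = (\<Sum>l<pos (map t xs). f (map (t ^^ Suc l) xs))"
      by (simp only: 1)
    show ?thesis
    proof (cases "pos xs")
      \<comment> \<open>At the representative the sum is empty, while its translate has to run
        through the rest of the orbit. The vanishing norm closes the circle.\<close>
      case 0
      obtain q where q: "p = Suc q" using p_pos gr0_implies_Suc by blast
      have "?g (map t xs) = (\<Sum>l<q. f (map (t ^^ Suc l) xs))"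
        unfolding 2 using pos_t[of xs] True 0 q by simp
      moreover have "norm_op p t f xs = f xs + (\<Sum>l<q. f (map (t ^^ Suc l) xs))"
        unfolding norm_op_def q sum.lessThan_Suc_shift by simp
      ultimately show ?thesis using inv[of xs] 0 by (simp add: diff_op_def)
    next
      case (Suc k)
      have "?g (map t xs) = (\<Sum>l<k. f (map (t ^^ Suc l) xs))"
        unfolding 2 using pos_t[of xs] True Suc by simp
      moreover have "?g xs = f xs + (\<Sum>l<k. f (map (t ^^ Suc l) xs))"
        unfolding Suc sum.lessThan_Suc_shift by simp
      ultimately show ?thesis by (simp add: diff_op_def)
    qed
  next
    case False
    then have "f (map (t ^^ l) xs) = 0" "f xs = 0" "f (map (t ^^ l) (map t xs)) = 0" for l
      using f n alt_outside[OF alt_n_alt[OF f]] alt_n_outside[OF f]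
      by (auto simp del: map_map simp: Nil_is_map_conv)
    then show ?thesis by (simp add: diff_op_def del: map_map)
  qed
qed

lemma exact_res_op:
  assumes "f \<in> alt_n K n" "0 < n" "\<And>xs. res_op p t m f xs = 0"
  obtains g where "g \<in> alt_n K n" "\<And>xs. res_op p t (Suc m) g xs = f xs"
proof (cases "odd m")
  case True
  then show ?thesis using exact_diff[OF assms(1,2)] assms(3) that by (auto simp: res_op_def)
next
  case False
  then show ?thesis using exact_norm[OF assms(1,2)] assms(3) that
    by (auto simp: res_op_def diff_op_def)
qed


subsection \<open>Resolutions\<close>

text \<open>As \<open>F [] = 1\<close>, the coboundary on lists of length 1 is the unit cochain, so
  this one equation also contains the initial condition on the term of degree 0.\<close>

definition resolution :: "('a list \<Rightarrow> int) \<Rightarrow> bool" where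
  "resolution F \<longleftrightarrow> F \<in> alt K \<and> F [] = 1 \<and>
     (\<forall>xs. coboundary K F xs = res_op p t (length xs) F xs)"

definition assemble :: "(nat \<Rightarrow> 'a list \<Rightarrow> int) \<Rightarrow> 'a list \<Rightarrow> int" where
  "assemble \<phi> xs = (if xs = [] then 1 else \<phi> (length xs - 1) xs)"

lemma unit_cochain_eq: "unit_cochain K xs = coboundary K (\<lambda>ys. if ys = [] then 1 else 0) xs"
proof (cases "length xs = 1")
  case True
  then obtain v where "xs = [v]" by (cases xs) auto
  then show ?thesis
    by (simp add: unit_cochain_def coboundary_eq simplex_list_def ordered_simplices_def list_cob_Cons)
next
  case False
  then have "list_cob (\<lambda>ys. if ys = [] then 1 else 0) xs = list_cob (\<lambda>xs. 0) xs"
    by (intro list_cob_cong) auto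
  then show ?thesis using False
    by (simp add: unit_cochain_def ordered_simplices_def coboundary_eq list_cob_zero)
qed

lemma empty_unit_alt_n: "(\<lambda>ys. if ys = [] then 1 else 0) \<in> alt_n K 0"
  using empty_in by (auto simp: alt_n_def alt_def alternating_def simplex_list_def)

lemma unit_cochain_alt_n: "unit_cochain K \<in> alt_n K 1"
proof -
  have "unit_cochain K = coboundary K (\<lambda>ys. if ys = [] then 1 else 0)"
    by (rule ext) (rule unit_cochain_eq)
  then show ?thesis using coboundary_alt_n[OF empty_unit_alt_n] by simp
qed

lemma assemble_alt:
  assumes "\<And>j. \<phi> j \<in> alt_n K (Suc j)"
  shows "assemble \<phi> \<in> alt K"
proof -
  have "assemble \<phi> (xs @ a # b # ys) = - assemble \<phi> (xs @ b # a # ys)" for xs a b ys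
    by (simp add: assemble_def alternatingD[OF alt_alternating[OF alt_n_alt[OF assms]], of _ xs a b ys])
  then have "alternating (assemble \<phi>)"
    unfolding alternating_def by blast
  then show ?thesis
    using alt_outside[OF alt_n_alt[OF assms]] empty_in
    by (auto simp: alt_def assemble_def simplex_list_def)
qed

lemma part_assemble: "(\<And>j. \<phi> j \<in> alt_n K (Suc j)) \<Longrightarrow> part (Suc j) (assemble \<phi>) = \<phi> j"
  by (auto simp: fun_eq_iff part_def assemble_def alt_n_def)

lemma resolution_of_1_iff:
  assumes "\<And>j. \<phi> j \<in> alt_n K (Suc j)"
  shows "resolution_of_1 p K t \<phi> \<longleftrightarrow> resolution (assemble \<phi>)"
proof -
  have 0: "coboundary K (assemble \<phi>) xs = unit_cochain K xs" if "length xs = 1" for xs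
  proof -
    have "list_cob (assemble \<phi>) xs = list_cob (\<lambda>ys. if ys = [] then 1 else 0) xs"
      by (intro list_cob_cong) (use that in \<open>auto simp: assemble_def\<close>)
    then show ?thesis by (simp add: unit_cochain_eq coboundary_eq)
  qed
  have 1: "coboundary K (assemble \<phi>) xs = coboundary K (\<phi> j) xs" if "length xs = Suc (Suc j)" for xs j
  proof -
    have "list_cob (assemble \<phi>) xs = list_cob (\<phi> j) xs"
      by (intro list_cob_cong) (use that in \<open>auto simp: assemble_def\<close>)
    then show ?thesis by (simp add: coboundary_eq)
  qed
  have 2: "res_op p t n (assemble \<phi>) xs = res_op p t n (\<phi> j) xs" if "length xs = Suc j" for n xs j
    by (intro res_op_cong) (use that in \<open>auto simp: assemble_def\<close>)
  have "resolution (assemble \<phi>) \<longleftrightarrow>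
      (\<forall>xs. coboundary K (assemble \<phi>) xs = res_op p t (length xs) (assemble \<phi>) xs)"
    using assemble_alt[OF assms] by (simp add: resolution_def assemble_def)
  also have "\<dots> \<longleftrightarrow> (\<forall>n xs. length xs = n \<longrightarrow>
      coboundary K (assemble \<phi>) xs = res_op p t n (assemble \<phi>) xs)" by blast
  also have "\<dots> \<longleftrightarrow> (\<forall>xs. length xs = 1 \<longrightarrow> res_op p t 1 (\<phi> 0) xs = unit_cochain K xs) \<and>
      (\<forall>j xs. length xs = Suc (Suc j) \<longrightarrow> coboundary K (\<phi> j) xs = res_op p t (Suc (Suc j)) (\<phi> (Suc j)) xs)"
    (is "?L \<longleftrightarrow> ?A \<and> ?B")
  proof (intro iffI conjI allI impI)
    fix xs :: "'a list" assume L: ?L and l: "length xs = 1"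
    show "res_op p t 1 (\<phi> 0) xs = unit_cochain K xs"
      using L[rule_format, OF l] 0[OF l] 2[of xs 0 1] l by simp
  next
    fix xs :: "'a list" and j assume L: ?L and l: "length xs = Suc (Suc j)"
    show "coboundary K (\<phi> j) xs = res_op p t (Suc (Suc j)) (\<phi> (Suc j)) xs"
      using L[rule_format, OF l] 1[OF l] 2[OF l, of "Suc (Suc j)"] by simp
  next
    fix n and xs :: "'a list" assume AB: "?A \<and> ?B" and l: "length xs = n"
    consider (zero) "n = 0" | (one) "n = 1" | (two) j where "n = Suc (Suc j)"
      by (metis One_nat_def not0_implies_Suc)
    then show "coboundary K (assemble \<phi>) xs = res_op p t n (assemble \<phi>) xs"
    proof cases
      case zero
      then show ?thesis using l by (simp add: coboundary_eq res_op_def diff_op_def)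
    next
      case one
      have "res_op p t 1 (\<phi> 0) xs = unit_cochain K xs" using AB l one by blast
      then show ?thesis using 0[of xs] 2[of xs 0 1] l one by simp
    next
      case two
      have "coboundary K (\<phi> j) xs = res_op p t (Suc (Suc j)) (\<phi> (Suc j)) xs" using AB l two by blast
      then show ?thesis using 1[of xs j] 2[of xs "Suc j" n] l two by simp
    qed
  qed
  also have "?A \<longleftrightarrow> op_s p (cochain_map t) (\<phi> 0) = unit_cochain K"
  proof -
    have "res_op p t 1 (\<phi> 0) xs = unit_cochain K xs" if "length xs \<noteq> 1" for xs
      using alt_n_outside[OF res_op_alt_n[OF assms[of 0]]] alt_n_outside[OF unit_cochain_alt_n] that
      by simp
    then have "?A \<longleftrightarrow> (\<forall>xs. res_op p t 1 (\<phi> 0) xs = unit_cochain K xs)" by metis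
    then show ?thesis by (simp add: op_s_cochain_map res_op_def fun_eq_iff)
  qed
  also have "?B \<longleftrightarrow> (\<forall>j. coboundary K (\<phi> j) = res_op p t j (\<phi> (Suc j)))"
  proof -
    have "coboundary K (\<phi> j) xs = res_op p t (Suc (Suc j)) (\<phi> (Suc j)) xs"
      if "length xs \<noteq> Suc (Suc j)" for j xs
      using alt_n_outside[OF res_op_alt_n[OF assms[of "Suc j"]]]
        alt_n_outside[OF coboundary_alt_n[OF assms[of j]]] that by simp
    then have "?B \<longleftrightarrow> (\<forall>j xs. coboundary K (\<phi> j) xs = res_op p t (Suc (Suc j)) (\<phi> (Suc j)) xs)"
      by metis
    then show ?thesis by (simp add: fun_eq_iff)
  qed
  also have "(\<forall>j. coboundary K (\<phi> j) = res_op p t j (\<phi> (Suc j))) \<longleftrightarrow>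
      (\<forall>j. even j \<longrightarrow> coboundary K (\<phi> j) = op_d (cochain_map t) (\<phi> (Suc j))) \<and>
      (\<forall>j. odd j \<longrightarrow> coboundary K (\<phi> j) = op_s p (cochain_map t) (\<phi> (Suc j)))"
    unfolding op_s_cochain_map op_d_cochain_map res_op_def by auto
  finally show ?thesis
    using assms by (simp add: resolution_of_1_def alternating_functions_eq_alt_n)
qed

text \<open>The terms are lifted one after another through the exactness of s and d, which is
  available because the coboundary commutes with both.\<close>

lemma resolution_exists: "\<exists>F. resolution F"
proof -
  obtain g0 where g0: "g0 \<in> alt_n K 1" "\<And>xs. res_op p t 1 g0 xs = unit_cochain K xs"
    using exact_res_op[OF unit_cochain_alt_n, of 0] 
    by (auto simp: unit_cochain_def ordered_simplices_def res_op_def diff_op_def distinct_map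
        inj_on_subset[OF t_inj])
  have cc: "coboundary K (unit_cochain K) xs = 0" for xs
    unfolding unit_cochain_eq[abs_def] by (rule coboundary_coboundary[OF complex])
  \<comment> \<open>The carried invariant says that the coboundary of the current term lies in the
    kernel of the right operator and can be lifted. It starts with the unit cochain, which is
    closed, and persists because the lifted equation exhibits a coboundary.\<close>
  have "\<exists>\<phi>. \<forall>j. (\<phi> j \<in> alt_n K (Suc j) \<and> (\<forall>xs. coboundary K (res_op p t (Suc j) (\<phi> j)) xs = 0)
        \<and> (j = 0 \<longrightarrow> \<phi> j = g0)) \<and>
      (\<forall>xs. coboundary K (\<phi> j) xs = res_op p t j (\<phi> (Suc j)) xs)"
  proof (rule dependent_nat_choice)
    have "res_op p t (Suc 0) g0 = unit_cochain K" using g0(2) by (auto simp: fun_eq_iff)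
    then show "\<exists>x. x \<in> alt_n K (Suc 0) \<and> (\<forall>xs. coboundary K (res_op p t (Suc 0) x) xs = 0)
        \<and> ((0::nat) = 0 \<longrightarrow> x = g0)"
      using g0(1) cc by (intro exI[of _ g0]) simp
  next
    fix x n assume x: "x \<in> alt_n K (Suc n) \<and> (\<forall>xs. coboundary K (res_op p t (Suc n) x) xs = 0)
        \<and> (n = 0 \<longrightarrow> x = g0)"
    have "coboundary K x \<in> alt_n K (Suc (Suc n))" using x coboundary_alt_n by blast
    moreover have "res_op p t (Suc n) (coboundary K x) xs = 0" for xs
      using x coboundary_res_op by metis
    ultimately obtain y where y: "y \<in> alt_n K (Suc (Suc n))"
        "\<And>xs. res_op p t (Suc (Suc n)) y xs = coboundary K x xs"
      using exact_res_op by blast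
    have "res_op p t (Suc (Suc n)) y = coboundary K x" using y(2) by blast
    then show "\<exists>y. (y \<in> alt_n K (Suc (Suc n)) \<and> (\<forall>xs. coboundary K (res_op p t (Suc (Suc n)) y) xs = 0)
        \<and> (Suc n = 0 \<longrightarrow> y = g0)) \<and> (\<forall>xs. coboundary K x xs = res_op p t n y xs)"
      using y coboundary_coboundary[OF complex] by (intro exI[of _ y]) auto
  qed
  then obtain \<phi> where \<phi>: "\<And>j. \<phi> j \<in> alt_n K (Suc j)" "\<phi> 0 = g0"
      "\<And>j xs. coboundary K (\<phi> j) xs = res_op p t j (\<phi> (Suc j)) xs" by blast
  have "resolution_of_1 p K t \<phi>"
  proof -
    have "norm_op p t (\<phi> 0) = unit_cochain K" unfolding \<phi>(2) using g0(2) by (simp add: fun_eq_iff res_op_def)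
    then show ?thesis
      using \<phi>(1,3) by (simp add: resolution_of_1_def alternating_functions_eq_alt_n op_s_cochain_map
          op_d_cochain_map res_op_def fun_eq_iff)
  qed
  then show ?thesis using resolution_of_1_iff[OF \<phi>(1)] by blast
qed

text \<open>The comparison argument for independence of the resolution. The condition
  \<open>\<chi> [] = 0\<close> matters for \<open>n = 0\<close> only, where no correction is
  permitted because there are no cochains below degree 0.\<close>

lemma resolution_difference:
  assumes F: "resolution F" and G: "resolution G"
  shows "\<exists>\<chi>\<in>alt_n K n. \<chi> [] = 0 \<and> (\<forall>xs. length xs = Suc n \<longrightarrow>
      res_op p t (Suc n) F xs - res_op p t (Suc n) G xs = coboundary K (res_op p t (Suc n) \<chi>) xs)"
proof (induction n)
  case 0
  have "res_op p t (Suc 0) F xs = res_op p t (Suc 0) G xs" if "length xs = Suc 0" for xs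
  proof -
    have "list_cob F xs = list_cob G xs"
      by (rule list_cob_cong) (use that F G in \<open>auto simp: resolution_def\<close>)
    then have "coboundary K F xs = coboundary K G xs" by (simp add: coboundary_eq)
    then show ?thesis using F G that by (simp add: resolution_def)
  qed
  then show ?case
    by (intro bexI[of _ "\<lambda>_. 0"])
      (simp_all add: alt_n_zero res_op_zero coboundary_zero res_op_zero[abs_def])
next
  case (Suc n)
  then obtain \<chi> where \<chi>: "\<chi> \<in> alt_n K n" "\<chi> [] = 0"
    "\<And>xs. length xs = Suc n \<Longrightarrow>
      res_op p t (Suc n) F xs - res_op p t (Suc n) G xs = coboundary K (res_op p t (Suc n) \<chi>) xs"
    by blast
  \<comment> \<open>The difference of the terms, corrected by the previous homotopy, is killed by
    the operator; its preimage under the next operator is the new homotopy.\<close>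
  let ?w = "\<lambda>xs. part (Suc n) F xs - part (Suc n) G xs - coboundary K \<chi> xs"
  have w: "?w \<in> alt_n K (Suc n)"
    using F G \<chi> by (intro alt_n_diff part_alt_n coboundary_alt_n) (auto simp: resolution_def)
  have "res_op p t (Suc n) ?w xs = 0" for xs
  proof (cases "length xs = Suc n")
    case True
    have "res_op p t (Suc n) (part (Suc n) F) xs = res_op p t (Suc n) F xs"
      "res_op p t (Suc n) (part (Suc n) G) xs = res_op p t (Suc n) G xs"
      using True by (auto intro!: res_op_cong simp: part_def)
    then show ?thesis using \<chi>(3)[OF True] by (simp add: res_op_diff coboundary_res_op)
  next
    case False
    then show ?thesis using res_op_alt_n[OF w] alt_n_outside by blast
  qed
  then obtain \<eta> where \<eta>: "\<eta> \<in> alt_n K (Suc n)" "\<And>xs. res_op p t (Suc (Suc n)) \<eta> xs = ?w xs"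
    using exact_res_op[OF w] by blast
  have "res_op p t (Suc (Suc n)) F xs - res_op p t (Suc (Suc n)) G xs =
      coboundary K (res_op p t (Suc (Suc n)) \<eta>) xs" if l: "length xs = Suc (Suc n)" for xs
  proof -
    have "res_op p t (Suc (Suc n)) F xs - res_op p t (Suc (Suc n)) G xs =
        coboundary K F xs - coboundary K G xs"
      using F G l by (simp add: resolution_def)
    also have "\<dots> = coboundary K ?w xs"
      using l by (simp add: coboundary_diff coboundary_part coboundary_coboundary[OF complex])
    also have "?w = res_op p t (Suc (Suc n)) \<eta>" using \<eta>(2) by (simp add: fun_eq_iff)
    finally show ?thesis .
  qed
  moreover have "\<eta> [] = 0" using alt_n_outside[OF \<eta>(1), of "[]"] by simp
  ultimately show ?case using \<eta>(1) by blast
qed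

end

subsection \<open>Cohomology of complexes of integer-valued functions\<close>

text \<open>A bridge from cosets in HOL-Algebra to pointwise formulas: classes become congruences
  modulo the subgroup of coboundaries.\<close>

locale function_complex =
  fixes S :: "nat \<Rightarrow> ('x \<Rightarrow> int) set" and \<delta> :: "nat \<Rightarrow> ('x \<Rightarrow> int) \<Rightarrow> 'x \<Rightarrow> int"
    and G :: "nat \<Rightarrow> ('x \<Rightarrow> int) monoid"
  assumes carrier_G: "carrier (G j) = S j"
    and mult_G: "monoid.mult (G j) x y = (\<lambda>v. x v + y v)"
    and one_G: "one (G j) = (\<lambda>v. 0)"
    and zero_S: "(\<lambda>v. 0) \<in> S j"
    and add_S: "x \<in> S j \<Longrightarrow> y \<in> S j \<Longrightarrow> (\<lambda>v. x v + y v) \<in> S j"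
    and minus_S: "x \<in> S j \<Longrightarrow> (\<lambda>v. - x v) \<in> S j"
    and \<delta>_S: "x \<in> S j \<Longrightarrow> \<delta> j x \<in> S (Suc j)"
    and \<delta>_add: "\<delta> j (\<lambda>v. x v + y v) = (\<lambda>v. \<delta> j x v + \<delta> j y v)"
begin

abbreviation "B \<equiv> coboundaries G \<delta>"

lemma \<delta>_zero: "\<delta> j (\<lambda>v. 0) = (\<lambda>v. 0)"
  using \<delta>_add[of j "\<lambda>v. 0" "\<lambda>v. 0"] by (auto simp: fun_eq_iff)

lemma \<delta>_minus: "\<delta> j (\<lambda>v. - x v) = (\<lambda>v. - \<delta> j x v)"
  using \<delta>_add[of j x "\<lambda>v. - x v"] by (auto simp: fun_eq_iff \<delta>_zero eq_neg_iff_add_eq_0 add.commute)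

lemma \<delta>_mult: "\<delta> j (\<lambda>v. int n * x v) = (\<lambda>v. int n * \<delta> j x v)"
  by (induction n) (simp_all add: \<delta>_zero \<delta>_add algebra_simps)

lemma B_zero: "(\<lambda>v. 0) \<in> B j"
  using zero_S \<delta>_zero
  by (cases j) (auto simp: coboundaries_def one_G carrier_G intro!: image_eqI[of _ _ "\<lambda>v. 0"])

lemma B_add:
  assumes "x \<in> B j" "y \<in> B j"
  shows "(\<lambda>v. x v + y v) \<in> B j"
proof (cases j)
  case (Suc i)
  then obtain a b where "a \<in> S i" "b \<in> S i" "x = \<delta> i a" "y = \<delta> i b"
    using assms by (auto simp: coboundaries_def carrier_G)
  then show ?thesis using Suc add_S \<delta>_add[of i a b]
    by (auto simp: coboundaries_def carrier_G intro!: image_eqI[of _ _ "\<lambda>v. a v + b v"])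
qed (use assms in \<open>simp add: coboundaries_def one_G\<close>)

lemma B_minus:
  assumes "x \<in> B j"
  shows "(\<lambda>v. - x v) \<in> B j"
proof (cases j)
  case (Suc i)
  then obtain a where "a \<in> S i" "x = \<delta> i a"
    using assms by (auto simp: coboundaries_def carrier_G)
  then show ?thesis using Suc minus_S \<delta>_minus[of i a]
    by (auto simp: coboundaries_def carrier_G intro!: image_eqI[of _ _ "\<lambda>v. - a v"])
qed (use assms in \<open>simp add: coboundaries_def one_G\<close>)

lemma B_diff: "x \<in> B j \<Longrightarrow> y \<in> B j \<Longrightarrow> (\<lambda>v. x v - y v) \<in> B j"
  using B_add[of x j "\<lambda>v. - y v"] B_minus[of y j] by simp

lemma class_eq: "cohomology_class G \<delta> j x = (\<lambda>b v. b v + x v) ` B j"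
  unfolding cohomology_class_def r_coset_def mult_G by blast

lemma one_cohomology: "one (cohomology G \<delta> j) = B j"
  by (simp add: cohomology_def FactGroup_def)

lemma class_eq_class_iff:
  "cohomology_class G \<delta> j x = cohomology_class G \<delta> j y \<longleftrightarrow> (\<lambda>v. x v - y v) \<in> B j"
proof
  assume eq: "cohomology_class G \<delta> j x = cohomology_class G \<delta> j y"
  have "x \<in> cohomology_class G \<delta> j x"
    unfolding class_eq by (rule image_eqI[OF _ B_zero]) simp
  then have "x \<in> cohomology_class G \<delta> j y" using eq by simp
  then obtain b where b: "b \<in> B j" "x = (\<lambda>v. b v + y v)" unfolding class_eq by (rule imageE)
  then have "(\<lambda>v. x v - y v) = b" by (simp add: fun_eq_iff)
  then show "(\<lambda>v. x v - y v) \<in> B j" using b(1) by simp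
next
  assume *: "(\<lambda>v. x v - y v) \<in> B j"
  show "cohomology_class G \<delta> j x = cohomology_class G \<delta> j y"
    unfolding class_eq
  proof (intro equalityI image_subsetI)
    fix b assume b: "b \<in> B j"
    show "(\<lambda>v. b v + x v) \<in> (\<lambda>b v. b v + y v) ` B j"
      by (rule image_eqI[OF _ B_add[OF b *]]) simp
    show "(\<lambda>v. b v + y v) \<in> (\<lambda>b v. b v + x v) ` B j"
      by (rule image_eqI[OF _ B_diff[OF b *]]) simp
  qed
qed

lemma class_eq_one_iff: "cohomology_class G \<delta> j x = one (cohomology G \<delta> j) \<longleftrightarrow> x \<in> B j"
proof -
  have "cohomology_class G \<delta> j (\<lambda>v. 0) = B j" by (simp add: class_eq)
  then show ?thesis
    using class_eq_class_iff[of j x "\<lambda>v. 0"] by (simp add: one_cohomology)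
qed

section \<open>Coefficient reduction on cosets\<close>

definition mod_coset :: "nat \<Rightarrow> nat \<Rightarrow> ('x \<Rightarrow> int) \<Rightarrow> ('x \<Rightarrow> int) set" where
  "mod_coset n j x = (\<lambda>y v. int n * y v + x v) ` S j"

lemma multiples_eq: "multiples n (G j) = mod_coset n j (\<lambda>v. 0)"
proof -
  have "x [^]\<^bsub>G j\<^esub> n = (\<lambda>v. int n * x v)" for x
    by (induction n) (simp_all add: nat_pow_def one_G mult_G algebra_simps)
  then show ?thesis unfolding multiples_def mod_coset_def carrier_G by auto
qed

lemma mod_coset_eq: "multiples n (G j) #>\<^bsub>G j\<^esub> x = mod_coset n j x"
  unfolding multiples_eq r_coset_def mult_G mod_coset_def by auto

lemma mod_coset_add:
  "mod_coset n j x <#>\<^bsub>G j\<^esub> mod_coset n j y = mod_coset n j (\<lambda>v. x v + y v)"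
proof (intro equalityI subsetI)
  fix z assume "z \<in> mod_coset n j x <#>\<^bsub>G j\<^esub> mod_coset n j y"
  then obtain a b where ab: "a \<in> S j" "b \<in> S j"
    "z = (\<lambda>v. (int n * a v + x v) + (int n * b v + y v))"
    unfolding set_mult_def mod_coset_def mult_G by auto
  show "z \<in> mod_coset n j (\<lambda>v. x v + y v)"
    unfolding mod_coset_def
    by (rule image_eqI[OF _ add_S[OF ab(1,2)]]) (simp add: ab(3) algebra_simps)
next
  fix z assume "z \<in> mod_coset n j (\<lambda>v. x v + y v)"
  then obtain a where a: "a \<in> S j" "z = (\<lambda>v. int n * a v + (x v + y v))"
    unfolding mod_coset_def by (rule imageE)
  have "z = monoid.mult (G j) (\<lambda>v. int n * a v + x v) y"
    unfolding mult_G a(2) by (simp add: add.assoc)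
  moreover have "(\<lambda>v. int n * a v + x v) \<in> mod_coset n j x"
    unfolding mod_coset_def using a(1) by (rule imageI)
  moreover have "y \<in> mod_coset n j y"
    unfolding mod_coset_def by (rule image_eqI[OF _ zero_S]) simp
  ultimately show "z \<in> mod_coset n j x <#>\<^bsub>G j\<^esub> mod_coset n j y"
    unfolding set_mult_def by blast
qed

lemma mod_coset_self: "x \<in> mod_coset n j x"
  unfolding mod_coset_def by (rule image_eqI[OF _ zero_S]) simp

lemma mod_coset_cong:
  assumes a: "a \<in> S j" and x: "x = (\<lambda>v. int n * a v + y v)"
  shows "mod_coset n j x = mod_coset n j y"
  unfolding mod_coset_def
proof (intro equalityI image_subsetI)
  fix b assume b: "b \<in> S j"
  show "(\<lambda>v. int n * b v + x v) \<in> (\<lambda>b v. int n * b v + y v) ` S j"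
    by (rule image_eqI[OF _ add_S[OF b a]]) (simp add: x algebra_simps)
  show "(\<lambda>v. int n * b v + y v) \<in> (\<lambda>b v. int n * b v + x v) ` S j"
    by (rule image_eqI[OF _ add_S[OF b minus_S[OF a]]]) (simp add: x algebra_simps)
qed

text \<open>The map induced on quotients sends a coset to its image multiplied by the full subgroup
  of multiples, so one element of the image already produces the whole target coset.\<close>

lemma tensor_coboundaries:
  "coboundaries (tensor_group n G) (tensor_map n G \<delta>) j = mod_coset n j ` B j"
proof (cases j)
  case 0
  then show ?thesis
    by (simp add: coboundaries_def tensor_group_def FactGroup_def multiples_eq one_G)
next
  case (Suc i)
  have "tensor_map n G \<delta> i (mod_coset n i c) = mod_coset n j (\<delta> i c)" if "c \<in> S i" for c
  proof -
    have "tensor_map n G \<delta> i (mod_coset n i c) =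
        mod_coset n j (\<lambda>v. 0) <#>\<^bsub>G j\<^esub> (\<delta> i ` mod_coset n i c)"
      by (simp add: tensor_map_def quotient_map_def multiples_eq Suc)
    also have "\<dots> = mod_coset n j (\<delta> i c)"
    proof (rule equalityI)
      have "\<delta> i ` mod_coset n i c \<subseteq> mod_coset n j (\<delta> i c)"
      proof (intro image_subsetI)
        fix z assume "z \<in> mod_coset n i c"
        then obtain a where a: "a \<in> S i" "z = (\<lambda>v. int n * a v + c v)"
          unfolding mod_coset_def by (rule imageE)
        have "\<delta> i z = (\<lambda>v. int n * \<delta> i a v + \<delta> i c v)"
          unfolding a(2) by (subst \<delta>_add) (simp add: \<delta>_mult)
        then show "\<delta> i z \<in> mod_coset n j (\<delta> i c)"
          unfolding mod_coset_def using \<delta>_S[OF a(1)] Suc by simp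
      qed
      then have "mod_coset n j (\<lambda>v. 0) <#>\<^bsub>G j\<^esub> (\<delta> i ` mod_coset n i c)
          \<subseteq> mod_coset n j (\<lambda>v. 0) <#>\<^bsub>G j\<^esub> mod_coset n j (\<delta> i c)"
        unfolding set_mult_def by blast
      then show "mod_coset n j (\<lambda>v. 0) <#>\<^bsub>G j\<^esub> (\<delta> i ` mod_coset n i c) \<subseteq> mod_coset n j (\<delta> i c)"
        by (simp add: mod_coset_add)
      show "mod_coset n j (\<delta> i c) \<subseteq> mod_coset n j (\<lambda>v. 0) <#>\<^bsub>G j\<^esub> (\<delta> i ` mod_coset n i c)"
      proof
        fix z assume "z \<in> mod_coset n j (\<delta> i c)"
        then obtain a where a: "a \<in> S j" "z = (\<lambda>v. int n * a v + \<delta> i c v)"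
          unfolding mod_coset_def by (rule imageE)
        have "(\<lambda>v. int n * a v) \<in> mod_coset n j (\<lambda>v. 0)"
          unfolding mod_coset_def by (rule image_eqI[OF _ a(1)]) simp
        moreover have "\<delta> i c \<in> \<delta> i ` mod_coset n i c" using mod_coset_self by (rule imageI)
        moreover have "z = monoid.mult (G j) (\<lambda>v. int n * a v) (\<delta> i c)"
          unfolding mult_G a(2) by (rule refl)
        ultimately show "z \<in> mod_coset n j (\<lambda>v. 0) <#>\<^bsub>G j\<^esub> (\<delta> i ` mod_coset n i c)"
          unfolding set_mult_def by blast
      qed
    qed
    finally show ?thesis .
  qed
  moreover have "carrier (tensor_group n G i) = mod_coset n i ` S i"
    by (auto simp: tensor_group_def FactGroup_def RCOSETS_def mod_coset_eq carrier_G)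
  ultimately show ?thesis
    unfolding coboundaries_def Suc by (auto simp: image_image carrier_G Suc)
qed

text \<open>The tensor product is formed for the subcomplex, so the error is \<open>n\<close> times
  an element of \<open>S j\<close> and not just a cochain divisible by \<open>n\<close>. For Smith
  classes, exactness later writes this element as a value of s or d.\<close>

lemma reduce_class_eq_one_iff:
  "reduce_class n G \<delta> j (cohomology_class G \<delta> j x) =
     one (cohomology (tensor_group n G) (tensor_map n G \<delta>) j) \<longleftrightarrow>
   (\<exists>b\<in>B j. \<exists>y\<in>S j. x = (\<lambda>v. b v + int n * y v))"
proof -
  let ?C = "cohomology_class G \<delta> j x"
  have one: "one (cohomology (tensor_group n G) (tensor_map n G \<delta>) j) = mod_coset n j ` B j"
    by (simp add: cohomology_def FactGroup_def tensor_coboundaries)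
  have mult: "monoid.mult (tensor_group n G j) X Y = X <#>\<^bsub>G j\<^esub> Y" for X Y
    by (simp add: tensor_group_def FactGroup_def)
  have "reduce_class n G \<delta> j ?C =
      mod_coset n j ` B j <#>\<^bsub>tensor_group n G j\<^esub> (mod_coset n j ` ?C)"
    by (simp add: reduce_class_def quotient_map_def tensor_coboundaries mod_coset_eq)
  also have "\<dots> = (\<Union>b\<in>B j. \<Union>c\<in>B j. {mod_coset n j (\<lambda>v. b v + (c v + x v))})"
    unfolding set_mult_def[of "tensor_group n G j"] mult class_eq by (simp add: mod_coset_add)
  also have "\<dots> = (\<lambda>b. mod_coset n j (\<lambda>v. b v + x v)) ` B j"
  proof (intro equalityI UN_least image_subsetI)
    fix b c assume b: "b \<in> B j" and c: "c \<in> B j"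
    have "mod_coset n j (\<lambda>v. b v + (c v + x v)) \<in> (\<lambda>b. mod_coset n j (\<lambda>v. b v + x v)) ` B j"
      by (rule image_eqI[OF _ B_add[OF b c]]) (simp add: add.assoc)
    then show "{mod_coset n j (\<lambda>v. b v + (c v + x v))} \<subseteq> (\<lambda>b. mod_coset n j (\<lambda>v. b v + x v)) ` B j"
      by simp
  next
    fix b assume b: "b \<in> B j"
    have "mod_coset n j (\<lambda>v. b v + x v) \<in> {mod_coset n j (\<lambda>v. b v + (0 + x v))}" by simp
    then show "mod_coset n j (\<lambda>v. b v + x v) \<in>
        (\<Union>b\<in>B j. \<Union>c\<in>B j. {mod_coset n j (\<lambda>v. b v + (c v + x v))})"
      by (intro UN_I[OF b] UN_I[OF B_zero])
  qed
  finally have red: "reduce_class n G \<delta> j ?C = (\<lambda>b. mod_coset n j (\<lambda>v. b v + x v)) ` B j" .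
  show ?thesis
    unfolding red one
  proof
    assume eq: "(\<lambda>b. mod_coset n j (\<lambda>v. b v + x v)) ` B j = mod_coset n j ` B j"
    have "mod_coset n j x \<in> mod_coset n j ` B j"
      unfolding eq[symmetric] by (rule image_eqI[OF _ B_zero]) simp
    then obtain b where b: "b \<in> B j" "mod_coset n j x = mod_coset n j b" by (auto elim: imageE)
    then have "x \<in> mod_coset n j b" using mod_coset_self[of x n j] by simp
    then obtain y where y: "y \<in> S j" "x = (\<lambda>v. int n * y v + b v)"
      unfolding mod_coset_def by (rule imageE)
    show "\<exists>b\<in>B j. \<exists>y\<in>S j. x = (\<lambda>v. b v + int n * y v)"
      by (intro bexI[OF _ b(1)] bexI[OF _ y(1)]) (simp add: y(2) add.commute)
  next
    assume "\<exists>b\<in>B j. \<exists>y\<in>S j. x = (\<lambda>v. b v + int n * y v)"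
    then obtain b y where bys: "b \<in> B j" "y \<in> S j" "x = (\<lambda>v. b v + int n * y v)" by (elim bexE)
    have eq: "mod_coset n j (\<lambda>v. c v + x v) = mod_coset n j (\<lambda>v. c v + b v)" for c
      by (rule mod_coset_cong[OF bys(2)]) (simp add: bys(3) algebra_simps)
    show "(\<lambda>b. mod_coset n j (\<lambda>v. b v + x v)) ` B j = mod_coset n j ` B j"
      unfolding eq
    proof (intro equalityI image_subsetI)
      fix c assume c: "c \<in> B j"
      show "mod_coset n j (\<lambda>v. c v + b v) \<in> mod_coset n j ` B j"
        by (rule imageI[OF B_add[OF c bys(1)]])
      show "mod_coset n j c \<in> (\<lambda>c. mod_coset n j (\<lambda>v. c v + b v)) ` B j"
        by (rule image_eqI[OF _ B_diff[OF c bys(1)]]) simp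
    qed
  qed
qed

end


subsection \<open>Smith classes in terms of resolutions\<close>

context Zp_action
begin

lemma smith_complex_eq:
  "smith_complex p K t n j =
     \<lparr>carrier = {\<phi> \<in> alt_n K (Suc j). res_op p t n \<phi> = (\<lambda>xs. 0)},
      monoid.mult = (\<lambda>\<phi> \<psi> xs. \<phi> xs + \<psi> xs), one = (\<lambda>xs. 0)\<rparr>"
  by (simp add: smith_complex_def cochain_group_s_def cochain_group_d_def cochain_group_def
      alternating_functions_eq_alt_n res_op_def op_s_cochain_map op_d_cochain_map)

sublocale smith: function_complex
  "\<lambda>j. {\<phi> \<in> alt_n K (Suc j). res_op p t n \<phi> = (\<lambda>xs. 0)}" "\<lambda>_. coboundary K" "smith_complex p K t n"
  for n
proof
  show "coboundary K x \<in> {\<phi> \<in> alt_n K (Suc (Suc j)). res_op p t n \<phi> = (\<lambda>xs. 0)}"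
    if "x \<in> {\<phi> \<in> alt_n K (Suc j). res_op p t n \<phi> = (\<lambda>xs. 0)}" for x j
    using that coboundary_alt_n[of x K "Suc j"]
    by (auto simp: coboundary_res_op[symmetric, THEN ext] coboundary_zero)
  show "(\<lambda>v. - x v) \<in> {\<phi> \<in> alt_n K (Suc j). res_op p t n \<phi> = (\<lambda>xs. 0)}"
    if "x \<in> {\<phi> \<in> alt_n K (Suc j). res_op p t n \<phi> = (\<lambda>xs. 0)}" for x j
    using that alt_n_cmult[of x K "Suc j" "-1"] res_op_cmult[of p t n "-1" x, THEN ext] by auto
qed (auto simp: smith_complex_eq alt_n_zero alt_n_add res_op_zero res_op_add coboundary_add fun_eq_iff)

text \<open>By exactness the cochains in the kernel of one operator are the values of the other. For
  \<open>n = 0\<close> the condition \<open>\<chi> [] = 0\<close> leaves only the zero function, as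
  there are no coboundaries in degree 0.\<close>

lemma smith_coboundaries:
  "coboundaries (smith_complex p K t n) (\<lambda>_. coboundary K) n =
     {coboundary K (res_op p t (Suc n) \<chi>) | \<chi>. \<chi> \<in> alt_n K n \<and> \<chi> [] = 0}"
proof (cases n)
  case 0
  have "\<chi> = (\<lambda>xs. 0)" if "\<chi> \<in> alt_n K 0" "\<chi> [] = 0" for \<chi>
  proof
    show "\<chi> xs = 0" for xs using that by (cases xs) (auto simp: alt_n_def)
  qed
  then have "{coboundary K (res_op p t (Suc n) \<chi>) | \<chi>. \<chi> \<in> alt_n K n \<and> \<chi> [] = 0} =
      {coboundary K (res_op p t (Suc n) (\<lambda>xs. 0))}"
    unfolding 0 using alt_n_zero by blast
  then show ?thesis
    by (simp add: 0 coboundaries_def smith_complex_eq res_op_zero[abs_def] coboundary_zero[abs_def])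
next
  case (Suc i)
  have "{\<phi> \<in> alt_n K n. res_op p t n \<phi> = (\<lambda>xs. 0)} = res_op p t (Suc n) ` alt_n K n"
  proof (intro equalityI subsetI)
    fix \<phi> assume "\<phi> \<in> {\<phi> \<in> alt_n K n. res_op p t n \<phi> = (\<lambda>xs. 0)}"
    then obtain g where "g \<in> alt_n K n" "\<And>xs. res_op p t (Suc n) g xs = \<phi> xs"
      using exact_res_op[of \<phi> n n] Suc by auto
    then show "\<phi> \<in> res_op p t (Suc n) ` alt_n K n" by (intro image_eqI[of _ _ g]) auto
  qed (auto simp: res_op_alt_n res_op_res_op)
  moreover have "\<chi> [] = 0" if "\<chi> \<in> alt_n K n" for \<chi>
    using alt_n_outside[OF that, of "[]"] Suc by simp
  ultimately have "coboundaries (smith_complex p K t n) (\<lambda>_. coboundary K) n =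
      coboundary K ` res_op p t (Suc n) ` alt_n K n"
    by (simp add: coboundaries_def smith_complex_eq Suc)
  then show ?thesis using \<open>\<And>\<chi>. \<chi> \<in> alt_n K n \<Longrightarrow> \<chi> [] = 0\<close> by auto
qed

lemma smith_cocycle_eq: "smith_cocycle p t n \<phi> = res_op p t (Suc n) \<phi>"
  by (simp add: smith_cocycle_def res_op_def op_s_cochain_map op_d_cochain_map)

lemma res_op_part:
  "res_op p t m (part n f) xs = (if length xs = n then res_op p t m f xs else 0)"
  by (auto simp: res_op_def norm_op_def diff_op_def part_def)

lemma resolution_of_1_assemble:
  assumes "resolution_of_1 p K t \<phi>"
  shows "resolution (assemble \<phi>)" "part (Suc n) (assemble \<phi>) = \<phi> n"
proof -
  have "\<And>j. \<phi> j \<in> alt_n K (Suc j)"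
    using assms by (simp add: resolution_of_1_def alternating_functions_eq_alt_n)
  then show "resolution (assemble \<phi>)" "part (Suc n) (assemble \<phi>) = \<phi> n"
    using assms resolution_of_1_iff part_assemble by blast+
qed

lemma resolution_parts:
  assumes "resolution F"
  shows "resolution_of_1 p K t (\<lambda>j. part (Suc j) F)"
proof -
  have mem: "\<And>j. part (Suc j) F \<in> alt_n K (Suc j)"
    using assms part_alt_n by (auto simp: resolution_def)
  moreover have "assemble (\<lambda>j. part (Suc j) F) = F"
    using assms by (auto simp: fun_eq_iff assemble_def part_def resolution_def)
  ultimately show ?thesis using resolution_of_1_iff[OF mem] assms by simp
qed

text \<open>Since the cocycles of two resolutions differ by a coboundary, the definite description
  can be evaluated on any resolution at hand.\<close>

lemma smith_class_eq:
  assumes F: "resolution F"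
  shows "smith_class p K t n =
    cohomology_class (smith_complex p K t n) (\<lambda>_. coboundary K) n (res_op p t (Suc n) (part (Suc n) F))"
proof -
  have eq: "cohomology_class (smith_complex p K t n) (\<lambda>_. coboundary K) n (res_op p t (Suc n) (part (Suc n) G)) =
      cohomology_class (smith_complex p K t n) (\<lambda>_. coboundary K) n (res_op p t (Suc n) (part (Suc n) F))"
    if G: "resolution G" for G
  proof -
    obtain \<chi> where \<chi>: "\<chi> \<in> alt_n K n" "\<chi> [] = 0"
      "\<And>xs. length xs = Suc n \<Longrightarrow>
        res_op p t (Suc n) G xs - res_op p t (Suc n) F xs = coboundary K (res_op p t (Suc n) \<chi>) xs"
      using resolution_difference[OF G F, of n] by blast
    have "coboundary K (res_op p t (Suc n) \<chi>) xs = 0" if "length xs \<noteq> Suc n" for xs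
      using alt_n_outside[OF coboundary_alt_n[OF res_op_alt_n[OF \<chi>(1)]]] that by blast
    then have "(\<lambda>xs. res_op p t (Suc n) (part (Suc n) G) xs - res_op p t (Suc n) (part (Suc n) F) xs) =
        coboundary K (res_op p t (Suc n) \<chi>)"
      using \<chi>(3) by (auto simp: fun_eq_iff res_op_part)
    then show ?thesis
      unfolding smith.class_eq_class_iff smith_coboundaries using \<chi>(1,2) by auto
  qed
  show ?thesis
    unfolding smith_class_def smith_cocycle_eq
  proof (rule the_equality)
    show "\<exists>\<phi>. resolution_of_1 p K t \<phi> \<and>
        cohomology_class (smith_complex p K t n) (\<lambda>_. coboundary K) n (res_op p t (Suc n) (part (Suc n) F)) =
        cohomology_class (smith_complex p K t n) (\<lambda>_. coboundary K) n (res_op p t (Suc n) (\<phi> n))"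
      using resolution_parts[OF F] by (intro exI[of _ "\<lambda>j. part (Suc j) F"]) simp
  next
    fix A assume "\<exists>\<phi>. resolution_of_1 p K t \<phi> \<and>
        A = cohomology_class (smith_complex p K t n) (\<lambda>_. coboundary K) n (res_op p t (Suc n) (\<phi> n))"
    then obtain \<phi> where \<phi>: "resolution_of_1 p K t \<phi>"
      "A = cohomology_class (smith_complex p K t n) (\<lambda>_. coboundary K) n (res_op p t (Suc n) (\<phi> n))"
      by blast
    then show "A = cohomology_class (smith_complex p K t n) (\<lambda>_. coboundary K) n (res_op p t (Suc n) (part (Suc n) F))"
      using eq[of "assemble \<phi>"] resolution_of_1_assemble[OF \<phi>(1)] by simp
  qed
qed

definition null :: "nat \<Rightarrow> bool" where
  "null n \<longleftrightarrow> (\<exists>F. resolution F \<and> (\<forall>xs. n < length xs \<longrightarrow> F xs = 0))"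

definition null_mod :: "nat \<Rightarrow> bool" where
  "null_mod n \<longleftrightarrow> smith_class_mod p p K t n = one (smith_cohomology_mod p p K t n)"

lemma smith_class_null_iff:
  assumes F: "resolution F"
  shows "smith_class p K t n = one (smith_cohomology p K t n) \<longleftrightarrow>
    (\<exists>\<chi>\<in>alt_n K n. \<chi> [] = 0 \<and> (\<forall>xs. length xs = Suc n \<longrightarrow>
      res_op p t (Suc n) F xs = coboundary K (res_op p t (Suc n) \<chi>) xs))" (is "_ \<longleftrightarrow> ?R")
proof -
  have "smith_class p K t n = one (smith_cohomology p K t n) \<longleftrightarrow>
      (\<exists>\<chi>\<in>alt_n K n. \<chi> [] = 0 \<and>
        res_op p t (Suc n) (part (Suc n) F) = coboundary K (res_op p t (Suc n) \<chi>))"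
    unfolding smith_cohomology_def smith_class_eq[OF F] smith.class_eq_one_iff smith_coboundaries
    by blast
  also have "\<dots> \<longleftrightarrow> ?R"
  proof (intro bex_cong refl conj_cong)
    fix \<chi> assume "\<chi> \<in> alt_n K n"
    then have "coboundary K (res_op p t (Suc n) \<chi>) xs = 0" if "length xs \<noteq> Suc n" for xs
      using alt_n_outside[OF coboundary_alt_n[OF res_op_alt_n]] that by blast
    then show "(res_op p t (Suc n) (part (Suc n) F) = coboundary K (res_op p t (Suc n) \<chi>)) =
       (\<forall>xs. length xs = Suc n \<longrightarrow> res_op p t (Suc n) F xs = coboundary K (res_op p t (Suc n) \<chi>) xs)"
      by (auto simp: fun_eq_iff res_op_part)
  qed
  finally show ?thesis .
qed

lemma null_mod_iff:
  assumes F: "resolution F"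
  shows "null_mod n \<longleftrightarrow>
    (\<exists>\<chi>\<in>alt_n K n. \<exists>\<psi>\<in>alt_n K (Suc n). \<chi> [] = 0 \<and> (\<forall>xs. length xs = Suc n \<longrightarrow>
      res_op p t (Suc n) F xs =
        coboundary K (res_op p t (Suc n) \<chi>) xs + int p * res_op p t (Suc n) \<psi> xs))"
    (is "_ \<longleftrightarrow> ?R")
proof -
  have S: "{\<phi> \<in> alt_n K (Suc n). res_op p t n \<phi> = (\<lambda>xs. 0)} = res_op p t (Suc n) ` alt_n K (Suc n)"
  proof (intro equalityI subsetI)
    fix \<phi> assume "\<phi> \<in> {\<phi> \<in> alt_n K (Suc n). res_op p t n \<phi> = (\<lambda>xs. 0)}"
    then obtain g where "g \<in> alt_n K (Suc n)" "\<And>xs. res_op p t (Suc n) g xs = \<phi> xs"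
      using exact_res_op[of \<phi> "Suc n" n] by auto
    then show "\<phi> \<in> res_op p t (Suc n) ` alt_n K (Suc n)" by (intro image_eqI[of _ _ g]) auto
  qed (auto simp: res_op_alt_n res_op_res_op)
  have "null_mod n \<longleftrightarrow> (\<exists>\<chi>\<in>alt_n K n. \<exists>\<psi>\<in>alt_n K (Suc n). \<chi> [] = 0 \<and>
        res_op p t (Suc n) (part (Suc n) F) =
          (\<lambda>xs. coboundary K (res_op p t (Suc n) \<chi>) xs + int p * res_op p t (Suc n) \<psi> xs))"
    unfolding null_mod_def smith_class_mod_def smith_cohomology_mod_def smith_class_eq[OF F]
      smith.reduce_class_eq_one_iff smith_coboundaries S
    by blast
  also have "\<dots> \<longleftrightarrow> ?R"
  proof (intro bex_cong refl conj_cong)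
    fix \<chi> \<psi> assume "\<chi> \<in> alt_n K n" "\<psi> \<in> alt_n K (Suc n)"
    then have "coboundary K (res_op p t (Suc n) \<chi>) xs = 0" "res_op p t (Suc n) \<psi> xs = 0"
      if "length xs \<noteq> Suc n" for xs
      using alt_n_outside[OF coboundary_alt_n[OF res_op_alt_n]] alt_n_outside[OF res_op_alt_n] that
      by blast+
    then show "(res_op p t (Suc n) (part (Suc n) F) =
          (\<lambda>xs. coboundary K (res_op p t (Suc n) \<chi>) xs + int p * res_op p t (Suc n) \<psi> xs)) =
       (\<forall>xs. length xs = Suc n \<longrightarrow> res_op p t (Suc n) F xs =
        coboundary K (res_op p t (Suc n) \<chi>) xs + int p * res_op p t (Suc n) \<psi> xs)"
      by (auto simp: fun_eq_iff res_op_part)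
  qed
  finally show ?thesis .
qed

end

subsection \<open>Indices and truncated resolutions\<close>

lemma (in Zp_action) resolutionD:
  assumes "resolution F"
  shows "F \<in> alt K" "F [] = 1" "coboundary K F xs = res_op p t (length xs) F xs"
  using assms by (simp_all add: resolution_def)

context Zp_action
begin

lemma norm_op_eq_mult:
  assumes "\<And>xs. diff_op t f xs = 0"
  shows "norm_op p t f xs = int p * f xs"
proof -
  have "f (map (t ^^ k) xs) = f xs" for k
  proof (induction k)
    case (Suc k)
    have "map (t ^^ Suc k) xs = map t (map (t ^^ k) xs)" by simp
    then show ?case using Suc assms[of "map (t ^^ k) xs"] by (simp only: diff_op_def)
  qed simp
  then show ?thesis by (simp add: norm_op_def)
qed

text \<open>The operator s or p - s, according to parity. By s s = p s and d (p - s) = p d it acts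
  like multiplication by p under \<open>res_op\<close>, but unlike p times \<open>f\<close> its
  value is closed as soon as \<open>res_op\<close> kills the coboundary of \<open>f\<close>.\<close>

definition lift_op :: "nat \<Rightarrow> ('a list \<Rightarrow> int) \<Rightarrow> 'a list \<Rightarrow> int" where
  "lift_op n f xs = (if odd n then norm_op p t f xs else int p * f xs - norm_op p t f xs)"

lemma lift_op_alt_n:
  assumes "f \<in> alt_n K m"
  shows "lift_op n f \<in> alt_n K m"
proof -
  have "norm_op p t f \<in> alt_n K m"
    using res_op_alt_n[OF assms, of 1] by (simp add: res_op_def)
  moreover from this have "(\<lambda>xs. int p * f xs - norm_op p t f xs) \<in> alt_n K m"
    using alt_n_cmult[OF assms, of "int p"] by (rule alt_n_diff[rotated])
  ultimately show ?thesis by (cases "odd n") (simp_all add: lift_op_def[abs_def])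
qed

lemma res_op_lift_op: "res_op p t n (lift_op n f) xs = int p * res_op p t n f xs"
proof (cases "odd n")
  case True
  have "lift_op n f = norm_op p t f" using True by (simp add: fun_eq_iff lift_op_def)
  then show ?thesis using True by (simp add: res_op_def norm_op_norm_op)
next
  case False
  then show ?thesis
    by (simp add: res_op_def lift_op_def diff_op_def norm_op_map_t algebra_simps)
qed

lemma coboundary_norm_op: "coboundary K (norm_op p t f) xs = norm_op p t (coboundary K f) xs"
  using coboundary_res_op[of 1 f xs] by (simp add: res_op_def)

text \<open>For odd \<open>n\<close> the coboundary of s f is s of the coboundary, hence 0. For even
  \<open>n\<close> the coboundary of \<open>f\<close> is invariant, so s multiplies it by p and the
  two parts of p - s cancel.\<close>

lemma coboundary_lift_op:
  assumes "\<And>xs. res_op p t n (coboundary K f) xs = 0"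
  shows "coboundary K (lift_op n f) xs = 0"
proof (cases "odd n")
  case True
  have "lift_op n f = norm_op p t f" using True by (simp add: fun_eq_iff lift_op_def)
  then show ?thesis using True assms[of xs] by (simp add: res_op_def coboundary_norm_op)
next
  case False
  have "lift_op n f = (\<lambda>xs. int p * f xs - norm_op p t f xs)"
    using False by (simp add: fun_eq_iff lift_op_def)
  moreover have "norm_op p t (coboundary K f) xs = int p * coboundary K f xs"
    using False assms by (intro norm_op_eq_mult) (simp add: res_op_def)
  ultimately show ?thesis by (simp add: coboundary_diff coboundary_cmult coboundary_norm_op)
qed

text \<open>Change of a resolution by a homotopy \<chi>: it alters the two neighbouring lengths
  \<open>n\<close> and \<open>n + 1\<close>, and the resolution equation persists because s d = d s
  = 0 and the coboundary squares to 0.\<close>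

lemma resolution_shift:
  assumes F: "resolution F" and \<chi>: "\<chi> \<in> alt_n K n" "\<chi> [] = 0"
  shows "resolution (\<lambda>xs. F xs - (res_op p t (Suc n) \<chi> xs + coboundary K \<chi> xs))" (is "resolution ?F")
proof -
  have r: "res_op p t (Suc n) \<chi> \<in> alt_n K n" and c: "coboundary K \<chi> \<in> alt_n K (Suc n)"
    using \<chi> by (simp_all add: res_op_alt_n coboundary_alt_n)
  have "?F \<in> alt K"
    by (intro alt_diff alt_add resolutionD[OF F] alt_n_alt[OF r] alt_n_alt[OF c])
  moreover have "?F [] = 1"
    using resolutionD(2)[OF F] \<chi>(2) by (simp add: res_op_def norm_op_def diff_op_def coboundary_eq)
  moreover have "coboundary K ?F xs = res_op p t (length xs) ?F xs" for xs
  proof -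
    have "coboundary K ?F xs = coboundary K F xs - res_op p t (Suc n) (coboundary K \<chi>) xs"
      by (simp add: coboundary_diff coboundary_add coboundary_res_op coboundary_coboundary[OF complex])
    moreover have "res_op p t (length xs) ?F xs = res_op p t (length xs) F xs
        - (res_op p t (length xs) (res_op p t (Suc n) \<chi>) xs + res_op p t (length xs) (coboundary K \<chi>) xs)"
      by (simp add: res_op_diff res_op_add)
    moreover have "res_op p t (length xs) (res_op p t (Suc n) \<chi>) xs = 0"
      using alt_n_outside[OF res_op_alt_n[OF r], of xs "length xs"]
      by (cases "length xs = n") (simp_all add: res_op_res_op)
    moreover have "res_op p t (length xs) (coboundary K \<chi>) xs = res_op p t (Suc n) (coboundary K \<chi>) xs"
      using alt_n_outside[OF res_op_alt_n[OF c], of xs] by (cases "length xs = Suc n") simp_all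
    ultimately show ?thesis using resolutionD(3)[OF F, of xs] by simp
  qed
  ultimately show ?thesis by (simp add: resolution_def)
qed

text \<open>A closed \<open>g\<close> of length \<open>n\<close> may replace everything from length
  \<open>n\<close> on: the equation at length \<open>n\<close> links it to the lower terms, and at
  length \<open>n + 1\<close> both sides vanish.\<close>

lemma resolution_truncate:
  assumes F: "resolution F" and g: "g \<in> alt_n K n" "n = 0 \<Longrightarrow> g [] = 1"
    and eq: "\<And>xs. length xs = n \<Longrightarrow> coboundary K F xs = res_op p t n g xs"
    and closed: "\<And>xs. coboundary K g xs = 0"
  shows "resolution (\<lambda>xs. if length xs < n then F xs else g xs)" (is "resolution ?F")
proof -
  have "?F \<in> alt K"
  proof -
    have "(\<lambda>xs. if length xs < n then F xs else 0) \<in> alt K"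
      by (rule alt_restrict[OF resolutionD(1)[OF F]]) (metis size_mset)
    then have "(\<lambda>xs. (if length xs < n then F xs else 0) + g xs) \<in> alt K"
      using alt_add alt_n_alt[OF g(1)] by blast
    moreover have "(\<lambda>xs. (if length xs < n then F xs else 0) + g xs) = ?F"
      using alt_n_outside[OF g(1)] by auto
    ultimately show ?thesis by simp
  qed
  moreover have "?F [] = 1" using g(2) resolutionD(2)[OF F] by auto
  moreover have "coboundary K ?F xs = res_op p t (length xs) ?F xs" for xs
  proof -
    consider "length xs < n" | "length xs = n" | "length xs > n" by linarith
    then show ?thesis
    proof cases
      case 1
      then have "list_cob ?F xs = list_cob F xs" by (intro list_cob_cong) auto
      moreover have "res_op p t (length xs) ?F xs = res_op p t (length xs) F xs"
        using 1 by (intro res_op_cong) auto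
      ultimately show ?thesis using resolutionD(3)[OF F, of xs] by (simp add: coboundary_eq split: if_splits)
    next
      case 2
      then have "list_cob ?F xs = list_cob F xs" by (intro list_cob_cong) auto
      moreover have "res_op p t (length xs) ?F xs = res_op p t (length xs) g xs"
        using 2 by (intro res_op_cong) auto
      ultimately show ?thesis using eq[OF 2] 2 by (auto simp: coboundary_eq split: if_splits)
    next
      case 3
      then have "list_cob ?F xs = list_cob g xs" by (intro list_cob_cong) auto
      moreover have "res_op p t (length xs) ?F xs = res_op p t (length xs) g xs"
        using 3 by (intro res_op_cong) auto
      moreover have "res_op p t (length xs) g xs = 0"
        using alt_n_outside[OF res_op_alt_n[OF g(1)]] 3 by simp
      ultimately show ?thesis using closed[of xs] by (auto simp: coboundary_eq split: if_splits)
    qed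
  qed
  ultimately show ?thesis by (simp add: resolution_def)
qed

lemma smith_class_eq_one_iff_null:
  "smith_class p K t n = one (smith_cohomology p K t n) \<longleftrightarrow> null n"
proof
  obtain F where F: "resolution F" using resolution_exists by blast
  assume "smith_class p K t n = one (smith_cohomology p K t n)"
  then obtain \<chi> where \<chi>: "\<chi> \<in> alt_n K n" "\<chi> [] = 0"
    "\<And>xs. length xs = Suc n \<Longrightarrow> res_op p t (Suc n) F xs = coboundary K (res_op p t (Suc n) \<chi>) xs"
    using smith_class_null_iff[OF F] by blast
  let ?F = "\<lambda>xs. F xs - (res_op p t (Suc n) \<chi> xs + coboundary K \<chi> xs)"
  have F': "resolution ?F" using resolution_shift[OF F \<chi>(1,2)] .
  have z: "coboundary K ?F xs = 0" if "length xs = Suc n" for xs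
  proof -
    have "coboundary K ?F xs = coboundary K F xs - coboundary K (res_op p t (Suc n) \<chi>) xs"
      by (simp add: coboundary_diff coboundary_add coboundary_coboundary[OF complex])
    then show ?thesis using \<chi>(3)[OF that] resolutionD(3)[OF F, of xs] that by simp
  qed
  have "resolution (\<lambda>xs. if length xs < n then ?F xs else part n ?F xs)"
  proof (rule resolution_truncate[OF F'])
    show "part n ?F \<in> alt_n K n" by (rule part_alt_n[OF resolutionD(1)[OF F']])
    show "n = 0 \<Longrightarrow> part n ?F [] = 1" using resolutionD(2)[OF F'] by (simp add: part_def)
    show "coboundary K ?F xs = res_op p t n (part n ?F) xs" if "length xs = n" for xs
      using resolutionD(3)[OF F', of xs] that by (simp add: res_op_part)
    show "coboundary K (part n ?F) xs = 0" for xs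
      using z by (simp add: coboundary_part)
  qed
  then show "null n" unfolding null_def by (intro exI conjI) (assumption, auto simp: part_def)
next
  assume "null n"
  then obtain F where F: "resolution F" "\<And>xs. n < length xs \<Longrightarrow> F xs = 0" by (auto simp: null_def)
  have "res_op p t (Suc n) F xs = 0" if "length xs = Suc n" for xs
    using F(2) that by (simp add: res_op_def norm_op_def diff_op_def)
  then show "smith_class p K t n = one (smith_cohomology p K t n)"
    unfolding smith_class_null_iff[OF F(1)]
    by (intro bexI[OF _ alt_n_zero])
      (simp add: res_op_zero res_op_zero[abs_def] coboundary_zero)
qed

lemma smith_index_eq: "smith_index p K t = (LEAST n. null n)"
  by (simp add: smith_index_def smith_class_eq_one_iff_null)

lemma smith_index_p_eq: "smith_index_p p K t = (LEAST n. null_mod n)"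
  by (simp add: smith_index_p_def null_mod_def)

lemma null_mono: "null n \<Longrightarrow> n \<le> m \<Longrightarrow> null m"
  unfolding null_def by force

lemma null_large: "null (card (\<Union>K))"
proof -
  obtain F where F: "resolution F" using resolution_exists by blast
  have "F xs = 0" if "card (\<Union>K) < length xs" for xs
  proof -
    have "finite (\<Union>K)" using finite_K finite_simplex by blast
    then have "\<not> simplex_list K xs"
      using that card_mono[of "\<Union>K" "set xs"] distinct_card[of xs]
      by (auto simp: simplex_list_def Union_upper)
    then show ?thesis using alt_outside[OF resolutionD(1)[OF F]] by blast
  qed
  then show ?thesis using F unfolding null_def by blast
qed

lemma null_smith_index: "null (smith_index p K t)"
  unfolding smith_index_eq using null_large by (rule LeastI)

lemma smith_index_le_iff: "smith_index p K t \<le> n \<longleftrightarrow> null n"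
  using null_smith_index null_mono Least_le[of null n] unfolding smith_index_eq by blast

lemma null_mod_if_null:
  assumes "null n"
  shows "null_mod n"
proof -
  obtain F where F: "resolution F" "\<And>xs. n < length xs \<Longrightarrow> F xs = 0"
    using assms by (auto simp: null_def)
  have "res_op p t (Suc n) F xs = 0" if "length xs = Suc n" for xs
    using F(2) that by (simp add: res_op_def norm_op_def diff_op_def)
  then show ?thesis
    unfolding null_mod_iff[OF F(1)]
    by (intro bexI[OF _ alt_n_zero])
      (simp add: res_op_zero res_op_zero[abs_def] coboundary_zero)
qed

section \<open>Vanishing of a Smith class modulo p\<close>

lemma alt_n_divide:
  assumes f: "f \<in> alt_n K n" and dvd: "\<And>xs. c dvd f xs" and c: "c \<noteq> 0"
  obtains g where "g \<in> alt_n K n" "\<And>xs. f xs = c * g xs"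
proof
  let ?g = "\<lambda>xs. f xs div c"
  show eq: "f xs = c * ?g xs" for xs using dvd by simp
  have "c * ?g (xs @ a # b # ys) = c * (- ?g (xs @ b # a # ys))" for xs a b ys
    unfolding mult_minus_right eq[symmetric] by (rule alternatingD[OF alt_alternating[OF alt_n_alt[OF f]]])
  then have "alternating ?g" using c unfolding alternating_def by (metis mult_cancel_left)
  then show "?g \<in> alt_n K n"
    using alt_outside[OF alt_n_alt[OF f]] alt_n_outside[OF f] by (simp add: alt_n_def alt_def)
qed

lemma null_mod_if_dvd:
  assumes F: "resolution F" and dvd: "\<And>xs. length xs = Suc n \<Longrightarrow> int p dvd F xs"
  shows "null_mod n"
proof -
  have "int p dvd part (Suc n) F xs" for xs using dvd by (simp add: part_def)
  then obtain \<psi> where \<psi>: "\<psi> \<in> alt_n K (Suc n)" "\<And>xs. part (Suc n) F xs = int p * \<psi> xs"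
    using alt_n_divide[OF part_alt_n[OF resolutionD(1)[OF F]], of "int p" "Suc n"] p_pos by auto
  have "res_op p t (Suc n) F xs = int p * res_op p t (Suc n) \<psi> xs" if "length xs = Suc n" for xs
    unfolding res_op_cmult[symmetric] \<psi>(2)[symmetric] using that by (simp add: res_op_part)
  then show ?thesis
    unfolding null_mod_iff[OF F]
    by (intro bexI[OF _ alt_n_zero] bexI[OF _ \<psi>(1)])
      (simp add: res_op_zero[abs_def] coboundary_zero)
qed

text \<open>After a shift the Smith cocycle is p times \<open>res_op\<close> of some \<psi>, which
  equals \<open>res_op\<close> of the closed cochain \<open>lift_op (Suc n) \<psi>\<close>. So the
  resolution can end with this cochain, one length later than an integrally vanishing class would
  allow.\<close>

lemma null_mod_normal_form:
  assumes "null_mod n"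
  obtains F \<psi> where "resolution F" "\<psi> \<in> alt_n K (Suc n)"
    "\<And>xs. Suc n < length xs \<Longrightarrow> F xs = 0"
    "\<And>xs. length xs = Suc n \<Longrightarrow> F xs = lift_op (Suc n) \<psi> xs"
    "\<And>xs. res_op p t (Suc n) (coboundary K \<psi>) xs = 0"
proof -
  obtain F where F: "resolution F" using resolution_exists by blast
  then obtain \<chi> \<psi> where \<chi>: "\<chi> \<in> alt_n K n" "\<chi> [] = 0" and \<psi>: "\<psi> \<in> alt_n K (Suc n)"
    and eq: "\<And>xs. length xs = Suc n \<Longrightarrow> res_op p t (Suc n) F xs =
        coboundary K (res_op p t (Suc n) \<chi>) xs + int p * res_op p t (Suc n) \<psi> xs"
    using assms null_mod_iff[OF F] by blast
  let ?F = "\<lambda>xs. F xs - (res_op p t (Suc n) \<chi> xs + coboundary K \<chi> xs)"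
  have F': "resolution ?F" using resolution_shift[OF F \<chi>] .
  have z: "coboundary K ?F xs = int p * res_op p t (Suc n) \<psi> xs" if "length xs = Suc n" for xs
  proof -
    have "coboundary K ?F xs = coboundary K F xs - coboundary K (res_op p t (Suc n) \<chi>) xs"
      by (simp add: coboundary_diff coboundary_add coboundary_coboundary[OF complex])
    then show ?thesis using eq[OF that] resolutionD(3)[OF F, of xs] that by simp
  qed
  have z': "part (Suc n) (coboundary K ?F) xs = int p * res_op p t (Suc n) \<psi> xs" for xs
    using z alt_n_outside[OF res_op_alt_n[OF \<psi>]] by (simp add: part_def)
  \<comment> \<open>p times the left side is the coboundary of a coboundary, and p can be cancelled
    over the integers.\<close>
  have dc: "res_op p t (Suc n) (coboundary K \<psi>) xs = 0" for xs
  proof -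
    have "int p * coboundary K (res_op p t (Suc n) \<psi>) xs = coboundary K (part (Suc n) (coboundary K ?F)) xs"
      unfolding z' coboundary_cmult[symmetric] ..
    also have "\<dots> = 0" by (simp add: coboundary_part coboundary_coboundary[OF complex])
    finally show ?thesis using p_pos by (simp add: coboundary_res_op)
  qed
  have "resolution (\<lambda>xs. if length xs < Suc n then ?F xs else lift_op (Suc n) \<psi> xs)"
  proof (rule resolution_truncate[OF F'])
    show "lift_op (Suc n) \<psi> \<in> alt_n K (Suc n)" by (rule lift_op_alt_n[OF \<psi>])
    show "coboundary K ?F xs = res_op p t (Suc n) (lift_op (Suc n) \<psi>) xs" if "length xs = Suc n" for xs
      using z[OF that] by (simp add: res_op_lift_op)
    show "coboundary K (lift_op (Suc n) \<psi>) xs = 0" for xs by (rule coboundary_lift_op[OF dc])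
  qed simp
  then show ?thesis
    using that[of _ \<psi>] \<psi> dc alt_n_outside[OF lift_op_alt_n[OF \<psi>]] by auto
qed

lemma null_Suc_if_null_mod: "null_mod n \<Longrightarrow> null (Suc n)"
  by (erule null_mod_normal_form) (auto simp: null_def)

text \<open>Monotonicity passes through the integers: vanishing modulo p in one degree gives
  integral vanishing in the next, and integral vanishing is monotone because a truncated resolution
  stays truncated.\<close>

lemma null_mod_mono: "null_mod n \<Longrightarrow> n \<le> m \<Longrightarrow> null_mod m"
  by (metis le_SucE le_less_Suc_eq less_imp_le not_less_eq_eq null_Suc_if_null_mod null_mod_if_null null_mono)

lemma smith_index_p_le_iff: "smith_index_p p K t \<le> n \<longleftrightarrow> null_mod n"
proof -
  have "null_mod (LEAST n. null_mod n)"
    using null_mod_if_null[OF null_large] by (rule LeastI)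
  then show ?thesis
    using null_mod_mono Least_le[of null_mod n] unfolding smith_index_p_eq by blast
qed

lemma smith_index_p_le: "smith_index_p p K t \<le> smith_index p K t"
  using smith_index_p_le_iff null_mod_if_null null_smith_index by blast

end

subsection \<open>Cochains of a join\<close>

definition lefts :: "('a + 'b) list \<Rightarrow> 'a list" where "lefts zs = map projl (filter isl zs)"

definition rights :: "('a + 'b) list \<Rightarrow> 'b list" where "rights zs = map projr (filter (\<lambda>z. \<not> isl z) zs)"

lemma lefts_simps [simp]:
  "lefts [] = []" "lefts (Inl a # zs) = a # lefts zs" "lefts (Inr b # zs) = lefts zs"
  "lefts (xs @ ys) = lefts xs @ lefts ys"
  by (simp_all add: lefts_def)

lemma rights_simps [simp]:
  "rights [] = []" "rights (Inl a # zs) = rights zs" "rights (Inr b # zs) = b # rights zs"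
  "rights (xs @ ys) = rights xs @ rights ys"
  by (simp_all add: rights_def)

lemma lefts_rights_map [simp]:
  "lefts (map Inl xs) = xs" "lefts (map Inr ys) = []" "rights (map Inl xs) = []" "rights (map Inr ys) = ys"
  by (simp_all add: lefts_def rights_def comp_def)

lemma mset_lefts_rights: "mset (map Inl (lefts zs) @ map Inr (rights zs)) = mset zs"
proof (induction zs)
  case (Cons z zs)
  then show ?case by (cases z) simp_all
qed simp

lemma set_lefts_rights: "set (lefts zs) = Inl -` set zs" "set (rights zs) = Inr -` set zs"
  using mset_eq_setD[OF mset_lefts_rights[of zs]] by auto

lemma distinct_lefts_rights: "distinct zs \<longleftrightarrow> distinct (lefts zs) \<and> distinct (rights zs)"
proof -
  have "distinct zs \<longleftrightarrow> distinct (map Inl (lefts zs) @ map Inr (rights zs))"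
    by (rule mset_eq_imp_distinct_iff) (simp only: mset_lefts_rights)
  also have "\<dots> \<longleftrightarrow> distinct (lefts zs) \<and> distinct (rights zs)"
    by (auto simp: distinct_map)
  finally show ?thesis .
qed

lemma in_complex_join_iff: "\<rho> \<in> complex_join K L \<longleftrightarrow> Inl -` \<rho> \<in> K \<and> Inr -` \<rho> \<in> L"
proof
  assume "\<rho> \<in> complex_join K L"
  then obtain \<sigma> \<tau> where "\<rho> = \<sigma> <+> \<tau>" "\<sigma> \<in> K" "\<tau> \<in> L" by (auto simp: complex_join_def)
  moreover have "Inl -` (\<sigma> <+> \<tau>) = \<sigma>" "Inr -` (\<sigma> <+> \<tau>) = \<tau>" by auto
  ultimately show "Inl -` \<rho> \<in> K \<and> Inr -` \<rho> \<in> L" by simp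
next
  assume "Inl -` \<rho> \<in> K \<and> Inr -` \<rho> \<in> L"
  moreover have "\<rho> = (Inl -` \<rho>) <+> (Inr -` \<rho>)"
  proof (intro equalityI subsetI)
    fix x assume "x \<in> \<rho>" then show "x \<in> (Inl -` \<rho>) <+> (Inr -` \<rho>)" by (cases x) auto
  qed auto
  ultimately show "\<rho> \<in> complex_join K L" unfolding complex_join_def by blast
qed

lemma simplex_list_join:
  "simplex_list (complex_join K L) zs \<longleftrightarrow> simplex_list K (lefts zs) \<and> simplex_list L (rights zs)"
  by (auto simp: simplex_list_def in_complex_join_iff set_lefts_rights distinct_lefts_rights)

text \<open>The sign of the shuffle that moves all left entries in front of the right ones.\<close>

fun shuffle_sign :: "('a + 'b) list \<Rightarrow> int" where
  "shuffle_sign [] = 1"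
| "shuffle_sign (Inl a # zs) = shuffle_sign zs"
| "shuffle_sign (Inr b # zs) = (- 1) ^ length (lefts zs) * shuffle_sign zs"

definition join_extend :: "('a list \<Rightarrow> 'b list \<Rightarrow> int) \<Rightarrow> ('a + 'b) list \<Rightarrow> int" where
  "join_extend F zs = shuffle_sign zs * F (lefts zs) (rights zs)"

definition join_restrict :: "(('a + 'b) list \<Rightarrow> int) \<Rightarrow> 'a list \<Rightarrow> 'b list \<Rightarrow> int" where
  "join_restrict \<theta> xs ys = \<theta> (map Inl xs @ map Inr ys)"

definition bialt :: "'a set set \<Rightarrow> 'b set set \<Rightarrow> ('a list \<Rightarrow> 'b list \<Rightarrow> int) set" where
  "bialt K L = {F. (\<forall>ys. (\<lambda>xs. F xs ys) \<in> alt K) \<and> (\<forall>xs. F xs \<in> alt L)}"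

lemma shuffle_sign_sorted [simp]: "shuffle_sign (map Inl xs @ map Inr ys) = 1"
proof (induction xs)
  case Nil
  show ?case by (induction ys) simp_all
qed simp

lemma join_restrict_extend [simp]: "join_restrict (join_extend F) = F"
  by (simp add: fun_eq_iff join_restrict_def join_extend_def)

lemma shuffle_sign_swap:
  "shuffle_sign (zs @ a # b # ws) =
    (if isl a = isl b then 1 else - 1) * shuffle_sign (zs @ b # a # ws)"
proof (induction zs)
  case Nil
  then show ?case by (cases a; cases b) simp_all
next
  case (Cons z zs)
  have "length (lefts (zs @ a # b # ws)) = length (lefts (zs @ b # a # ws))"
    by (cases a; cases b) simp_all
  then show ?case using Cons by (cases z) (simp_all del: lefts_simps)
qed

lemma join_extend_alt:
  assumes "F \<in> bialt K L"
  shows "join_extend F \<in> alt (complex_join K L)"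
proof -
  have l: "alternating (\<lambda>xs. F xs ys)" and r: "alternating (F xs)" for xs ys
    using assms by (auto simp: bialt_def dest: alt_alternating)
  have "join_extend F (zs @ a # b # ws) = - join_extend F (zs @ b # a # ws)" for zs a b ws
  proof (cases a; cases b)
    fix x y assume "a = Inl x" "b = Inl y"
    then show ?thesis
      using alternatingD[OF l, of "lefts zs" x y "lefts ws" "rights zs @ rights ws"]
        shuffle_sign_swap[of zs a b ws]
      by (simp add: join_extend_def)
  next
    fix x y assume "a = Inr x" "b = Inr y"
    then show ?thesis
      using alternatingD[OF r, of "lefts zs @ lefts ws" "rights zs" x y "rights ws"]
        shuffle_sign_swap[of zs a b ws]
      by (simp add: join_extend_def)
  next
    fix x y assume "a = Inl x" "b = Inr y"
    then show ?thesis
      using shuffle_sign_swap[of zs a b ws] by (simp add: join_extend_def)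
  next
    fix x y assume "a = Inr x" "b = Inl y"
    then show ?thesis
      using shuffle_sign_swap[of zs a b ws] by (simp add: join_extend_def)
  qed
  then have "alternating (join_extend F)" unfolding alternating_def by blast
  moreover have "F (lefts zs) (rights zs) = 0" if "\<not> simplex_list (complex_join K L) zs" for zs
    using that assms alt_outside[of "\<lambda>xs. F xs (rights zs)" K "lefts zs"]
      alt_outside[of "F (lefts zs)" L "rights zs"]
    by (auto simp: bialt_def simplex_list_join)
  ultimately show ?thesis by (simp add: alt_def join_extend_def)
qed

lemma join_restrict_bialt:
  assumes \<theta>: "\<theta> \<in> alt (complex_join K L)"
  shows "join_restrict \<theta> \<in> bialt K L"
proof -
  have "join_restrict \<theta> (xs @ a # b # xs') ys = - join_restrict \<theta> (xs @ b # a # xs') ys" for xs a b xs' ys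
    unfolding join_restrict_def
    using alternatingD[OF alt_alternating[OF \<theta>], of "map Inl xs" "Inl a" "Inl b" "map Inl xs' @ map Inr ys"]
    by simp
  then have l: "alternating (\<lambda>xs. join_restrict \<theta> xs ys)" for ys unfolding alternating_def by blast
  have "join_restrict \<theta> xs (ys @ a # b # ys') = - join_restrict \<theta> xs (ys @ b # a # ys')" for xs a b ys' ys
    unfolding join_restrict_def
    using alternatingD[OF alt_alternating[OF \<theta>], of "map Inl xs @ map Inr ys" "Inr a" "Inr b" "map Inr ys'"]
    by simp
  then have r: "alternating (join_restrict \<theta> xs)" for xs unfolding alternating_def by blast
  have "join_restrict \<theta> xs ys = 0" if "\<not> (simplex_list K xs \<and> simplex_list L ys)" for xs ys
    using alt_outside[OF \<theta>, of "map Inl xs @ map Inr ys"] that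
    by (simp add: join_restrict_def simplex_list_join)
  then show ?thesis using l r by (auto simp: bialt_def alt_def)
qed

text \<open>Every list is a permutation of its sorted form, whose sign is common to \<open>f\<close>
  and \<open>g\<close>. Equality is asked for the total length of \<open>zs\<close> only, so one
  degree can be treated at a time.\<close>

lemma join_restrict_inject:
  assumes f: "f \<in> alt (complex_join K L)" and g: "g \<in> alt (complex_join K L)"
    and eq: "\<And>xs ys. length xs + length ys = length zs \<Longrightarrow> join_restrict f xs ys = join_restrict g xs ys"
  shows "f zs = g zs"
proof -
  let ?s = "map Inl (lefts zs) @ map Inr (rights zs)"
  obtain \<pi> where \<pi>: "\<pi> permutes {..<length zs}" "permute_list \<pi> zs = ?s"
    using mset_eq_permutation[OF mset_lefts_rights] by metis
  have "length ?s = length zs" using mset_lefts_rights[of zs] by (rule mset_eq_length)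
  then have "f ?s = g ?s" using eq[of "lefts zs" "rights zs"] by (simp add: join_restrict_def)
  then have "sign \<pi> * f zs = sign \<pi> * g zs"
    using alternating_permute[OF alt_alternating[OF f] \<pi>(1)]
      alternating_permute[OF alt_alternating[OF g] \<pi>(1)] \<pi>(2) by simp
  then show ?thesis by (simp add: sign_def split: if_splits)
qed

lemma join_restrict_list_cob:
  "list_cob \<theta> (map Inl xs @ map Inr ys) =
     list_cob (\<lambda>xs. join_restrict \<theta> xs ys) xs + (- 1) ^ length xs * list_cob (join_restrict \<theta> xs) ys"
  unfolding list_cob_append join_restrict_def[abs_def]
  using list_cob_map[of "\<lambda>us. \<theta> (us @ map Inr ys)" Inl xs]
    list_cob_map[of "\<lambda>vs. \<theta> (map Inl xs @ vs)" Inr ys] by simp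

lemma join_restrict_coboundary:
  assumes "\<theta> \<in> alt (complex_join K L)"
  shows "join_restrict (coboundary (complex_join K L) \<theta>) xs ys =
     coboundary K (\<lambda>xs. join_restrict \<theta> xs ys) xs
       + (- 1) ^ length xs * coboundary L (join_restrict \<theta> xs) ys"
proof -
  have b: "join_restrict \<theta> \<in> bialt K L" by (rule join_restrict_bialt[OF assms])
  \<comment> \<open>The coboundary over \<open>K\<close> does not test \<open>ys\<close>; these two
    facts supply the missing tests of the other factor.\<close>
  have "coboundary K (\<lambda>xs. join_restrict \<theta> xs ys) xs = 0" if "\<not> simplex_list L ys"
  proof -
    have "(\<lambda>xs. join_restrict \<theta> xs ys) = (\<lambda>xs. 0)"
      using b that alt_outside[of "join_restrict \<theta> _" L ys] by (auto simp: bialt_def)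
    then show ?thesis by (simp add: coboundary_zero)
  qed
  moreover have "coboundary L (join_restrict \<theta> xs) ys = 0" if "\<not> simplex_list K xs"
  proof -
    have "join_restrict \<theta> xs = (\<lambda>ys. 0)"
      using b that alt_outside[of "\<lambda>xs. join_restrict \<theta> xs _" K xs] by (auto simp: bialt_def)
    then show ?thesis by (simp add: coboundary_zero)
  qed
  ultimately show ?thesis
    using join_restrict_list_cob[of \<theta> xs ys]
    by (auto simp: coboundary_eq join_restrict_def simplex_list_join)
qed

section \<open>The diagonal action on functions of two lists\<close>

lemma map_sum_funpow:
  fixes t :: "'a \<Rightarrow> 'a" and u :: "'b \<Rightarrow> 'b"
  shows "map_sum t u ^^ k = map_sum (t ^^ k) (u ^^ k)"
proof
  show "(map_sum t u ^^ k) x = map_sum (t ^^ k) (u ^^ k) x" for x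
  proof (induction k)
    case 0
    show ?case by (cases x) simp_all
  next
    case (Suc k)
    then show ?case by (cases x) simp_all
  qed
qed

lemma join_restrict_norm_op:
  "join_restrict (norm_op p (map_sum t u) \<theta>) xs ys =
     (\<Sum>k<p. join_restrict \<theta> (map (t ^^ k) xs) (map (u ^^ k) ys))"
  unfolding join_restrict_def norm_op_def map_sum_funpow by (simp add: comp_def)

lemma join_restrict_diff_op:
  "join_restrict (diff_op (map_sum t u) \<theta>) xs ys =
     join_restrict \<theta> xs ys - join_restrict \<theta> (map t xs) (map u ys)"
  unfolding join_restrict_def diff_op_def by (simp add: comp_def)


subsection \<open>The action on a join\<close>

locale Zp_pair = A: Zp_action p K t + B: Zp_action p L u
  for p and K :: "'a set set" and t and L :: "'b set set" and u
begin

lemma vimage_map_sum: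
  "Inl -` (map_sum f g ` \<rho>) = f ` (Inl -` \<rho>)" "Inr -` (map_sum f g ` \<rho>) = g ` (Inr -` \<rho>)"
proof -
  show "Inl -` (map_sum f g ` \<rho>) = f ` (Inl -` \<rho>)"
  proof (intro equalityI subsetI)
    fix x assume "x \<in> Inl -` (map_sum f g ` \<rho>)"
    then obtain z where "z \<in> \<rho>" "map_sum f g z = Inl x" by auto
    then show "x \<in> f ` (Inl -` \<rho>)" by (cases z) auto
  qed (auto intro: image_eqI[of _ _ "Inl _"])
  show "Inr -` (map_sum f g ` \<rho>) = g ` (Inr -` \<rho>)"
  proof (intro equalityI subsetI)
    fix x assume "x \<in> Inr -` (map_sum f g ` \<rho>)"
    then obtain z where "z \<in> \<rho>" "map_sum f g z = Inr x" by auto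
    then show "x \<in> g ` (Inr -` \<rho>)" by (cases z) auto
  qed (auto intro: image_eqI[of _ _ "Inr _"])
qed

lemma bij_map_sum: "bij (map_sum t u)"
proof (rule o_bij)
  let ?v = "map_sum (inv_into UNIV t) (inv_into UNIV u)"
  show "?v \<circ> map_sum t u = id"
    using A.t_bij B.t_bij by (simp add: map_sum.comp bij_is_inj map_sum.id)
  show "map_sum t u \<circ> ?v = id"
    using A.t_bij B.t_bij bij_is_surj surj_iff by (metis map_sum.comp map_sum.id)
qed

lemma Zp_complex_join: "Zp_complex p (complex_join K L) (map_sum t u)"
proof -
  have "complex_join K L = (\<lambda>(\<sigma>, \<tau>). \<sigma> <+> \<tau>) ` (K \<times> L)" by (auto simp: complex_join_def)
  then have fin: "finite (complex_join K L)" using A.finite_K B.finite_K by simp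
  have "finite \<rho>" if "\<rho> \<in> complex_join K L" for \<rho>
    using that A.finite_simplex B.finite_simplex by (auto simp: complex_join_def)
  moreover have "{} \<in> complex_join K L"
    using A.empty_in B.empty_in by (simp add: in_complex_join_iff)
  moreover have "\<tau> \<in> complex_join K L" if "\<sigma> \<in> complex_join K L" "\<tau> \<subseteq> \<sigma>" for \<sigma> \<tau>
    using that A.complex B.complex vimage_mono[OF that(2)]
    unfolding in_complex_join_iff abstract_complex_def by metis
  ultimately have "abstract_complex (complex_join K L)"
    using fin by (auto simp: abstract_complex_def)
  moreover have "map_sum t u permutes \<Union>(complex_join K L)"
  proof -
    have "map_sum t u z = z" if "z \<notin> \<Union>(complex_join K L)" for z
    proof (cases z)
      case (Inl a)
      have "a \<notin> \<Union>K"
      proof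
        assume "a \<in> \<Union>K"
        then obtain \<sigma> where "\<sigma> \<in> K" "a \<in> \<sigma>" by blast
        then have "\<sigma> <+> {} \<in> complex_join K L" "z \<in> \<sigma> <+> {}"
          using B.empty_in Inl unfolding complex_join_def by blast+
        then show False using that by blast
      qed
      then show ?thesis using Inl A.t_permutes by (simp add: permutes_not_in)
    next
      case (Inr b)
      have "b \<notin> \<Union>L"
      proof
        assume "b \<in> \<Union>L"
        then obtain \<sigma> where "\<sigma> \<in> L" "b \<in> \<sigma>" by blast
        then have "{} <+> \<sigma> \<in> complex_join K L" "z \<in> {} <+> \<sigma>"
          using A.empty_in Inr unfolding complex_join_def by blast+
        then show False using that by blast
      qed
      then show ?thesis using Inr B.t_permutes by (simp add: permutes_not_in)
    qed
    then show ?thesis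
      unfolding permutes_def using bij_map_sum by (metis bij_pointE)
  qed
  moreover have "(`) (map_sum t u) ` complex_join K L = complex_join K L"
  proof (intro equalityI subsetI)
    fix \<rho> assume "\<rho> \<in> (`) (map_sum t u) ` complex_join K L"
    then show "\<rho> \<in> complex_join K L" by (auto simp: in_complex_join_iff vimage_map_sum)
  next
    fix \<rho> assume "\<rho> \<in> complex_join K L"
    moreover obtain \<sigma> where \<sigma>: "\<rho> = map_sum t u ` \<sigma>"
      using bij_is_surj[OF bij_map_sum] by (metis image_vimage_eq inf_top_right)
    ultimately have "\<sigma> \<in> complex_join K L" by (simp add: in_complex_join_iff vimage_map_sum)
    then show "\<rho> \<in> (`) (map_sum t u) ` complex_join K L" using \<sigma> by blast
  qed
  moreover have "map_sum t u ^^ p = id"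
    by (simp add: map_sum_funpow A.t_period B.t_period map_sum.id)
  moreover have "(map_sum t u ^^ k) ` \<rho> \<noteq> \<rho>"
    if \<rho>: "\<rho> \<in> complex_join K L" "\<rho> \<noteq> {}" and k: "\<not> p dvd k" for \<rho> k
  proof
    assume "(map_sum t u ^^ k) ` \<rho> = \<rho>"
    then have eq: "(t ^^ k) ` (Inl -` \<rho>) = Inl -` \<rho>" "(u ^^ k) ` (Inr -` \<rho>) = Inr -` \<rho>"
      by (metis map_sum_funpow vimage_map_sum)+
    obtain z where "z \<in> \<rho>" using \<rho>(2) by blast
    then show False
      using A.t_free[OF _ _ k, of "Inl -` \<rho>"] B.t_free[OF _ _ k, of "Inr -` \<rho>"] eq \<rho>(1)
      by (cases z) (auto simp: in_complex_join_iff)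
  qed
  ultimately show ?thesis unfolding Zp_complex_def by blast
qed

sublocale J: Zp_action p "complex_join K L" "map_sum t u"
  using Zp_complex_join A.p_pos by unfold_locales

end

subsection \<open>The join of two resolutions\<close>

text \<open>The diagonal shift preserves the triangle l < k < n up to its column l = 0 and its row k
  = n. If \<open>h\<close> has period n in both arguments, the result is the norm in the first
  argument minus the norm in the second.\<close>

lemma sum_triangle_telescope:
  fixes h :: "nat \<Rightarrow> nat \<Rightarrow> int"
  shows "(\<Sum>k<n. \<Sum>l<k. h k l - h (Suc k) (Suc l)) =
    (\<Sum>k<n. h k 0) - h 0 0 - (\<Sum>l<n. h n l) + h n 0"
proof (induction n)
  case (Suc n)
  have "(\<Sum>l<Suc n. h (Suc n) l) = h (Suc n) 0 + (\<Sum>l<n. h (Suc n) (Suc l))"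
    by (rule sum.lessThan_Suc_shift)
  then show ?case using Suc by (simp add: sum_subtractf)
qed simp

lemma sum_triangle_rows:
  fixes f g :: "nat \<Rightarrow> int"
  shows "(\<Sum>k<n. \<Sum>l<k. f k * (g l - g (Suc l))) = (\<Sum>k<n. f k * (g 0 - g k))"
proof (rule sum.cong[OF refl])
  fix k show "(\<Sum>l<k. f k * (g l - g (Suc l))) = f k * (g 0 - g k)"
    by (induction k) (simp_all add: sum_distrib_left[symmetric] sum_lessThan_telescope')
qed

lemma sum_triangle_columns:
  fixes f g :: "nat \<Rightarrow> int"
  shows "(\<Sum>k<n. \<Sum>l<k. (f k - f (Suc k)) * g l) = (\<Sum>l<n. (f (Suc l) - f n) * g l)"
proof (induction n)
  case (Suc n)
  have "(\<Sum>l<n. (f (Suc l) - f (Suc n)) * g l) =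
      (\<Sum>l<n. (f (Suc l) - f n) * g l) + (\<Sum>l<n. (f n - f (Suc n)) * g l)"
    unfolding sum.distrib[symmetric] by (rule sum.cong) (simp_all add: algebra_simps)
  then show ?case using Suc by simp
qed simp

lemma alt_mult_const: "f \<in> alt K \<Longrightarrow> (\<lambda>xs. f xs * c) \<in> alt K"
  using alt_cmult[of f K c] by (simp add: mult.commute)

lemma coboundary_mult_const: "coboundary K (\<lambda>xs. f xs * c) xs = coboundary K f xs * c"
  by (simp add: coboundary_eq list_cob_mult_const)

lemma coboundary_cong:
  assumes "\<And>ys. length ys + 1 = length xs \<Longrightarrow> f ys = g ys"
  shows "coboundary K f xs = coboundary K g xs"
proof -
  have "list_cob f xs = list_cob g xs" by (rule list_cob_cong) (rule assms)
  then show ?thesis by (simp add: coboundary_eq)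
qed

lemma alt_if:
  assumes "f \<in> alt K" "g \<in> alt K" "\<And>xs ys. mset xs = mset ys \<Longrightarrow> P xs = P ys"
  shows "(\<lambda>xs. if P xs then f xs else g xs) \<in> alt K"
proof -
  have "(\<lambda>xs. if P xs then f xs else 0) \<in> alt K"
    by (rule alt_restrict[OF assms(1)]) (rule assms(3))
  moreover have "(\<lambda>xs. if \<not> P xs then g xs else 0) \<in> alt K"
    by (rule alt_restrict[OF assms(2)]) (metis assms(3))
  ultimately have "(\<lambda>xs. (if P xs then f xs else 0) + (if \<not> P xs then g xs else 0)) \<in> alt K"
    by (rule alt_add)
  moreover have "(\<lambda>xs. (if P xs then f xs else 0) + (if \<not> P xs then g xs else 0)) =
      (\<lambda>xs. if P xs then f xs else g xs)" by auto
  ultimately show ?thesis by simp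
qed

lemma list_cob_mset_even: "mset xs = mset ys \<Longrightarrow> even (length xs) = even (length ys)"
  by (metis size_mset)

lemma parity_pred: "n + 1 = (m::nat) \<Longrightarrow> even n = odd m"
  by auto

context Zp_pair
begin

text \<open>With list length as degree, this is the pattern of the usual diagonal approximation for
  the periodic resolution of a cyclic group: a plain product, a product with one shift, a triangular
  sum.\<close>

definition join_res :: "('a list \<Rightarrow> int) \<Rightarrow> ('b list \<Rightarrow> int) \<Rightarrow> 'a list \<Rightarrow> 'b list \<Rightarrow> int" where
  "join_res F G xs ys =
    (if even (length ys) then F xs * G ys
     else if even (length xs) then F (map t xs) * G ys
     else \<Sum>k<p. \<Sum>l<k. F (map (t ^^ k) xs) * G (map (u ^^ l) ys))"

lemma alt_translate1: "f \<in> alt K \<Longrightarrow> (\<lambda>xs. f (map t xs)) \<in> alt K"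
  using A.alt_translate[of f 1] by simp

lemma join_res_bialt:
  assumes F: "F \<in> alt K" and G: "G \<in> alt L"
  shows "join_res F G \<in> bialt K L"
proof -
  have "(\<lambda>xs. join_res F G xs ys) \<in> alt K" for ys
  proof (cases "even (length ys)")
    case True
    then show ?thesis by (simp add: join_res_def alt_mult_const F)
  next
    case False
    then have "(\<lambda>xs. join_res F G xs ys) = (\<lambda>xs. if even (length xs) then F (map t xs) * G ys
        else \<Sum>k<p. \<Sum>l<k. F (map (t ^^ k) xs) * G (map (u ^^ l) ys))"
      by (simp add: join_res_def)
    also have "\<dots> \<in> alt K"
      by (intro alt_if alt_sum alt_mult_const alt_translate1 A.alt_translate F list_cob_mset_even)
    finally show ?thesis .
  qed
  moreover have "join_res F G xs \<in> alt L" for xs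
    unfolding join_res_def[abs_def]
    by (intro alt_if alt_sum alt_cmult B.alt_translate G list_cob_mset_even)
      (auto intro!: alt_cmult alt_sum B.alt_translate G)
  ultimately show ?thesis by (simp add: bialt_def)
qed

lemma map_map_pow: "map (t ^^ k) (map t xs) = map (t ^^ Suc k) xs"
  "map (u ^^ k) (map u ys) = map (u ^^ Suc k) ys"
  by (simp_all add: funpow_swap1 comp_def)

text \<open>Along the orbits of \<open>xs\<close> and \<open>ys\<close> everything is expressed by
  two p-periodic sequences f and g. A coboundary flips the parity of one length, so each case
  combines two neighbouring clauses of \<open>join_res\<close>.\<close>

lemma join_res_cob:
  assumes F: "A.resolution F" and G: "B.resolution G"
  shows "coboundary K (\<lambda>xs. join_res F G xs ys) xs + (- 1) ^ length xs * coboundary L (join_res F G xs) ys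
    = (if odd (length xs + length ys)
       then \<Sum>k<p. join_res F G (map (t ^^ k) xs) (map (u ^^ k) ys)
       else join_res F G xs ys - join_res F G (map t xs) (map u ys))"
proof -
  define f where "f k = F (map (t ^^ k) xs)" for k
  define g where "g l = G (map (u ^^ l) ys)" for l
  have f0: "F xs = f 0" "F (map t xs) = f 1" "F (map (t ^^ k) xs) = f k"
    "F (map (t ^^ k) (map t xs)) = f (Suc k)" "F (map t (map (t ^^ k) xs)) = f (Suc k)" for k
    by (simp_all only: f_def map_map_pow) (simp_all add: comp_def)
  have g0: "G ys = g 0" "G (map u ys) = g 1" "G (map (u ^^ k) ys) = g k"
    "G (map (u ^^ k) (map u ys)) = g (Suc k)" for k
    by (simp_all only: g_def map_map_pow) simp_all
  have fp: "f p = f 0" and gp: "g p = g 0" by (simp_all add: f_def g_def A.t_period B.t_period)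
  have cF: "coboundary K F (map (t ^^ k) xs) = (if odd (length xs) then \<Sum>k<p. f k else f k - f (Suc k))" for k
    using A.resolutionD(3)[OF F, of "map (t ^^ k) xs"] A.norm_op_pow[of F k xs]
    by (simp add: res_op_def norm_op_def diff_op_def f_def comp_def)
  have cG: "coboundary L G (map (u ^^ k) ys) = (if odd (length ys) then \<Sum>k<p. g k else g k - g (Suc k))" for k
    using B.resolutionD(3)[OF G, of "map (u ^^ k) ys"] B.norm_op_pow[of G k ys]
    by (simp add: res_op_def norm_op_def diff_op_def g_def comp_def)
  have cF0: "coboundary K F xs = (if odd (length xs) then \<Sum>k<p. f k else f 0 - f 1)"
    "coboundary K F (map t xs) = (if odd (length xs) then \<Sum>k<p. f k else f 1 - f (Suc 1))"
    using cF[of 0] cF[of 1] by simp_all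
  have cG0: "coboundary L G ys = (if odd (length ys) then \<Sum>k<p. g k else g 0 - g 1)"
    using cG[of 0] by simp
  consider (ee) "even (length xs)" "even (length ys)" | (oe) "odd (length xs)" "even (length ys)"
    | (eo) "even (length xs)" "odd (length ys)" | (oo) "odd (length xs)" "odd (length ys)" by blast
  then show ?thesis
  proof cases
    \<comment> \<open>The identity f0 g0 - f1 g1 = (f0 - f1) g0 + f1 (g0 - g1) forces the shift of
      the first factor in the clause for even and odd lengths.\<close>
    case ee
    have "coboundary K (\<lambda>xs. join_res F G xs ys) xs = coboundary K (\<lambda>xs. F xs * g 0) xs"
      by (rule coboundary_cong, drule parity_pred) (use ee in \<open>simp add: join_res_def g0\<close>)
    also have "\<dots> = (f 0 - f 1) * g 0" using ee by (simp add: coboundary_mult_const cF0)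
    finally have 1: "coboundary K (\<lambda>xs. join_res F G xs ys) xs = (f 0 - f 1) * g 0" .
    have "coboundary L (join_res F G xs) ys = coboundary L (\<lambda>ys. f 1 * G ys) ys"
      by (rule coboundary_cong, drule parity_pred) (use ee in \<open>simp add: join_res_def f0\<close>)
    also have "\<dots> = f 1 * (g 0 - g 1)" using ee by (simp add: coboundary_cmult cG0)
    finally show ?thesis
      using ee 1 by (simp add: join_res_def f0 g0 algebra_simps)
  next
    \<comment> \<open>The rows of the triangle contribute the sum of f k (g 0 - g k) with a minus
      sign; its first half cancels the other coboundary and the diagonal norm remains.\<close>
    case oe
    have "coboundary K (\<lambda>xs. join_res F G xs ys) xs = coboundary K (\<lambda>xs. F xs * g 0) xs"
      by (rule coboundary_cong, drule parity_pred) (use oe in \<open>simp add: join_res_def g0\<close>)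
    also have "\<dots> = (\<Sum>k<p. f k) * g 0" using oe by (simp add: coboundary_mult_const cF0)
    finally have 1: "coboundary K (\<lambda>xs. join_res F G xs ys) xs = (\<Sum>k<p. f k) * g 0" .
    have "coboundary L (join_res F G xs) ys =
        coboundary L (\<lambda>ys. \<Sum>k<p. \<Sum>l<k. f k * G (map (u ^^ l) ys)) ys"
      by (rule coboundary_cong, drule parity_pred) (use oe in \<open>simp add: join_res_def f0\<close>)
    also have "\<dots> = (\<Sum>k<p. \<Sum>l<k. f k * (g l - g (Suc l)))"
      using oe by (simp add: coboundary_sum coboundary_cmult B.coboundary_translate cG)
    also have "\<dots> = (\<Sum>k<p. f k * (g 0 - g k))" by (rule sum_triangle_rows)
    finally show ?thesis
      using oe 1 by (simp add: join_res_def f0 g0 right_diff_distrib sum_subtractf sum_distrib_right)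
  next
    \<comment> \<open>The columns leave f (l + 1) g l, which is the diagonal norm of the shifted
      product.\<close>
    case eo
    have "coboundary K (\<lambda>xs. join_res F G xs ys) xs =
        coboundary K (\<lambda>xs. \<Sum>k<p. \<Sum>l<k. F (map (t ^^ k) xs) * g l) xs"
      by (rule coboundary_cong, drule parity_pred) (use eo in \<open>simp add: join_res_def g0\<close>)
    also have "\<dots> = (\<Sum>k<p. \<Sum>l<k. (f k - f (Suc k)) * g l)"
      using eo by (simp add: coboundary_sum coboundary_mult_const A.coboundary_translate cF)
    also have "\<dots> = (\<Sum>l<p. (f (Suc l) - f p) * g l)" by (rule sum_triangle_columns)
    finally have 1: "coboundary K (\<lambda>xs. join_res F G xs ys) xs = (\<Sum>l<p. (f (Suc l) - f 0) * g l)"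
      by (simp add: fp)
    have "coboundary L (join_res F G xs) ys = coboundary L (\<lambda>ys. f 0 * G ys) ys"
      by (rule coboundary_cong, drule parity_pred) (use eo in \<open>simp add: join_res_def f0\<close>)
    also have "\<dots> = f 0 * (\<Sum>l<p. g l)" using eo by (simp add: coboundary_cmult cG0)
    finally show ?thesis
      using eo 1 by (simp add: join_res_def f0 g0 left_diff_distrib sum_subtractf sum_distrib_left
          del: map_map)
  next
    \<comment> \<open>Read backwards: the diagonal difference of the triangular sum telescopes to
      the norm of one factor times the other.\<close>
    case oo
    have "coboundary K (\<lambda>xs. join_res F G xs ys) xs = coboundary K (\<lambda>xs. F (map t xs) * g 0) xs"
      by (rule coboundary_cong, drule parity_pred) (use oo in \<open>simp add: join_res_def g0\<close>)
    also have "\<dots> = (\<Sum>k<p. f k) * g 0"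
      using oo by (simp add: coboundary_mult_const A.coboundary_translate cF0)
    finally have 1: "coboundary K (\<lambda>xs. join_res F G xs ys) xs = (\<Sum>k<p. f k) * g 0" .
    have "coboundary L (join_res F G xs) ys = coboundary L (\<lambda>ys. f 0 * G ys) ys"
      by (rule coboundary_cong, drule parity_pred) (use oo in \<open>simp add: join_res_def f0\<close>)
    also have "\<dots> = f 0 * (\<Sum>l<p. g l)" using oo by (simp add: coboundary_cmult cG0)
    finally have 2: "coboundary L (join_res F G xs) ys = f 0 * (\<Sum>l<p. g l)" .
    have "join_res F G xs ys - join_res F G (map t xs) (map u ys) =
        (\<Sum>k<p. \<Sum>l<k. f k * g l - f (Suc k) * g (Suc l))"
      using oo by (simp add: join_res_def f0 g0 sum_subtractf del: map_map)
    also have "\<dots> = (\<Sum>k<p. f k * g 0) - f 0 * g 0 - (\<Sum>l<p. f p * g l) + f p * g 0"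
      by (rule sum_triangle_telescope)
    also have "\<dots> = (\<Sum>k<p. f k) * g 0 - f 0 * (\<Sum>l<p. g l)"
      by (simp add: fp sum_distrib_left sum_distrib_right)
    finally show ?thesis using oo 1 2 by simp
  qed
qed

lemma join_resolution:
  assumes F: "A.resolution F" and G: "B.resolution G"
  shows "J.resolution (join_extend (join_res F G))"
proof -
  let ?J = "complex_join K L" and ?\<theta> = "join_extend (join_res F G)"
  have \<theta>: "?\<theta> \<in> alt ?J"
    by (intro join_extend_alt join_res_bialt A.resolutionD[OF F] B.resolutionD[OF G])
  have "coboundary ?J ?\<theta> zs = res_op p (map_sum t u) (length zs) ?\<theta> zs" for zs
  proof (rule join_restrict_inject[OF coboundary_alt[OF \<theta>] J.res_op_alt[OF \<theta>]])
    fix xs :: "'a list" and ys :: "'b list" assume l: "length xs + length ys = length zs"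
    show "join_restrict (coboundary ?J ?\<theta>) xs ys =
        join_restrict (res_op p (map_sum t u) (length zs) ?\<theta>) xs ys"
      unfolding join_restrict_coboundary[OF \<theta>] join_restrict_extend join_res_cob[OF F G] l res_op_def
      by (simp add: join_restrict_norm_op join_restrict_diff_op)
  qed
  then show ?thesis
    using \<theta> A.resolutionD(2)[OF F] B.resolutionD(2)[OF G]
    by (simp add: J.resolution_def join_extend_def join_res_def)
qed

lemma join_res_eq_0:
  assumes "\<And>xs. M < length xs \<Longrightarrow> F xs = 0" "\<And>ys. N < length ys \<Longrightarrow> G ys = 0"
    and "M < length xs \<or> N < length ys"
  shows "join_res F G xs ys = 0"
  using assms by (auto simp: join_res_def)

lemma length_lefts_rights: "length (lefts zs) + length (rights zs) = length zs"
  using mset_eq_length[OF mset_lefts_rights[of zs]] by simp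

lemma null_join:
  assumes "A.null M" "B.null N"
  shows "J.null (M + N)"
proof -
  obtain F where F: "A.resolution F" "\<And>xs. M < length xs \<Longrightarrow> F xs = 0"
    using assms(1) unfolding A.null_def by blast
  obtain G where G: "B.resolution G" "\<And>ys. N < length ys \<Longrightarrow> G ys = 0"
    using assms(2) unfolding B.null_def by blast
  have "join_extend (join_res F G) zs = 0" if "M + N < length zs" for zs
  proof -
    have "M < length (lefts zs) \<or> N < length (rights zs)"
      using that length_lefts_rights[of zs] by linarith
    then show ?thesis using join_res_eq_0[OF F(2) G(2)] by (simp add: join_extend_def)
  qed
  then show ?thesis using join_resolution[OF F(1) G(1)] unfolding J.null_def by blast
qed

theorem smith_index_join_le:
  "smith_index p (complex_join K L) (map_sum t u) \<le> smith_index p K t + smith_index p L u"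
  unfolding J.smith_index_le_iff by (intro null_join A.null_smith_index B.null_smith_index)

end

subsection \<open>Two divisible classes\<close>

context Zp_action
begin

lemma norm_op_lift_op_even: "even n \<Longrightarrow> norm_op p t (lift_op n f) xs = 0"
proof -
  assume "even n"
  then have "lift_op n f = (\<lambda>xs. int p * f xs - norm_op p t f xs)" by (simp add: fun_eq_iff lift_op_def)
  then have "norm_op p t (lift_op n f) xs = int p * norm_op p t f xs - norm_op p t (norm_op p t f) xs"
    by (simp add: norm_op_def sum_subtractf sum_distrib_left)
  then show ?thesis by (simp add: norm_op_norm_op)
qed

lemma lift_op_odd_pow: "odd n \<Longrightarrow> lift_op n f (map (t ^^ k) xs) = lift_op n f xs"
  by (simp add: lift_op_def norm_op_pow)

end

context Zp_pair
begin

text \<open>With a and b the values of \<psi> and \<open>G\<close> along the orbits, the top product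
  is (p a0 - sum of the a k) b0. Adding the diagonally invariant \<open>W\<close>, the sum of a k b
  k, gives the sum of (a0 - a k)(b0 - b k), because the b k add up to 0. This is a coboundary of the
  triangular sum \<open>X\<close>, whose first factors \<psi> - \<psi> t^k are closed since the
  coboundary of \<psi> is invariant.\<close>

lemma null_join_if_divisible_correction:
  assumes F: "A.resolution F" "\<And>xs. M < length xs \<Longrightarrow> F xs = 0"
    and G: "B.resolution G" "\<And>ys. N < length ys \<Longrightarrow> G ys = 0"
    and M: "even M" "0 < M" and N: "even N" "0 < N"
    and \<psi>: "\<psi> \<in> alt_n K M" "\<And>xs. diff_op t (coboundary K \<psi>) xs = 0"
    and F_M: "\<And>xs. length xs = M \<Longrightarrow> F xs = lift_op_K xs"
    and lift: "\<And>xs. lift_op_K xs = int p * \<psi> xs - norm_op p t \<psi> xs"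
    and G_N: "\<And>ys. length ys = N \<Longrightarrow> norm_op p u G ys = 0"
  defines "g \<equiv> part (N - 1) G"
  defines "X \<equiv> (\<lambda>xs ys. \<Sum>k<p. \<Sum>l<k. (\<psi> xs - \<psi> (map (t ^^ k) xs)) * g (map (u ^^ l) ys))"
  defines "W \<equiv> (\<lambda>xs ys. \<Sum>k<p. \<psi> (map (t ^^ k) xs) * part N G (map (u ^^ k) ys))"
  assumes l: "length xs + length ys = M + N"
  shows "join_res F G xs ys =
    join_restrict (coboundary (complex_join K L) (join_extend X)) xs ys - W xs ys"
proof -
  have g: "g \<in> alt L" unfolding g_def by (rule alt_n_alt[OF part_alt_n[OF B.resolutionD(1)[OF G(1)]]])
  have \<psi>a: "\<psi> \<in> alt K" by (rule alt_n_alt[OF \<psi>(1)])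
  have X: "X \<in> bialt K L"
    unfolding X_def bialt_def
    by (auto intro!: alt_sum alt_mult_const alt_cmult alt_diff A.alt_translate B.alt_translate \<psi>a g)
  have inv: "coboundary K \<psi> (map (t ^^ k) xs) = coboundary K \<psi> xs" for k xs
  proof (induction k)
    case (Suc k)
    have "map (t ^^ Suc k) xs = map t (map (t ^^ k) xs)" by simp
    then show ?case using Suc \<psi>(2)[of "map (t ^^ k) xs"] by (simp only: diff_op_def)
  qed simp
  have cK: "coboundary K (\<lambda>xs. X xs ys) xs = 0"
    unfolding X_def
    by (simp add: coboundary_sum coboundary_mult_const coboundary_diff A.coboundary_translate inv)
  have cL: "coboundary L (X xs) ys =
      (\<Sum>k<p. \<Sum>l<k. (\<psi> xs - \<psi> (map (t ^^ k) xs)) * coboundary L g (map (u ^^ l) ys))"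
    unfolding X_def by (simp add: coboundary_sum coboundary_cmult B.coboundary_translate)
  have R: "join_restrict (coboundary (complex_join K L) (join_extend X)) xs ys =
      (- 1) ^ length xs * coboundary L (X xs) ys"
    by (simp add: join_restrict_coboundary[OF join_extend_alt[OF X]] cK)
  show ?thesis
  proof (cases "length xs = M")
    case False
    then have "\<psi> xs = 0" "\<And>k. \<psi> (map (t ^^ k) xs) = 0" using alt_n_outside[OF \<psi>(1)] by simp_all
    moreover have "join_res F G xs ys = 0"
      using False l by (intro join_res_eq_0[OF F(2) G(2)]) auto
    ultimately show ?thesis unfolding R cL by (simp add: W_def)
  next
    case True
    then have lN: "length ys = N" using l by simp
    define a where "a k = \<psi> (map (t ^^ k) xs)" for k
    define b where "b k = G (map (u ^^ k) ys)" for k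
    have cg: "coboundary L g (map (u ^^ k) ys) = b k - b (Suc k)" for k
      using B.resolutionD(3)[OF G(1), of "map (u ^^ k) ys"] lN N
      by (simp add: g_def coboundary_part res_op_def diff_op_def b_def)
    have "(\<Sum>k<p. b k) = 0" using G_N[OF lN] by (simp add: norm_op_def b_def)
    then have "(\<Sum>k<p. (a 0 - a k) * (b 0 - b k)) =
        (int p * a 0 - (\<Sum>k<p. a k)) * b 0 + (\<Sum>k<p. a k * b k)"
      by (simp add: algebra_simps sum.distrib sum_subtractf sum_distrib_left[symmetric]
          sum_distrib_right[symmetric])
    moreover have "coboundary L (X xs) ys = (\<Sum>k<p. (a 0 - a k) * (b 0 - b k))"
    proof -
      have "coboundary L (X xs) ys = (\<Sum>k<p. \<Sum>l<k. (a 0 - a k) * (b l - b (Suc l)))"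
        unfolding cL cg by (simp add: a_def)
      also have "\<dots> = (\<Sum>k<p. (a 0 - a k) * (b 0 - b k))"
        by (rule sum_triangle_rows[of "\<lambda>k. a 0 - a k"])
      finally show ?thesis .
    qed
    moreover have "W xs ys = (\<Sum>k<p. a k * b k)" using lN by (simp add: W_def a_def b_def part_def)
    moreover have "join_res F G xs ys = (int p * a 0 - (\<Sum>k<p. a k)) * b 0"
      using lN N True by (simp add: join_res_def F_M lift norm_op_def a_def b_def)
    ultimately show ?thesis unfolding R using True M by simp
  qed
qed

text \<open>At total length m + n + 2 only the product of the two top terms survives. A top term is
  invariant if its degree is even and has norm 0 if its degree is odd, which suffices unless both
  degrees are odd; that case needs the correction by \<open>X\<close> and \<open>W\<close>.\<close>

lemma null_join_if_null_mod:
  assumes "A.null_mod m" "B.null_mod n"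
  shows "J.null (m + n + 1)"
proof -
  obtain F \<psi> where F1: "A.resolution F" and \<psi>1: "\<psi> \<in> alt_n K (Suc m)"
    and F2: "\<And>xs. Suc m < length xs \<Longrightarrow> F xs = 0"
    and F\<psi>: "\<And>xs. length xs = Suc m \<Longrightarrow> F xs = A.lift_op (Suc m) \<psi> xs"
    and \<psi>2: "\<And>xs. res_op p t (Suc m) (coboundary K \<psi>) xs = 0"
    by (rule A.null_mod_normal_form[OF assms(1)]) (rule that)
  obtain G \<eta> where G1: "B.resolution G" and \<eta>: "\<eta> \<in> alt_n L (Suc n)"
    and G2: "\<And>ys. Suc n < length ys \<Longrightarrow> G ys = 0"
    and G\<eta>: "\<And>ys. length ys = Suc n \<Longrightarrow> G ys = B.lift_op (Suc n) \<eta> ys"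
    and "\<And>ys. res_op p u (Suc n) (coboundary L \<eta>) ys = 0"
    by (rule B.null_mod_normal_form[OF assms(2)]) (rule that)
  note F = F1 F2 and G = G1 G2 and \<psi> = \<psi>1 \<psi>2
  let ?J = "complex_join K L" and ?v = "map_sum t u" and ?\<theta> = "join_extend (join_res F G)"
  have \<theta>: "J.resolution ?\<theta>" by (rule join_resolution[OF F(1) G(1)])
  have z: "join_res F G xs ys = 0" if "length xs + length ys = Suc m + Suc n" "length xs \<noteq> Suc m" for xs ys
    using that by (intro join_res_eq_0[OF F(2) G(2)]) auto
  have F\<psi>': "F (map (t ^^ k) xs) = A.lift_op (Suc m) \<psi> (map (t ^^ k) xs)" if "length xs = Suc m" for k xs
    using F\<psi> that by simp
  have F\<psi>'': "F (map t xs) = A.lift_op (Suc m) \<psi> (map t xs)" if "length xs = Suc m" for xs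
    using F\<psi> that by simp
  have G\<eta>': "G (map (u ^^ k) ys) = B.lift_op (Suc n) \<eta> (map (u ^^ k) ys)" if "length ys = Suc n" for k ys
    using G\<eta> that by simp
  have normF: "norm_op p t F xs = 0" if "length xs = Suc m" "odd m" for xs
    using that A.norm_op_lift_op_even[of "Suc m" \<psi> xs] by (simp add: norm_op_def F\<psi>')
  have normG: "norm_op p u G ys = 0" if "length ys = Suc n" "odd n" for ys
    using that B.norm_op_lift_op_even[of "Suc n" \<eta> ys] by (simp add: norm_op_def G\<eta>')
  have "\<exists>\<chi>\<in>alt_n ?J (m + n + 1). \<chi> [] = 0 \<and> (\<forall>zs. length zs = Suc (m + n + 1) \<longrightarrow>
      res_op p ?v (Suc (m + n + 1)) ?\<theta> zs = coboundary ?J (res_op p ?v (Suc (m + n + 1)) \<chi>) zs)"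
  proof (cases "odd m \<and> odd n")
    case False
    have "res_op p ?v (Suc (m + n + 1)) ?\<theta> zs = (\<lambda>zs. 0) zs" if lz: "length zs = Suc (m + n + 1)" for zs
    proof (rule join_restrict_inject[OF J.res_op_alt[OF J.resolutionD(1)[OF \<theta>]] alt_zero])
      fix xs :: "'a list" and ys :: "'b list" assume l': "length xs + length ys = length zs"
      then have l: "length xs + length ys = Suc m + Suc n" using lz by simp
      show "join_restrict (res_op p ?v (Suc (m + n + 1)) ?\<theta>) xs ys = join_restrict (\<lambda>zs. 0) xs ys"
      proof (cases "length xs = Suc m")
        case lx: False
        have "join_res F G (map f xs) (map h ys) = 0" for f h
          using z[of "map f xs" "map h ys"] l lx by simp
        moreover have "join_res F G xs ys = 0" using z l lx by simp
        ultimately show ?thesis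
          by (auto simp: res_op_def join_restrict_norm_op join_restrict_diff_op join_restrict_def[of "\<lambda>zs. 0"])
      next
        case lx: True
        then have ly: "length ys = Suc n" using l by simp
        consider (ee) "even m" "even n" | (oe) "odd m" "even n" | (eo) "even m" "odd n" using False by blast
        then show ?thesis
        proof cases
          case ee
          have "join_res F G (map t xs) (map u ys) = join_res F G xs ys"
            using ee lx ly
            by (simp add: join_res_def F\<psi>' G\<eta>' A.lift_op_odd_pow B.lift_op_odd_pow del: map_map)
              (use A.lift_op_odd_pow[of "Suc m" \<psi> 1 xs] B.lift_op_odd_pow[of "Suc n" \<eta> 1 ys] in simp)
          then show ?thesis using ee
            by (simp add: res_op_def join_restrict_diff_op join_restrict_def[of "\<lambda>zs. 0"])
        next
          case eo
          have "(\<Sum>k<p. join_res F G (map (t ^^ k) xs) (map (u ^^ k) ys)) =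
              A.lift_op (Suc m) \<psi> xs * norm_op p u G ys"
            using eo lx ly by (simp add: join_res_def F\<psi>' A.lift_op_odd_pow norm_op_def sum_distrib_left)
          then show ?thesis using eo normG[OF ly]
            by (simp add: res_op_def join_restrict_norm_op join_restrict_def[of "\<lambda>zs. 0"])
        next
          case oe
          have "F (map t (map (t ^^ k) xs)) = F (map (t ^^ k) (map t xs))" for k
            by (simp only: map_map_pow) simp
          then have "(\<Sum>k<p. join_res F G (map (t ^^ k) xs) (map (u ^^ k) ys)) =
              norm_op p t F (map t xs) * B.lift_op (Suc n) \<eta> ys"
            using oe lx ly
            by (simp add: join_res_def G\<eta>' B.lift_op_odd_pow norm_op_def sum_distrib_right del: map_map)
          then show ?thesis using oe normF[of "map t xs"] lx
            by (simp add: res_op_def join_restrict_norm_op join_restrict_def[of "\<lambda>zs. 0"])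
        qed
      qed
    qed
    then show ?thesis
      by (intro bexI[OF _ alt_n_zero]) (simp add: res_op_zero[abs_def] coboundary_zero)
  next
    case True
    define g where "g = part n G"
    define X where "X = (\<lambda>xs ys. \<Sum>k<p. \<Sum>l<k. (\<psi> xs - \<psi> (map (t ^^ k) xs)) * g (map (u ^^ l) ys))"
    define W where "W = (\<lambda>xs ys. \<Sum>k<p. \<psi> (map (t ^^ k) xs) * part (Suc n) G (map (u ^^ k) ys))"
    have corr: "join_res F G xs ys = join_restrict (coboundary ?J (join_extend X)) xs ys - W xs ys"
      if "length xs + length ys = Suc m + Suc n" for xs ys
    proof -
      have N: "n = Suc n - 1" by simp
      show ?thesis
        unfolding X_def W_def g_def
        by (subst N, rule null_join_if_divisible_correction[OF F G, where \<psi> = \<psi> and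
              lift_op_K = "A.lift_op (Suc m) \<psi>"])
          (use True \<psi> F\<psi> normG that in \<open>simp_all add: res_op_def A.lift_op_def\<close>)
    qed
    have ga: "g \<in> alt_n L n" unfolding g_def by (rule part_alt_n[OF B.resolutionD(1)[OF G(1)]])
    have "X \<in> bialt K L"
      unfolding X_def bialt_def
      by (auto intro!: alt_sum alt_mult_const alt_cmult alt_diff A.alt_translate B.alt_translate
          alt_n_alt[OF \<psi>(1)] alt_n_alt[OF ga])
    then have Xa: "join_extend X \<in> alt ?J" by (rule join_extend_alt)
    have X0: "X xs ys = 0" if "length xs + length ys \<noteq> m + n + 1" for xs ys
    proof (cases "length xs = Suc m")
      case True
      then have "length ys \<noteq> n" using that by simp
      then show ?thesis using alt_n_outside[OF ga] by (simp add: X_def)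
    next
      case False
      then show ?thesis using alt_n_outside[OF \<psi>(1)] by (simp add: X_def)
    qed
    have "X (lefts zs) (rights zs) = 0" if "length zs \<noteq> m + n + 1" for zs
      using that by (intro X0) (simp only: length_lefts_rights not_False_eq_True)
    then have Xn: "join_extend X \<in> alt_n ?J (m + n + 1)"
      using Xa by (simp add: alt_n_def join_extend_def)
    \<comment> \<open>\<open>W\<close> is a norm for the diagonal action and therefore disappears
      under d, so that only the coboundary of d \<open>X\<close> remains.\<close>
    have WW: "W (map t xs) (map u ys) = W xs ys" for xs ys
    proof -
      have "W (map t xs) (map u ys) =
          (\<Sum>k<p. \<psi> (map (t ^^ Suc k) xs) * part (Suc n) G (map (u ^^ Suc k) ys))"
        unfolding W_def by (simp only: map_map_pow)
      also have "\<dots> = W xs ys"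
        unfolding W_def by (rule sum_shift_periodic) (simp add: A.t_period B.t_period)
      finally show ?thesis .
    qed
    have "res_op p ?v (Suc (m + n + 1)) ?\<theta> zs =
        coboundary ?J (res_op p ?v (Suc (m + n + 1)) (join_extend X)) zs"
      if lz: "length zs = Suc (m + n + 1)" for zs
    proof (rule join_restrict_inject[OF J.res_op_alt[OF J.resolutionD(1)[OF \<theta>]]
          coboundary_alt[OF J.res_op_alt[OF Xa]]])
      fix xs :: "'a list" and ys :: "'b list" assume l': "length xs + length ys = length zs"
      then have l: "length xs + length ys = Suc m + Suc n" using lz by simp
      have "coboundary ?J (res_op p ?v (Suc (m + n + 1)) (join_extend X)) =
          res_op p ?v (Suc (m + n + 1)) (coboundary ?J (join_extend X))"
        by (rule ext) (rule J.coboundary_res_op)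
      then show "join_restrict (res_op p ?v (Suc (m + n + 1)) ?\<theta>) xs ys =
          join_restrict (coboundary ?J (res_op p ?v (Suc (m + n + 1)) (join_extend X))) xs ys"
        using True corr[OF l] corr[of "map t xs" "map u ys"] l WW[of xs ys]
        by (simp add: res_op_def join_restrict_diff_op)
    qed
    then show ?thesis using Xn by (intro bexI[OF _ Xn]) (auto simp: alt_n_def)
  qed
  then show ?thesis
    using J.smith_class_null_iff[OF \<theta>] J.smith_class_eq_one_iff_null by blast
qed

lemma smith_index_join_less:
  assumes "smith_index_p p K t + 1 = smith_index p K t" "smith_index_p p L u + 1 = smith_index p L u"
  shows "smith_index p (complex_join K L) (map_sum t u) + 1 \<le> smith_index p K t + smith_index p L u"
proof -
  have "A.null_mod (smith_index_p p K t)" "B.null_mod (smith_index_p p L u)"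
    by (simp_all add: A.smith_index_p_le_iff[symmetric] B.smith_index_p_le_iff[symmetric])
  then have "smith_index p (complex_join K L) (map_sum t u) \<le> smith_index_p p K t + smith_index_p p L u + 1"
    unfolding J.smith_index_le_iff by (rule null_join_if_null_mod)
  then show ?thesis using assms by simp
qed

end

subsection \<open>Linear functionals modulo a prime\<close>

text \<open>Over the field of p elements a vector outside a subspace is separated from it by a
  functional. Integer representatives avoid quotients; the induction eliminates one coordinate at a
  time by Gauss's method.\<close>

lemma separating_functional:
  fixes p :: int and B :: "('x \<Rightarrow> int) set" and f :: "'x \<Rightarrow> int"
  assumes "finite X" and p: "prime p"
    and zero: "(\<lambda>x. 0) \<in> B"
    and lin: "\<And>b c k. b \<in> B \<Longrightarrow> c \<in> B \<Longrightarrow> (\<lambda>x. b x + k * c x) \<in> B"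
    and notin: "\<And>b. b \<in> B \<Longrightarrow> \<exists>x\<in>X. \<not> p dvd f x - b x"
  shows "\<exists>g. (\<forall>b\<in>B. p dvd (\<Sum>x\<in>X. g x * b x)) \<and> \<not> p dvd (\<Sum>x\<in>X. g x * f x)"
  using assms(1) zero lin notin
proof (induction X arbitrary: B f)
  case empty
  then show ?case by blast
next
  case (insert x X)
  show ?case
  proof (cases "\<forall>b\<in>B. p dvd b x")
    case all: True
    show ?thesis
    proof (cases "p dvd f x")
      case False
      have "(\<Sum>y\<in>insert x X. (if y = x then 1 else 0) * b y) = b x" for b :: "'x \<Rightarrow> int"
      proof -
        have "(\<Sum>y\<in>X. (if y = x then 1 else 0) * b y) = 0"
          using insert(2) by (intro sum.neutral) auto
        then show ?thesis using insert(1,2) by simp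
      qed
      then show ?thesis
        using all False by (intro exI[of _ "\<lambda>y. if y = x then 1 else 0"]) simp
    next
      case True
      have "\<exists>y\<in>X. \<not> p dvd f y - b y" if "b \<in> B" for b
        using insert.prems(3)[OF that] all True that by auto
      then obtain g where g: "\<forall>b\<in>B. p dvd (\<Sum>y\<in>X. g y * b y)" "\<not> p dvd (\<Sum>y\<in>X. g y * f y)"
        using insert.IH[of B f] insert.prems by blast
      have "(\<Sum>y\<in>insert x X. (g(x := 0)) y * b y) = (\<Sum>y\<in>X. g y * b y)" for b
      proof -
        have "(\<Sum>y\<in>X. (g(x := 0)) y * b y) = (\<Sum>y\<in>X. g y * b y)"
          using insert(2) by (intro sum.cong) auto
        then show ?thesis using insert(1,2) by simp
      qed
      then show ?thesis using g by (intro exI[of _ "g(x := 0)"]) simp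
    qed
  next
    case False
    then obtain b0 where b0: "b0 \<in> B" "\<not> p dvd b0 x" by blast
    then have "coprime (b0 x) p" using p by (simp add: prime_imp_coprime coprime_commute)
    then obtain c v where c: "c * b0 x + v * p = 1"
      using bezout_int[of "b0 x" p] by (auto simp: coprime_iff_gcd_eq_1)
    \<comment> \<open>A pivot with value 1 modulo p at \<open>x\<close>. The summand 0 brings it
      into the shape of the closure hypothesis.\<close>
    define b1 where "b1 y = 0 + c * b0 y" for y
    have b1: "b1 \<in> B" unfolding b1_def by (rule insert.prems(2)[OF insert.prems(1) b0(1)])
    have b1x: "p dvd 1 - b1 x"
      unfolding b1_def by (rule dvdI[of _ _ v]) (use c in \<open>simp add: algebra_simps\<close>)
    define B' where "B' = {b \<in> B. p dvd b x}"
    define f' where "f' y = f y - f x * b1 y" for y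
    have "\<exists>y\<in>X. \<not> p dvd f' y - b y" if "b \<in> B'" for b
    proof (rule ccontr)
      assume *: "\<not> (\<exists>y\<in>X. \<not> p dvd f' y - b y)"
      have "(\<lambda>y. b y + f x * b1 y) \<in> B"
        using that b1 insert.prems(2) by (simp add: B'_def)
      then obtain y where y: "y \<in> insert x X" "\<not> p dvd f y - (b y + f x * b1 y)"
        using insert.prems(3) by blast
      show False
      proof (cases "y = x")
        case True
        have "f y - (b y + f x * b1 y) = f x * (1 - b1 x) - b x"
          using True by (simp add: algebra_simps)
        then show False using y(2) b1x that by (simp add: B'_def)
      next
        case False
        then show False using * y by (auto simp: f'_def algebra_simps)
      qed
    qed
    moreover have "(\<lambda>x. 0) \<in> B'" using insert.prems(1) by (simp add: B'_def)
    moreover have "(\<lambda>x. b x + k * c x) \<in> B'" if "b \<in> B'" "c \<in> B'" for b c k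
      using that insert.prems(2) by (simp add: B'_def)
    ultimately obtain g where g: "\<forall>b\<in>B'. p dvd (\<Sum>y\<in>X. g y * b y)" "\<not> p dvd (\<Sum>y\<in>X. g y * f' y)"
      using insert.IH[of B' f'] by blast
    \<comment> \<open>The weight at \<open>x\<close> is chosen so that evaluation of
      \<open>g'\<close> on b is evaluation of \<open>g\<close> on b after elimination of its
      \<open>x\<close>-coordinate with the pivot.\<close>
    define g' where "g' = g(x := - (\<Sum>y\<in>X. g y * b1 y))"
    have eval: "(\<Sum>y\<in>insert x X. g' y * b y) = (\<Sum>y\<in>X. g y * (b y - b x * b1 y))" for b
    proof -
      have "(\<Sum>y\<in>X. g' y * b y) = (\<Sum>y\<in>X. g y * b y)"
        using insert(2) by (intro sum.cong) (auto simp: g'_def)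
      then show ?thesis using insert(1,2)
        by (simp add: g'_def algebra_simps sum_subtractf sum_distrib_left)
    qed
    have "p dvd (\<Sum>y\<in>insert x X. g' y * b y)" if b: "b \<in> B" for b
    proof -
      have "(\<lambda>y. b y + (- b x) * b1 y) \<in> B" using insert.prems(2)[OF b b1] by blast
      moreover have "b x + (- b x) * b1 x = b x * (1 - b1 x)" by (simp add: algebra_simps)
      ultimately have "(\<lambda>y. b y - b x * b1 y) \<in> B'" using b1x by (simp add: B'_def)
      from bspec[OF g(1) this] show ?thesis unfolding eval .
    qed
    moreover have "\<not> p dvd (\<Sum>y\<in>insert x X. g' y * f y)"
      unfolding eval using g(2) by (simp add: f'_def)
    ultimately show ?thesis by blast
  qed
qed

context Zp_action
begin

text \<open>A functional modulo p that kills \<open>D\<close> of all coboundaries. \<open>D\<close>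
  is independent of the parity of \<open>n\<close>, because in even Smith degrees both the condition
  with s and the stronger one with d are used.\<close>

definition dual_weights :: "nat \<Rightarrow> (('a list \<Rightarrow> int) \<Rightarrow> 'a list \<Rightarrow> int) \<Rightarrow> ('a list \<Rightarrow> int) \<Rightarrow> 'a list set \<Rightarrow> bool" where
  "dual_weights n D g X \<longleftrightarrow> finite X \<and> (\<forall>xs\<in>X. length xs = n) \<and>
     (\<forall>f\<in>alt K. int p dvd (\<Sum>xs\<in>X. g xs * D (coboundary K f) xs))"

lemma finite_simplex_lists: "finite {xs. simplex_list K xs \<and> length xs = n}"
proof (rule finite_subset)
  show "{xs. simplex_list K xs \<and> length xs = n} \<subseteq> {xs. set xs \<subseteq> \<Union>K \<and> length xs = n}"
    by (auto simp: simplex_list_def)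
  show "finite {xs. set xs \<subseteq> \<Union>K \<and> length xs = n}"
    using finite_K finite_simplex by (intro finite_lists_length_eq) blast
qed

text \<open>If the Smith cocycle agreed modulo p with a coboundary of the subcomplex, the class
  would vanish modulo p; so linear algebra over the field of p elements separates the two.\<close>

lemma dual_weights_exist:
  assumes p: "prime p" and F: "resolution F" and nn: "\<not> null_mod n"
  obtains g X where "dual_weights (Suc n) (res_op p t (Suc n)) g X"
    "\<not> int p dvd (\<Sum>xs\<in>X. g xs * res_op p t (Suc n) F xs)"
proof -
  let ?D = "res_op p t (Suc n)"
  define X where "X = {xs. simplex_list K xs \<and> length xs = Suc n}"
  define B where "B = {?D (coboundary K \<chi>) | \<chi>. \<chi> \<in> alt_n K n \<and> \<chi> [] = 0}"
  have "(\<lambda>xs. 0) \<in> B"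
    unfolding B_def by (intro CollectI exI[of _ "\<lambda>_. 0"])
      (simp add: alt_n_zero coboundary_zero[abs_def] res_op_zero[abs_def])
  moreover have "(\<lambda>xs. b xs + k * c xs) \<in> B" if b: "b \<in> B" and c: "c \<in> B" for b c k
  proof -
    obtain \<chi> where \<chi>: "b = ?D (coboundary K \<chi>)" "\<chi> \<in> alt_n K n" "\<chi> [] = 0" using b by (auto simp: B_def)
    obtain \<chi>' where \<chi>': "c = ?D (coboundary K \<chi>')" "\<chi>' \<in> alt_n K n" "\<chi>' [] = 0" using c by (auto simp: B_def)
    have "(\<lambda>xs. b xs + k * c xs) = ?D (coboundary K (\<lambda>xs. \<chi> xs + k * \<chi>' xs))"
      unfolding coboundary_add[abs_def] coboundary_cmult[abs_def]
      by (rule ext) (simp add: res_op_add res_op_cmult \<chi>(1) \<chi>'(1))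
    moreover have "(\<lambda>xs. \<chi> xs + k * \<chi>' xs) \<in> alt_n K n"
      by (intro alt_n_add alt_n_cmult \<chi> \<chi>')
    ultimately show ?thesis unfolding B_def using \<chi>(3) \<chi>'(3)
      by (intro CollectI exI[of _ "\<lambda>xs. \<chi> xs + k * \<chi>' xs"]) simp
  qed
  moreover have "\<exists>xs\<in>X. \<not> int p dvd ?D F xs - b xs" if b: "b \<in> B" for b
  proof (rule ccontr)
    assume "\<not> (\<exists>xs\<in>X. \<not> int p dvd ?D F xs - b xs)"
    then have dvd: "int p dvd ?D F xs - b xs" if "simplex_list K xs" "length xs = Suc n" for xs
      using that by (auto simp: X_def)
    obtain \<chi> where \<chi>: "b = ?D (coboundary K \<chi>)" "\<chi> \<in> alt_n K n" "\<chi> [] = 0" using b by (auto simp: B_def)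
    define w where "w xs = ?D (part (Suc n) F) xs - ?D (coboundary K \<chi>) xs" for xs
    have w: "w \<in> alt_n K (Suc n)"
      unfolding w_def by (intro alt_n_diff res_op_alt_n part_alt_n resolutionD[OF F] coboundary_alt_n \<chi>(2))
    have "int p dvd w xs" for xs
    proof (cases "simplex_list K xs \<and> length xs = Suc n")
      case True
      then show ?thesis using dvd[of xs] by (simp add: w_def res_op_part \<chi>(1))
    next
      case False
      then have "w xs = 0" using alt_n_outside[OF w] alt_outside[OF alt_n_alt[OF w]] by blast
      then show ?thesis by simp
    qed
    then obtain \<psi> where \<psi>: "\<psi> \<in> alt_n K (Suc n)" "\<And>xs. w xs = int p * \<psi> xs"
      using alt_n_divide[OF w, of "int p"] p_pos by auto
    \<comment> \<open>The quotient by p is again killed by \<open>res_op p t n\<close>, as integers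
      have no torsion, and thus is a value of \<open>res_op p t (Suc n)\<close>. A mere congruence
      modulo p has become vanishing in the reduced subcomplex.\<close>
    have "int p * res_op p t n \<psi> xs = 0" for xs
    proof -
      have "int p * res_op p t n \<psi> xs = res_op p t n w xs"
        unfolding res_op_cmult[symmetric] \<psi>(2)[symmetric] ..
      also have "\<dots> = 0" unfolding w_def by (simp add: res_op_diff res_op_res_op)
      finally show ?thesis .
    qed
    then have "res_op p t n \<psi> xs = 0" for xs using p_pos by simp
    then obtain \<psi>' where \<psi>': "\<psi>' \<in> alt_n K (Suc n)" "\<And>xs. ?D \<psi>' xs = \<psi> xs"
      using exact_res_op[OF \<psi>(1), of n] by auto
    have "?D F xs = coboundary K (?D \<chi>) xs + int p * ?D \<psi>' xs" if "length xs = Suc n" for xs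
      using \<psi>(2)[of xs] \<psi>'(2)[of xs] that by (simp add: w_def res_op_part coboundary_res_op)
    then have "null_mod n" unfolding null_mod_iff[OF F] using \<chi>(2,3) \<psi>'(1) by blast
    then show False using nn by simp
  qed
  ultimately obtain g where g: "\<forall>b\<in>B. int p dvd (\<Sum>xs\<in>X. g xs * b xs)"
    "\<not> int p dvd (\<Sum>xs\<in>X. g xs * ?D F xs)"
    using separating_functional[of X "int p" B "?D F"] finite_simplex_lists[of "Suc n"] p
    unfolding X_def by auto
  have "int p dvd (\<Sum>xs\<in>X. g xs * ?D (coboundary K f) xs)" if f: "f \<in> alt K" for f
  proof (cases n)
    \<comment> \<open>Coboundaries of the augmentation degree do not lie in \<open>B\<close>, but
      they are constant on vertices, so their norm is a multiple of p.\<close>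
    case 0
    have "?D (coboundary K f) xs = int p * f []" if "xs \<in> X" for xs
    proof -
      have s: "simplex_list K (map (t ^^ k) xs)" for k using that by (simp add: X_def)
      have l: "length (map (t ^^ k) xs) = 1" for k using that 0 by (simp add: X_def)
      have "coboundary K f (map (t ^^ k) xs) = f []" for k
        using s[of k] l[of k] by (cases "map (t ^^ k) xs") (auto simp: coboundary_eq list_cob_Cons simp del: map_eq_Cons_conv)
      then show ?thesis using 0 by (simp add: res_op_def norm_op_def)
    qed
    then have "(\<Sum>xs\<in>X. g xs * ?D (coboundary K f) xs) = (\<Sum>xs\<in>X. int p * (g xs * f []))"
      by (intro sum.cong) auto
    then show ?thesis by (simp add: sum_distrib_left[symmetric])
  next
    case (Suc k)
    have eq: "?D (coboundary K f) xs = ?D (coboundary K (part n f)) xs" if "xs \<in> X" for xs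
      using that by (intro res_op_cong) (simp add: X_def coboundary_part)
    have "?D (coboundary K (part n f)) \<in> B"
      unfolding B_def using part_alt_n[OF f, of n] Suc by (auto simp: part_def)
    then have "int p dvd (\<Sum>xs\<in>X. g xs * ?D (coboundary K (part n f)) xs)" using g(1) by blast
    also have "(\<Sum>xs\<in>X. g xs * ?D (coboundary K (part n f)) xs) = (\<Sum>xs\<in>X. g xs * ?D (coboundary K f) xs)"
      by (intro sum.cong) (auto simp: eq)
    finally show ?thesis .
  qed
  then have "dual_weights (Suc n) ?D g X"
    using finite_simplex_lists[of "Suc n"] by (simp add: dual_weights_def X_def)
  then show ?thesis using g(2) that by blast
qed

text \<open>Telescoping over the translates of \<open>f\<close>: on coboundaries the functional is
  invariant modulo p.\<close>

lemma dual_weights_diff_pow: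
  assumes d: "dual_weights n (diff_op t) g X" and f: "f \<in> alt K"
  shows "int p dvd (\<Sum>xs\<in>X. g xs * coboundary K f xs) - (\<Sum>xs\<in>X. g xs * coboundary K f (map (t ^^ k) xs))"
proof (induction k)
  case (Suc k)
  have "int p dvd (\<Sum>xs\<in>X. g xs * diff_op t (coboundary K (\<lambda>xs. f (map (t ^^ k) xs))) xs)"
    using d alt_translate[OF f] unfolding dual_weights_def by blast
  also have "(\<Sum>xs\<in>X. g xs * diff_op t (coboundary K (\<lambda>xs. f (map (t ^^ k) xs))) xs) =
     (\<Sum>xs\<in>X. g xs * coboundary K f (map (t ^^ k) xs)) - (\<Sum>xs\<in>X. g xs * coboundary K f (map (t ^^ Suc k) xs))"
  proof -
    have "map (t ^^ k) (map t xs) = map (t ^^ Suc k) xs" for xs by (simp add: funpow_swap1 comp_def)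
    then show ?thesis
      by (simp only: diff_op_def coboundary_translate right_diff_distrib sum_subtractf)
  qed
  finally have "int p dvd (\<Sum>xs\<in>X. g xs * coboundary K f (map (t ^^ k) xs)) -
      (\<Sum>xs\<in>X. g xs * coboundary K f (map (t ^^ Suc k) xs))" .
  from dvd_add[OF Suc this] show ?case by (simp del: funpow.simps)
qed simp

end

subsection \<open>Lower bounds for the index of a join\<close>

text \<open>The tensor product of the functionals with weights \<open>g\<close> and
  \<open>h\<close>.\<close>

definition pairing ::
    "('x \<Rightarrow> int) \<Rightarrow> 'x set \<Rightarrow> ('y \<Rightarrow> int) \<Rightarrow> 'y set \<Rightarrow> ('x \<Rightarrow> 'y \<Rightarrow> int) \<Rightarrow> int" where
  "pairing g X h Y \<theta> = (\<Sum>x\<in>X. \<Sum>y\<in>Y. g x * h y * \<theta> x y)"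

lemma pairing_cong:
  "(\<And>x y. x \<in> X \<Longrightarrow> y \<in> Y \<Longrightarrow> \<theta> x y = \<theta>' x y) \<Longrightarrow> pairing g X h Y \<theta> = pairing g X h Y \<theta>'"
  by (simp add: pairing_def)

lemma pairing_add:
  "pairing g X h Y (\<lambda>x y. \<theta> x y + \<theta>' x y) = pairing g X h Y \<theta> + pairing g X h Y \<theta>'"
  by (simp add: pairing_def distrib_left sum.distrib)

lemma pairing_cmult: "pairing g X h Y (\<lambda>x y. c * \<theta> x y) = c * pairing g X h Y \<theta>"
  by (simp add: pairing_def sum_distrib_left mult.left_commute)

lemma pairing_product:
  "pairing g X h Y (\<lambda>x y. f x * e y) = (\<Sum>x\<in>X. g x * f x) * (\<Sum>y\<in>Y. h y * e y)"
  by (simp add: pairing_def sum_product mult_ac)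

lemma pairing_swap: "pairing g X h Y \<theta> = pairing h Y g X (\<lambda>y x. \<theta> x y)"
  unfolding pairing_def by (subst sum.swap) (simp add: mult_ac)

lemma dvd_pairing_right:
  assumes "\<And>x. x \<in> X \<Longrightarrow> c dvd (\<Sum>y\<in>Y. h y * \<theta> x y)"
  shows "c dvd pairing g X h Y \<theta>"
proof -
  have "pairing g X h Y \<theta> = (\<Sum>x\<in>X. g x * (\<Sum>y\<in>Y. h y * \<theta> x y))"
    by (simp add: pairing_def sum_distrib_left mult.assoc)
  then show ?thesis using assms by (simp add: dvd_sum)
qed

lemma dvd_pairing_left:
  assumes "\<And>y. y \<in> Y \<Longrightarrow> c dvd (\<Sum>x\<in>X. g x * \<theta> x y)"
  shows "c dvd pairing g X h Y \<theta>"
  unfolding pairing_swap[of g X h Y] by (rule dvd_pairing_right) (rule assms)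

context Zp_pair
begin

abbreviation join_cob :: "('a list \<Rightarrow> 'b list \<Rightarrow> int) \<Rightarrow> 'a list \<Rightarrow> 'b list \<Rightarrow> int" where
  "join_cob R xs ys \<equiv> coboundary K (\<lambda>xs. R xs ys) xs + (- 1) ^ length xs * coboundary L (R xs) ys"

text \<open>The vanishing of the class of the join, rewritten for two lists of the critical lengths.
  \<open>R\<close> is the null-homotopy and \<Psi> the error divided by p; the parity of
  \<open>m + n\<close> decides between d and s of the diagonal action.\<close>

lemma null_mod_join:
  assumes F: "A.resolution F" and G: "B.resolution G" and nm: "J.null_mod (m + n + 1)"
  obtains R \<Psi> where "R \<in> bialt K L"
    "\<And>xs ys. length xs = Suc m \<Longrightarrow> length ys = Suc n \<Longrightarrow> even (m + n) \<Longrightarrow>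
      join_res F G xs ys - join_res F G (map t xs) (map u ys) =
      join_cob R xs ys - join_cob R (map t xs) (map u ys) + int p * \<Psi> xs ys"
    "\<And>xs ys. length xs = Suc m \<Longrightarrow> length ys = Suc n \<Longrightarrow> odd (m + n) \<Longrightarrow>
      (\<Sum>k<p. join_res F G (map (t ^^ k) xs) (map (u ^^ k) ys)) =
      (\<Sum>k<p. join_cob R (map (t ^^ k) xs) (map (u ^^ k) ys)) + int p * \<Psi> xs ys"
proof -
  let ?J = "complex_join K L" and ?v = "map_sum t u" and ?\<theta> = "join_extend (join_res F G)"
  have \<theta>: "J.resolution ?\<theta>" by (rule join_resolution[OF F G])
  obtain \<chi> \<psi> where \<chi>: "\<chi> \<in> alt_n ?J (m + n + 1)" and \<psi>: "\<psi> \<in> alt_n ?J (Suc (m + n + 1))"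
    and eq: "\<And>zs. length zs = Suc (m + n + 1) \<Longrightarrow> res_op p ?v (Suc (m + n + 1)) ?\<theta> zs =
        coboundary ?J (res_op p ?v (Suc (m + n + 1)) \<chi>) zs + int p * res_op p ?v (Suc (m + n + 1)) \<psi> zs"
    using nm J.null_mod_iff[OF \<theta>] by blast
  have c: "join_restrict (coboundary ?J \<chi>) xs ys = join_cob (join_restrict \<chi>) xs ys" for xs ys
    by (rule join_restrict_coboundary[OF alt_n_alt[OF \<chi>]])
  have e: "join_restrict (res_op p ?v (Suc (m + n + 1)) ?\<theta>) xs ys =
      join_restrict (res_op p ?v (Suc (m + n + 1)) (coboundary ?J \<chi>)) xs ys
      + int p * join_restrict (res_op p ?v (Suc (m + n + 1)) \<psi>) xs ys"
    if "length xs = Suc m" "length ys = Suc n" for xs ys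
    using eq[of "map Inl xs @ map Inr ys"] that
    by (simp add: join_restrict_def J.coboundary_res_op)
  show ?thesis
  proof (rule that[of "join_restrict \<chi>" "join_restrict (res_op p ?v (Suc (m + n + 1)) \<psi>)"])
    show "join_restrict \<chi> \<in> bialt K L" by (rule join_restrict_bialt[OF alt_n_alt[OF \<chi>]])
    show "join_res F G xs ys - join_res F G (map t xs) (map u ys) =
      join_cob (join_restrict \<chi>) xs ys - join_cob (join_restrict \<chi>) (map t xs) (map u ys)
        + int p * join_restrict (res_op p ?v (Suc (m + n + 1)) \<psi>) xs ys"
      if "length xs = Suc m" "length ys = Suc n" "even (m + n)" for xs ys
      using e[OF that(1,2)] that(3) unfolding c[symmetric]
      by (simp add: res_op_def join_restrict_diff_op)
    show "(\<Sum>k<p. join_res F G (map (t ^^ k) xs) (map (u ^^ k) ys)) =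
      (\<Sum>k<p. join_cob (join_restrict \<chi>) (map (t ^^ k) xs) (map (u ^^ k) ys))
        + int p * join_restrict (res_op p ?v (Suc (m + n + 1)) \<psi>) xs ys"
      if "length xs = Suc m" "length ys = Suc n" "odd (m + n)" for xs ys
      using e[OF that(1,2)] that(3) unfolding c[symmetric]
      by (simp add: res_op_def join_restrict_norm_op)
  qed
qed

lemma bialtD: "R \<in> bialt K L \<Longrightarrow> (\<lambda>xs. R xs ys) \<in> alt K" "R \<in> bialt K L \<Longrightarrow> R xs \<in> alt L"
  by (simp_all add: bialt_def)

lemma sum_shift_u: "(\<Sum>j<p. \<phi> (map (u ^^ Suc j) ys)) = (\<Sum>j<p. \<phi> (map (u ^^ j) ys))"
  for \<phi> :: "'b list \<Rightarrow> int"
  by (rule sum_shift_periodic) (simp add: B.t_period)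

lemma sum_shift_t: "(\<Sum>j<p. \<phi> (map (t ^^ Suc j) xs)) = (\<Sum>j<p. \<phi> (map (t ^^ j) xs))"
  for \<phi> :: "'a list \<Rightarrow> int"
  by (rule sum_shift_periodic) (simp add: A.t_period)

lemma pow_map: "map t (map (t ^^ k) xs) = map (t ^^ Suc k) xs" "map u (map (u ^^ k) ys) = map (u ^^ Suc k) ys"
  by simp_all

text \<open>Summing the relation over the translates of \<open>ys\<close> absorbs the shift by
  \<open>u\<close>, so the diagonal d becomes d on coboundaries over \<open>K\<close> and s on
  coboundaries over \<open>L\<close>; \<open>g\<close> kills the former and \<open>h\<close> the
  latter.\<close>

lemma dvd_pairing_even_left:
  assumes F: "A.resolution F" and G: "B.resolution G" and nm: "J.null_mod (m + n + 1)"
    and e: "even (m + n)"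
    and g: "A.dual_weights (Suc m) (diff_op t) g X" and h: "B.dual_weights (Suc n) (norm_op p u) h Y"
  shows "int p dvd pairing g X h Y (\<lambda>xs ys. \<Sum>j<p.
    join_res F G xs (map (u ^^ j) ys) - join_res F G (map t xs) (map (u ^^ Suc j) ys))"
proof -
  obtain R \<Psi> where R: "R \<in> bialt K L"
    and eq: "\<And>xs ys. length xs = Suc m \<Longrightarrow> length ys = Suc n \<Longrightarrow> even (m + n) \<Longrightarrow>
      join_res F G xs ys - join_res F G (map t xs) (map u ys) =
      join_cob R xs ys - join_cob R (map t xs) (map u ys) + int p * \<Psi> xs ys"
    by (rule null_mod_join[OF F G nm]) (rule that)
  define \<theta>1 where "\<theta>1 xs ys = (\<Sum>j<p. diff_op t (coboundary K (\<lambda>xs. R xs (map (u ^^ j) ys))) xs)" for xs ys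
  define \<theta>2 where "\<theta>2 xs ys = norm_op p u (coboundary L (R xs)) ys - norm_op p u (coboundary L (R (map t xs))) ys" for xs ys
  define \<theta>3 where "\<theta>3 xs ys = (\<Sum>j<p. \<Psi> xs (map (u ^^ j) ys))" for xs ys
  have "pairing g X h Y (\<lambda>xs ys. \<Sum>j<p.
      join_res F G xs (map (u ^^ j) ys) - join_res F G (map t xs) (map (u ^^ Suc j) ys)) =
    pairing g X h Y (\<lambda>xs ys. \<theta>1 xs ys + ((- 1) ^ Suc m * \<theta>2 xs ys + int p * \<theta>3 xs ys))"
  proof (rule pairing_cong)
    fix xs ys assume "xs \<in> X" "ys \<in> Y"
    then have l: "length xs = Suc m" "length ys = Suc n"
      using g h by (simp_all add: A.dual_weights_def B.dual_weights_def)
    have "join_res F G xs (map (u ^^ j) ys) - join_res F G (map t xs) (map (u ^^ Suc j) ys) =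
        join_cob R xs (map (u ^^ j) ys) - join_cob R (map t xs) (map (u ^^ Suc j) ys)
          + int p * \<Psi> xs (map (u ^^ j) ys)" for j
      using eq[of xs "map (u ^^ j) ys"] l e by (simp only: pow_map length_map)
    then have "(\<Sum>j<p. join_res F G xs (map (u ^^ j) ys) - join_res F G (map t xs) (map (u ^^ Suc j) ys)) =
        (\<Sum>j<p. join_cob R xs (map (u ^^ j) ys) - join_cob R (map t xs) (map (u ^^ Suc j) ys)
          + int p * \<Psi> xs (map (u ^^ j) ys))"
      by (simp only:)
    also have "\<dots> = (\<Sum>j<p. join_cob R xs (map (u ^^ j) ys)) - (\<Sum>j<p. join_cob R (map t xs) (map (u ^^ j) ys))
          + int p * \<theta>3 xs ys"
      unfolding \<theta>3_def sum.distrib sum_subtractf sum_distrib_left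
        sum_shift_u[of "\<lambda>ys. coboundary K (\<lambda>xs. R xs ys) (map t xs)"]
        sum_shift_u[of "\<lambda>ys. (- 1) ^ length (map t xs) * coboundary L (R (map t xs)) ys"] ..
    also have "\<dots> = \<theta>1 xs ys + ((- 1) ^ Suc m * \<theta>2 xs ys + int p * \<theta>3 xs ys)"
      by (simp add: \<theta>1_def \<theta>2_def norm_op_def diff_op_def l sum.distrib sum_subtractf
          sum_distrib_left[symmetric] right_diff_distrib sum_negf)
    finally show "(\<Sum>j<p. join_res F G xs (map (u ^^ j) ys) - join_res F G (map t xs) (map (u ^^ Suc j) ys)) =
        \<theta>1 xs ys + ((- 1) ^ Suc m * \<theta>2 xs ys + int p * \<theta>3 xs ys)" .
  qed
  also have "\<dots> = pairing g X h Y \<theta>1 + ((- 1) ^ Suc m * pairing g X h Y \<theta>2 + int p * pairing g X h Y \<theta>3)"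
    unfolding pairing_add pairing_cmult ..
  finally have main: "pairing g X h Y (\<lambda>xs ys. \<Sum>j<p.
      join_res F G xs (map (u ^^ j) ys) - join_res F G (map t xs) (map (u ^^ Suc j) ys)) =
    pairing g X h Y \<theta>1 + ((- 1) ^ Suc m * pairing g X h Y \<theta>2 + int p * pairing g X h Y \<theta>3)" .
  have "int p dvd pairing g X h Y \<theta>1"
  proof (rule dvd_pairing_left)
    fix ys
    have "(\<Sum>xs\<in>X. g xs * \<theta>1 xs ys) =
        (\<Sum>j<p. \<Sum>xs\<in>X. g xs * diff_op t (coboundary K (\<lambda>xs. R xs (map (u ^^ j) ys))) xs)"
      unfolding \<theta>1_def sum_distrib_left by (rule sum.swap)
    then show "int p dvd (\<Sum>xs\<in>X. g xs * \<theta>1 xs ys)"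
      using g bialtD(1)[OF R] unfolding A.dual_weights_def by (simp add: dvd_sum)
  qed
  moreover have "int p dvd pairing g X h Y \<theta>2"
  proof (rule dvd_pairing_right)
    fix xs
    show "int p dvd (\<Sum>ys\<in>Y. h ys * \<theta>2 xs ys)"
      using h bialtD(2)[OF R] unfolding B.dual_weights_def \<theta>2_def
      by (simp add: right_diff_distrib sum_subtractf)
  qed
  ultimately show ?thesis unfolding main by simp
qed

lemma dvd_pairing_even_right:
  assumes F: "A.resolution F" and G: "B.resolution G" and nm: "J.null_mod (m + n + 1)"
    and e: "even (m + n)"
    and g: "A.dual_weights (Suc m) (norm_op p t) g X" and h: "B.dual_weights (Suc n) (diff_op u) h Y"
  shows "int p dvd pairing g X h Y (\<lambda>xs ys. \<Sum>j<p.
    join_res F G (map (t ^^ j) xs) ys - join_res F G (map (t ^^ Suc j) xs) (map u ys))"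
proof -
  obtain R \<Psi> where R: "R \<in> bialt K L"
    and eq: "\<And>xs ys. length xs = Suc m \<Longrightarrow> length ys = Suc n \<Longrightarrow> even (m + n) \<Longrightarrow>
      join_res F G xs ys - join_res F G (map t xs) (map u ys) =
      join_cob R xs ys - join_cob R (map t xs) (map u ys) + int p * \<Psi> xs ys"
    by (rule null_mod_join[OF F G nm]) (rule that)
  define \<theta>1 where "\<theta>1 xs ys = norm_op p t (coboundary K (\<lambda>xs. R xs ys)) xs
      - norm_op p t (coboundary K (\<lambda>xs. R xs (map u ys))) xs" for xs ys
  define \<theta>2 where "\<theta>2 xs ys = (\<Sum>j<p. diff_op u (coboundary L (R (map (t ^^ j) xs))) ys)" for xs ys
  define \<theta>3 where "\<theta>3 xs ys = (\<Sum>j<p. \<Psi> (map (t ^^ j) xs) ys)" for xs ys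
  have "pairing g X h Y (\<lambda>xs ys. \<Sum>j<p.
      join_res F G (map (t ^^ j) xs) ys - join_res F G (map (t ^^ Suc j) xs) (map u ys)) =
    pairing g X h Y (\<lambda>xs ys. \<theta>1 xs ys + ((- 1) ^ Suc m * \<theta>2 xs ys + int p * \<theta>3 xs ys))"
  proof (rule pairing_cong)
    fix xs ys assume "xs \<in> X" "ys \<in> Y"
    then have l: "length xs = Suc m" "length ys = Suc n"
      using g h by (simp_all add: A.dual_weights_def B.dual_weights_def)
    have "join_res F G (map (t ^^ j) xs) ys - join_res F G (map (t ^^ Suc j) xs) (map u ys) =
        join_cob R (map (t ^^ j) xs) ys - join_cob R (map (t ^^ Suc j) xs) (map u ys)
          + int p * \<Psi> (map (t ^^ j) xs) ys" for j
      using eq[of "map (t ^^ j) xs" ys] l e by (simp only: pow_map length_map)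
    then have "(\<Sum>j<p. join_res F G (map (t ^^ j) xs) ys - join_res F G (map (t ^^ Suc j) xs) (map u ys)) =
        (\<Sum>j<p. join_cob R (map (t ^^ j) xs) ys - join_cob R (map (t ^^ Suc j) xs) (map u ys)
          + int p * \<Psi> (map (t ^^ j) xs) ys)"
      by (simp only:)
    also have "\<dots> = (\<Sum>j<p. join_cob R (map (t ^^ j) xs) ys) - (\<Sum>j<p. join_cob R (map (t ^^ j) xs) (map u ys))
          + int p * \<theta>3 xs ys"
      unfolding \<theta>3_def sum.distrib sum_subtractf sum_distrib_left
        sum_shift_t[of "\<lambda>xs. coboundary K (\<lambda>xs. R xs (map u ys)) xs"]
        sum_shift_t[of "\<lambda>xs. (- 1) ^ length xs * coboundary L (R xs) (map u ys)"] ..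
    also have "\<dots> = \<theta>1 xs ys + ((- 1) ^ Suc m * \<theta>2 xs ys + int p * \<theta>3 xs ys)"
      by (simp add: \<theta>1_def \<theta>2_def norm_op_def diff_op_def l sum.distrib sum_subtractf
          sum_distrib_left[symmetric] right_diff_distrib sum_negf)
    finally show "(\<Sum>j<p. join_res F G (map (t ^^ j) xs) ys - join_res F G (map (t ^^ Suc j) xs) (map u ys)) =
        \<theta>1 xs ys + ((- 1) ^ Suc m * \<theta>2 xs ys + int p * \<theta>3 xs ys)" .
  qed
  also have "\<dots> = pairing g X h Y \<theta>1 + ((- 1) ^ Suc m * pairing g X h Y \<theta>2 + int p * pairing g X h Y \<theta>3)"
    unfolding pairing_add pairing_cmult ..
  finally have main: "pairing g X h Y (\<lambda>xs ys. \<Sum>j<p.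
      join_res F G (map (t ^^ j) xs) ys - join_res F G (map (t ^^ Suc j) xs) (map u ys)) =
    pairing g X h Y \<theta>1 + ((- 1) ^ Suc m * pairing g X h Y \<theta>2 + int p * pairing g X h Y \<theta>3)" .
  have "int p dvd pairing g X h Y \<theta>1"
  proof (rule dvd_pairing_left)
    fix ys
    show "int p dvd (\<Sum>xs\<in>X. g xs * \<theta>1 xs ys)"
      using g bialtD(1)[OF R] unfolding A.dual_weights_def \<theta>1_def
      by (simp add: right_diff_distrib sum_subtractf)
  qed
  moreover have "int p dvd pairing g X h Y \<theta>2"
  proof (rule dvd_pairing_right)
    fix xs
    have "(\<Sum>ys\<in>Y. h ys * \<theta>2 xs ys) =
        (\<Sum>j<p. \<Sum>ys\<in>Y. h ys * diff_op u (coboundary L (R (map (t ^^ j) xs))) ys)"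
      unfolding \<theta>2_def sum_distrib_left by (rule sum.swap)
    then show "int p dvd (\<Sum>ys\<in>Y. h ys * \<theta>2 xs ys)"
      using h bialtD(2)[OF R] unfolding B.dual_weights_def by (simp add: dvd_sum)
  qed
  ultimately show ?thesis unfolding main by simp
qed

text \<open>The diagonal norm relation is compared with its shift in one factor. Both functionals
  are invariant on coboundaries modulo p, so the coboundaries of the shifted factor cancel termwise
  and those of the other factor telescope over a period.\<close>

lemma dvd_pairing_odd:
  assumes F: "A.resolution F" and G: "B.resolution G" and nm: "J.null_mod (m + n + 1)"
    and o: "odd (m + n)"
    and g: "A.dual_weights (Suc m) (diff_op t) g X" and h: "B.dual_weights (Suc n) (diff_op u) h Y"
  shows "int p dvd pairing g X h Y (\<lambda>xs ys. \<Sum>k<p.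
      join_res F G (map (t ^^ k) xs) (map (u ^^ k) ys) - join_res F G (map (t ^^ k) xs) (map (u ^^ Suc k) ys))" (is ?right)
    and "int p dvd pairing g X h Y (\<lambda>xs ys. \<Sum>k<p.
      join_res F G (map (t ^^ k) xs) (map (u ^^ k) ys) - join_res F G (map (t ^^ Suc k) xs) (map (u ^^ k) ys))" (is ?left)
proof -
  obtain R \<Psi> where R: "R \<in> bialt K L"
    and eq: "\<And>xs ys. length xs = Suc m \<Longrightarrow> length ys = Suc n \<Longrightarrow> odd (m + n) \<Longrightarrow>
      (\<Sum>k<p. join_res F G (map (t ^^ k) xs) (map (u ^^ k) ys)) =
      (\<Sum>k<p. join_cob R (map (t ^^ k) xs) (map (u ^^ k) ys)) + int p * \<Psi> xs ys"
    by (rule null_mod_join[OF F G nm]) (rule that)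
  have kK: "int p dvd (\<Sum>xs\<in>X. g xs * coboundary K (\<lambda>xs. R xs ys) xs) -
      (\<Sum>xs\<in>X. g xs * coboundary K (\<lambda>xs. R xs ys) (map (t ^^ k) xs))" for ys k
    by (rule A.dual_weights_diff_pow[OF g bialtD(1)[OF R]])
  have kL: "int p dvd (\<Sum>ys\<in>Y. h ys * coboundary L (R xs) ys) -
      (\<Sum>ys\<in>Y. h ys * coboundary L (R xs) (map (u ^^ k) ys))" for xs k
    by (rule B.dual_weights_diff_pow[OF h bialtD(2)[OF R]])
  show ?right
  proof -
    define \<theta>1 where "\<theta>1 xs ys = (\<Sum>k<p. coboundary K (\<lambda>xs. R xs (map (u ^^ k) ys)) (map (t ^^ k) xs)
        - coboundary K (\<lambda>xs. R xs (map (u ^^ Suc k) ys)) (map (t ^^ k) xs))" for xs ys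
    define \<theta>2 where "\<theta>2 xs ys = (\<Sum>k<p. coboundary L (R (map (t ^^ k) xs)) (map (u ^^ k) ys)
        - coboundary L (R (map (t ^^ k) xs)) (map (u ^^ Suc k) ys))" for xs ys
    define \<theta>3 where "\<theta>3 xs ys = \<Psi> xs ys - \<Psi> xs (map u ys)" for xs ys
    have "pairing g X h Y (\<lambda>xs ys. \<Sum>k<p.
        join_res F G (map (t ^^ k) xs) (map (u ^^ k) ys) - join_res F G (map (t ^^ k) xs) (map (u ^^ Suc k) ys)) =
      pairing g X h Y (\<lambda>xs ys. \<theta>1 xs ys + ((- 1) ^ Suc m * \<theta>2 xs ys + int p * \<theta>3 xs ys))"
    proof (rule pairing_cong)
      fix xs ys assume "xs \<in> X" "ys \<in> Y"
      then have l: "length xs = Suc m" "length ys = Suc n" "length (map u ys) = Suc n"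
        using g h by (simp_all add: A.dual_weights_def B.dual_weights_def)
      show "(\<Sum>k<p. join_res F G (map (t ^^ k) xs) (map (u ^^ k) ys)
          - join_res F G (map (t ^^ k) xs) (map (u ^^ Suc k) ys)) =
        \<theta>1 xs ys + ((- 1) ^ Suc m * \<theta>2 xs ys + int p * \<theta>3 xs ys)"
        using eq[OF l(1,2) o] eq[OF l(1,3) o] l(1)
        by (simp add: \<theta>1_def \<theta>2_def \<theta>3_def sum_subtractf sum.distrib map_map_pow sum_negf
            sum_distrib_left[symmetric] right_diff_distrib del: map_map funpow.simps)
    qed
    also have "\<dots> = pairing g X h Y \<theta>1 + ((- 1) ^ Suc m * pairing g X h Y \<theta>2 + int p * pairing g X h Y \<theta>3)"
      unfolding pairing_add pairing_cmult ..
    finally have main: "pairing g X h Y (\<lambda>xs ys. \<Sum>k<p.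
        join_res F G (map (t ^^ k) xs) (map (u ^^ k) ys) - join_res F G (map (t ^^ k) xs) (map (u ^^ Suc k) ys)) =
      pairing g X h Y \<theta>1 + ((- 1) ^ Suc m * pairing g X h Y \<theta>2 + int p * pairing g X h Y \<theta>3)" .
    have "int p dvd pairing g X h Y \<theta>1"
    proof (rule dvd_pairing_left)
      fix ys
      \<comment> \<open>Modulo p the translate of \<open>xs\<close> in \<open>b k j\<close> does not
        matter, so it may be replaced by \<open>a k\<close>, which is periodic in k.\<close>
      define a where "a k = (\<Sum>xs\<in>X. g xs * coboundary K (\<lambda>xs. R xs (map (u ^^ k) ys)) xs)" for k
      define b where "b k j = (\<Sum>xs\<in>X. g xs * coboundary K (\<lambda>xs. R xs (map (u ^^ k) ys)) (map (t ^^ j) xs))" for k j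
      have ab: "int p dvd a k - b k j" for k j unfolding a_def b_def by (rule kK)
      have "(\<Sum>xs\<in>X. g xs * \<theta>1 xs ys) = (\<Sum>k<p. b k k - b (Suc k) k)"
        unfolding \<theta>1_def sum_distrib_left b_def sum_subtractf[symmetric] right_diff_distrib
        by (rule sum.swap)
      also have "\<dots> = (\<Sum>k<p. (a (Suc k) - b (Suc k) k) - (a k - b k k)) + ((\<Sum>k<p. a k) - (\<Sum>k<p. a (Suc k)))"
        by (simp add: sum_subtractf)
      also have "(\<Sum>k<p. a (Suc k)) = (\<Sum>k<p. a k)"
        by (rule sum_shift_periodic) (simp add: a_def B.t_period)
      finally show "int p dvd (\<Sum>xs\<in>X. g xs * \<theta>1 xs ys)"
        using ab by (simp add: dvd_sum dvd_diff)
    qed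
    moreover have "int p dvd pairing g X h Y \<theta>2"
    proof (rule dvd_pairing_right)
      fix xs
      have "(\<Sum>ys\<in>Y. h ys * \<theta>2 xs ys) = (\<Sum>k<p.
          (\<Sum>ys\<in>Y. h ys * coboundary L (R (map (t ^^ k) xs)) (map (u ^^ k) ys))
          - (\<Sum>ys\<in>Y. h ys * coboundary L (R (map (t ^^ k) xs)) (map (u ^^ Suc k) ys)))"
        unfolding \<theta>2_def sum_distrib_left sum_subtractf[symmetric] right_diff_distrib
        by (rule sum.swap)
      moreover have "int p dvd (\<Sum>ys\<in>Y. h ys * coboundary L (R xs') (map (u ^^ i) ys))
          - (\<Sum>ys\<in>Y. h ys * coboundary L (R xs') (map (u ^^ j) ys))" for xs' i j
        using dvd_diff[OF kL[of xs' j] kL[of xs' i]] by simp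
      ultimately show "int p dvd (\<Sum>ys\<in>Y. h ys * \<theta>2 xs ys)" by (simp only: dvd_sum)
    qed
    ultimately show ?thesis unfolding main by simp
  qed
  show ?left
  proof -
    define \<theta>1 where "\<theta>1 xs ys = (\<Sum>k<p. coboundary K (\<lambda>xs. R xs (map (u ^^ k) ys)) (map (t ^^ k) xs)
        - coboundary K (\<lambda>xs. R xs (map (u ^^ k) ys)) (map (t ^^ Suc k) xs))" for xs ys
    define \<theta>2 where "\<theta>2 xs ys = (\<Sum>k<p. coboundary L (R (map (t ^^ k) xs)) (map (u ^^ k) ys)
        - coboundary L (R (map (t ^^ Suc k) xs)) (map (u ^^ k) ys))" for xs ys
    define \<theta>3 where "\<theta>3 xs ys = \<Psi> xs ys - \<Psi> (map t xs) ys" for xs ys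
    have "pairing g X h Y (\<lambda>xs ys. \<Sum>k<p.
        join_res F G (map (t ^^ k) xs) (map (u ^^ k) ys) - join_res F G (map (t ^^ Suc k) xs) (map (u ^^ k) ys)) =
      pairing g X h Y (\<lambda>xs ys. \<theta>1 xs ys + ((- 1) ^ Suc m * \<theta>2 xs ys + int p * \<theta>3 xs ys))"
    proof (rule pairing_cong)
      fix xs ys assume "xs \<in> X" "ys \<in> Y"
      then have l: "length xs = Suc m" "length ys = Suc n" "length (map t xs) = Suc m"
        using g h by (simp_all add: A.dual_weights_def B.dual_weights_def)
      show "(\<Sum>k<p. join_res F G (map (t ^^ k) xs) (map (u ^^ k) ys)
          - join_res F G (map (t ^^ Suc k) xs) (map (u ^^ k) ys)) =
        \<theta>1 xs ys + ((- 1) ^ Suc m * \<theta>2 xs ys + int p * \<theta>3 xs ys)"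
        using eq[OF l(1,2) o] eq[OF l(3,2) o] l(1)
        by (simp add: \<theta>1_def \<theta>2_def \<theta>3_def sum_subtractf sum.distrib map_map_pow sum_negf
            sum_distrib_left[symmetric] right_diff_distrib del: map_map funpow.simps)
    qed
    also have "\<dots> = pairing g X h Y \<theta>1 + ((- 1) ^ Suc m * pairing g X h Y \<theta>2 + int p * pairing g X h Y \<theta>3)"
      unfolding pairing_add pairing_cmult ..
    finally have main: "pairing g X h Y (\<lambda>xs ys. \<Sum>k<p.
        join_res F G (map (t ^^ k) xs) (map (u ^^ k) ys) - join_res F G (map (t ^^ Suc k) xs) (map (u ^^ k) ys)) =
      pairing g X h Y \<theta>1 + ((- 1) ^ Suc m * pairing g X h Y \<theta>2 + int p * pairing g X h Y \<theta>3)" .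
    have "int p dvd pairing g X h Y \<theta>2"
    proof (rule dvd_pairing_right)
      fix xs
      define a where "a k = (\<Sum>ys\<in>Y. h ys * coboundary L (R (map (t ^^ k) xs)) ys)" for k
      define b where "b k j = (\<Sum>ys\<in>Y. h ys * coboundary L (R (map (t ^^ k) xs)) (map (u ^^ j) ys))" for k j
      have ab: "int p dvd a k - b k j" for k j unfolding a_def b_def by (rule kL)
      have "(\<Sum>ys\<in>Y. h ys * \<theta>2 xs ys) = (\<Sum>k<p. b k k - b (Suc k) k)"
        unfolding \<theta>2_def sum_distrib_left b_def sum_subtractf[symmetric] right_diff_distrib
        by (rule sum.swap)
      also have "\<dots> = (\<Sum>k<p. (a (Suc k) - b (Suc k) k) - (a k - b k k)) + ((\<Sum>k<p. a k) - (\<Sum>k<p. a (Suc k)))"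
        by (simp add: sum_subtractf)
      also have "(\<Sum>k<p. a (Suc k)) = (\<Sum>k<p. a k)"
        by (rule sum_shift_periodic) (simp add: a_def A.t_period)
      finally show "int p dvd (\<Sum>ys\<in>Y. h ys * \<theta>2 xs ys)"
        using ab by (simp add: dvd_sum dvd_diff)
    qed
    moreover have "int p dvd pairing g X h Y \<theta>1"
    proof (rule dvd_pairing_left)
      fix ys
      have "(\<Sum>xs\<in>X. g xs * \<theta>1 xs ys) = (\<Sum>k<p.
          (\<Sum>xs\<in>X. g xs * coboundary K (\<lambda>xs. R xs (map (u ^^ k) ys)) (map (t ^^ k) xs))
          - (\<Sum>xs\<in>X. g xs * coboundary K (\<lambda>xs. R xs (map (u ^^ k) ys)) (map (t ^^ Suc k) xs)))"
        unfolding \<theta>1_def sum_distrib_left sum_subtractf[symmetric] right_diff_distrib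
        by (rule sum.swap)
      moreover have "int p dvd (\<Sum>xs\<in>X. g xs * coboundary K (\<lambda>xs. R xs ys') (map (t ^^ i) xs))
          - (\<Sum>xs\<in>X. g xs * coboundary K (\<lambda>xs. R xs ys') (map (t ^^ j) xs))" for ys' i j
        using dvd_diff[OF kK[of ys' j] kK[of ys' i]] by simp
      ultimately show "int p dvd (\<Sum>xs\<in>X. g xs * \<theta>1 xs ys)" by (simp only: dvd_sum)
    qed
    ultimately show ?thesis unfolding main by simp
  qed
qed

end

section \<open>The prime two, where s and d agree modulo p\<close>

lemma diff_op_2: "norm_op 2 t f xs = diff_op t f xs + 2 * f (map t xs)"
proof -
  have "{..<2::nat} = {0, 1}" by auto
  then show ?thesis by (simp add: norm_op_def diff_op_def)
qed

lemma norm_op_involution: "norm_op 2 t f xs = f xs + f (map t xs)"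
  by (simp add: diff_op_2 diff_op_def)

lemma dvd_weighted_norm_2_iff:
  "(2::int) dvd (\<Sum>xs\<in>X. g xs * norm_op 2 t f xs) \<longleftrightarrow> 2 dvd (\<Sum>xs\<in>X. g xs * diff_op t f xs)"
proof -
  have "(\<Sum>xs\<in>X. g xs * norm_op 2 t f xs) =
      (\<Sum>xs\<in>X. g xs * diff_op t f xs) + 2 * (\<Sum>xs\<in>X. g xs * f (map t xs))"
    by (simp add: diff_op_2 distrib_left sum.distrib sum_distrib_left mult.left_commute)
  then show ?thesis by simp
qed

lemma (in Zp_action) dual_weights_2_iff:
  assumes "p = 2"
  shows "dual_weights n (norm_op p t) g X \<longleftrightarrow> dual_weights n (diff_op t) g X"
proof -
  have "int p dvd (\<Sum>xs\<in>X. g xs * norm_op p t f xs) \<longleftrightarrow> int p dvd (\<Sum>xs\<in>X. g xs * diff_op t f xs)" for f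
    using dvd_weighted_norm_2_iff[where X = X and g = g and t = t] assms by simp
  then show ?thesis by (simp only: dual_weights_def)
qed

context Zp_pair
begin

section \<open>Products of functionals detect the class of the join\<close>

lemma join_res_odd_odd:
  assumes "odd (length xs)" "odd (length ys)"
  shows "join_res F G xs ys - join_res F G (map t xs) (map u ys) =
    norm_op p t F xs * G ys - F xs * norm_op p u G ys"
proof -
  define h where "h k l = F (map (t ^^ k) xs) * G (map (u ^^ l) ys)" for k l
  have "join_res F G xs ys - join_res F G (map t xs) (map u ys) =
      (\<Sum>k<p. \<Sum>l<k. h k l - h (Suc k) (Suc l))"
    using assms by (simp add: join_res_def h_def sum_subtractf map_map_pow del: map_map funpow.simps)
  also have "\<dots> = (\<Sum>k<p. h k 0) - h 0 0 - (\<Sum>l<p. h p l) + h p 0" by (rule sum_triangle_telescope)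
  also have "\<dots> = norm_op p t F xs * G ys - F xs * norm_op p u G ys"
    by (simp add: h_def A.t_period norm_op_def sum_distrib_left sum_distrib_right)
  finally show ?thesis .
qed

text \<open>The weights \<open>g\<close> kill d of coboundaries and still detect s of
  \<open>F\<close>. For even \<open>n\<close>, averaging turns the top class into s F times s G up
  to a multiple of p. For odd \<open>n\<close>, shifting the second factor produces products of F
  with the coboundary of G, and there \<open>h\<close> does not see the shifts. Either way the value
  is a product of two non-zero residues.\<close>

lemma not_null_mod_join_left:
  assumes p: "prime p" and F: "A.resolution F" and m: "even m"
    and g: "A.dual_weights (Suc m) (diff_op t) g X"
    and gF: "\<not> int p dvd (\<Sum>xs\<in>X. g xs * norm_op p t F xs)"
    and nn: "\<not> B.null_mod n"
  shows "\<not> J.null_mod (m + n + 1)"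
proof
  assume nm: "J.null_mod (m + n + 1)"
  obtain G where G: "B.resolution G" using B.resolution_exists by blast
  obtain h Y where h: "B.dual_weights (Suc n) (res_op p u (Suc n)) h Y"
    and hG: "\<not> int p dvd (\<Sum>ys\<in>Y. h ys * res_op p u (Suc n) G ys)"
    using B.dual_weights_exist[OF p G nn] by blast
  have pi: "prime (int p)" using p by simp
  have lX: "length xs = Suc m" if "xs \<in> X" for xs using g that by (simp add: A.dual_weights_def)
  have lY: "length ys = Suc n" if "ys \<in> Y" for ys using h that by (simp add: B.dual_weights_def)
  show False
  proof (cases "even n")
    case True
    then have e: "even (m + n)" and h': "B.dual_weights (Suc n) (norm_op p u) h Y"
      and hG': "\<not> int p dvd (\<Sum>ys\<in>Y. h ys * norm_op p u G ys)"
      using m h hG by (simp_all add: res_op_def)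
    have "pairing g X h Y (\<lambda>xs ys. \<Sum>j<p.
        join_res F G xs (map (u ^^ j) ys) - join_res F G (map t xs) (map (u ^^ Suc j) ys)) =
      pairing g X h Y (\<lambda>xs ys. norm_op p t F xs * norm_op p u G ys
        + (- int p) * (F xs * norm_op p u G ys))"
    proof (rule pairing_cong)
      fix xs ys assume "xs \<in> X" "ys \<in> Y"
      then have "join_res F G xs (map (u ^^ j) ys) - join_res F G (map t xs) (map (u ^^ Suc j) ys) =
          norm_op p t F xs * G (map (u ^^ j) ys) - F xs * norm_op p u G ys" for j
        using join_res_odd_odd[of xs "map (u ^^ j) ys" F G] lX lY m True
        by (simp only: pow_map B.norm_op_pow length_map even_Suc simp_thms)
      then show "(\<Sum>j<p. join_res F G xs (map (u ^^ j) ys) - join_res F G (map t xs) (map (u ^^ Suc j) ys)) =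
          norm_op p t F xs * norm_op p u G ys + (- int p) * (F xs * norm_op p u G ys)"
        by (simp only:) (simp add: sum_subtractf norm_op_def[of p u] sum_distrib_left sum_negf)
    qed
    also have "\<dots> = (\<Sum>xs\<in>X. g xs * norm_op p t F xs) * (\<Sum>ys\<in>Y. h ys * norm_op p u G ys)
        + (- int p) * pairing g X h Y (\<lambda>xs ys. F xs * norm_op p u G ys)"
      unfolding pairing_add pairing_cmult pairing_product ..
    finally have "int p dvd (\<Sum>xs\<in>X. g xs * norm_op p t F xs) * (\<Sum>ys\<in>Y. h ys * norm_op p u G ys)
        + (- int p) * pairing g X h Y (\<lambda>xs ys. F xs * norm_op p u G ys)"
      using dvd_pairing_even_left[OF F G nm e g h'] by simp
    then have "int p dvd (\<Sum>xs\<in>X. g xs * norm_op p t F xs) * (\<Sum>ys\<in>Y. h ys * norm_op p u G ys)"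
      by (simp add: dvd_diff_left_iff)
    then show False using gF hG' prime_dvd_mult_iff[OF pi] by blast
  next
    case False
    then have o: "odd (m + n)" and h': "B.dual_weights (Suc n) (diff_op u) h Y"
      and hG': "\<not> int p dvd (\<Sum>ys\<in>Y. h ys * diff_op u G ys)"
      using m h hG by (simp_all add: res_op_def)
    have dG: "diff_op u G ys = coboundary L G ys" if "length ys = Suc n" for ys
      using B.resolutionD(3)[OF G, of ys] that False by (simp add: res_op_def)
    define b where "b k = (\<Sum>ys\<in>Y. h ys * coboundary L G (map (u ^^ k) ys))" for k
    define a where "a k = (\<Sum>xs\<in>X. g xs * F (map (t ^^ k) xs))" for k
    have "pairing g X h Y (\<lambda>xs ys. \<Sum>k<p.
        join_res F G (map (t ^^ k) xs) (map (u ^^ k) ys) - join_res F G (map (t ^^ k) xs) (map (u ^^ Suc k) ys)) =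
      pairing g X h Y (\<lambda>xs ys. \<Sum>k<p. F (map (t ^^ k) xs) * coboundary L G (map (u ^^ k) ys))"
    proof (rule pairing_cong, rule sum.cong[OF refl])
      fix xs ys k assume "xs \<in> X" "ys \<in> Y"
      then have "even (length ys)" using lY False by simp
      then show "join_res F G (map (t ^^ k) xs) (map (u ^^ k) ys) - join_res F G (map (t ^^ k) xs) (map (u ^^ Suc k) ys)
          = F (map (t ^^ k) xs) * coboundary L G (map (u ^^ k) ys)"
        using dG[of "map (u ^^ k) ys", symmetric] lY \<open>ys \<in> Y\<close>
        by (simp add: join_res_def diff_op_def right_diff_distrib)
    qed
    also have "\<dots> = (\<Sum>k<p. a k * b k)"
    proof -
      have "pairing g X h Y (\<lambda>xs ys. \<Sum>k\<in>S. \<theta> k xs ys) = (\<Sum>k\<in>S. pairing g X h Y (\<theta> k))"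
        for \<theta> :: "nat \<Rightarrow> 'a list \<Rightarrow> 'b list \<Rightarrow> int" and S
        by (induction S rule: infinite_finite_induct) (simp_all add: pairing_add, simp_all add: pairing_def)
      then show ?thesis by (simp only: pairing_product a_def b_def)
    qed
    finally have "int p dvd (\<Sum>k<p. a k * b k)" using dvd_pairing_odd(1)[OF F G nm o g h'] by simp
    \<comment> \<open>Invariance of \<open>h\<close> on coboundaries allows \<open>b 0\<close> in
      place of \<open>b k\<close>, and the sum of the \<open>a k\<close> is then the value on the
      norm of \<open>F\<close>.\<close>
    moreover have "int p dvd (\<Sum>k<p. a k * (b 0 - b k))"
      using B.dual_weights_diff_pow[OF h' B.resolutionD(1)[OF G]] by (intro dvd_sum dvd_mult) (simp add: b_def)
    moreover have "(\<Sum>k<p. a k) * b 0 = (\<Sum>k<p. a k * b k) + (\<Sum>k<p. a k * (b 0 - b k))"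
      by (simp add: right_diff_distrib sum_subtractf sum_distrib_right)
    ultimately have "int p dvd (\<Sum>k<p. a k) * b 0" by simp
    moreover have "(\<Sum>k<p. a k) = (\<Sum>xs\<in>X. g xs * norm_op p t F xs)"
      unfolding a_def norm_op_def sum_distrib_left by (rule sum.swap)
    moreover have "b 0 = (\<Sum>ys\<in>Y. h ys * diff_op u G ys)"
      unfolding b_def by (intro sum.cong) (simp_all add: dG lY)
    ultimately show False using gF hG' prime_dvd_mult_iff[OF pi] by metis
  qed
qed

text \<open>The mirror image. It is not a formal consequence, since \<open>join_res\<close> treats
  the factors differently: the translate of \<open>F\<close> for even and odd lengths appears here
  as the exponent \<open>Suc k\<close>.\<close>

lemma not_null_mod_join_right:
  assumes p: "prime p" and G: "B.resolution G" and n: "even n"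
    and h: "B.dual_weights (Suc n) (diff_op u) h Y"
    and hG: "\<not> int p dvd (\<Sum>ys\<in>Y. h ys * norm_op p u G ys)"
    and nn: "\<not> A.null_mod m"
  shows "\<not> J.null_mod (m + n + 1)"
proof
  assume nm: "J.null_mod (m + n + 1)"
  obtain F where F: "A.resolution F" using A.resolution_exists by blast
  obtain g X where g: "A.dual_weights (Suc m) (res_op p t (Suc m)) g X"
    and gF: "\<not> int p dvd (\<Sum>xs\<in>X. g xs * res_op p t (Suc m) F xs)"
    using A.dual_weights_exist[OF p F nn] by blast
  have pi: "prime (int p)" using p by simp
  have lX: "length xs = Suc m" if "xs \<in> X" for xs using g that by (simp add: A.dual_weights_def)
  have lY: "length ys = Suc n" if "ys \<in> Y" for ys using h that by (simp add: B.dual_weights_def)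
  show False
  proof (cases "even m")
    case True
    then have e: "even (m + n)" and g': "A.dual_weights (Suc m) (norm_op p t) g X"
      and gF': "\<not> int p dvd (\<Sum>xs\<in>X. g xs * norm_op p t F xs)"
      using n g gF by (simp_all add: res_op_def)
    have "pairing g X h Y (\<lambda>xs ys. \<Sum>j<p.
        join_res F G (map (t ^^ j) xs) ys - join_res F G (map (t ^^ Suc j) xs) (map u ys)) =
      pairing g X h Y (\<lambda>xs ys. int p * (norm_op p t F xs * G ys)
        + (- 1) * (norm_op p t F xs * norm_op p u G ys))"
    proof (rule pairing_cong)
      fix xs ys assume "xs \<in> X" "ys \<in> Y"
      then have "join_res F G (map (t ^^ j) xs) ys - join_res F G (map (t ^^ Suc j) xs) (map u ys) =
          norm_op p t F xs * G ys - F (map (t ^^ j) xs) * norm_op p u G ys" for j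
        using join_res_odd_odd[of "map (t ^^ j) xs" ys F G] lX lY n True
        by (simp only: pow_map A.norm_op_pow length_map even_Suc simp_thms)
      then show "(\<Sum>j<p. join_res F G (map (t ^^ j) xs) ys - join_res F G (map (t ^^ Suc j) xs) (map u ys)) =
          int p * (norm_op p t F xs * G ys) + (- 1) * (norm_op p t F xs * norm_op p u G ys)"
        by (simp only:) (simp add: sum_subtractf norm_op_def[of p t] sum_distrib_right sum_negf)
    qed
    also have "\<dots> = int p * pairing g X h Y (\<lambda>xs ys. norm_op p t F xs * G ys)
        + (- 1) * ((\<Sum>xs\<in>X. g xs * norm_op p t F xs) * (\<Sum>ys\<in>Y. h ys * norm_op p u G ys))"
      unfolding pairing_add pairing_cmult pairing_product ..
    finally have "int p dvd int p * pairing g X h Y (\<lambda>xs ys. norm_op p t F xs * G ys)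
        + (- 1) * ((\<Sum>xs\<in>X. g xs * norm_op p t F xs) * (\<Sum>ys\<in>Y. h ys * norm_op p u G ys))"
      using dvd_pairing_even_right[OF F G nm e g' h] by simp
    then have "int p dvd (\<Sum>xs\<in>X. g xs * norm_op p t F xs) * (\<Sum>ys\<in>Y. h ys * norm_op p u G ys)"
      by (simp add: dvd_diff_right_iff)
    then show False using gF' hG prime_dvd_mult_iff[OF pi] by blast
  next
    case False
    then have o: "odd (m + n)" and g': "A.dual_weights (Suc m) (diff_op t) g X"
      and gF': "\<not> int p dvd (\<Sum>xs\<in>X. g xs * diff_op t F xs)"
      using n g gF by (simp_all add: res_op_def)
    have dF: "diff_op t F xs = coboundary K F xs" if "length xs = Suc m" for xs
      using A.resolutionD(3)[OF F, of xs] that False by (simp add: res_op_def)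
    define b where "b k = (\<Sum>xs\<in>X. g xs * coboundary K F (map (t ^^ k) xs))" for k
    define a where "a k = (\<Sum>ys\<in>Y. h ys * G (map (u ^^ k) ys))" for k
    have "pairing g X h Y (\<lambda>xs ys. \<Sum>k<p.
        join_res F G (map (t ^^ k) xs) (map (u ^^ k) ys) - join_res F G (map (t ^^ Suc k) xs) (map (u ^^ k) ys)) =
      pairing g X h Y (\<lambda>xs ys. \<Sum>k<p. coboundary K F (map (t ^^ Suc k) xs) * G (map (u ^^ k) ys))"
    proof (rule pairing_cong, rule sum.cong[OF refl])
      fix xs ys k assume "xs \<in> X" "ys \<in> Y"
      then have "even (length xs)" "odd (length ys)" using lX lY False n by simp_all
      then show "join_res F G (map (t ^^ k) xs) (map (u ^^ k) ys) - join_res F G (map (t ^^ Suc k) xs) (map (u ^^ k) ys)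
          = coboundary K F (map (t ^^ Suc k) xs) * G (map (u ^^ k) ys)"
        using dF[of "map (t ^^ Suc k) xs", symmetric] lX \<open>xs \<in> X\<close>
        by (simp add: join_res_def diff_op_def left_diff_distrib)
    qed
    also have "\<dots> = (\<Sum>k<p. b (Suc k) * a k)"
    proof -
      have "pairing g X h Y (\<lambda>xs ys. \<Sum>k\<in>S. \<theta> k xs ys) = (\<Sum>k\<in>S. pairing g X h Y (\<theta> k))"
        for \<theta> :: "nat \<Rightarrow> 'a list \<Rightarrow> 'b list \<Rightarrow> int" and S
        by (induction S rule: infinite_finite_induct) (simp_all add: pairing_add, simp_all add: pairing_def)
      then show ?thesis by (simp only: pairing_product a_def b_def)
    qed
    finally have "int p dvd (\<Sum>k<p. b (Suc k) * a k)" using dvd_pairing_odd(2)[OF F G nm o g' h] by simp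
    moreover have "int p dvd (\<Sum>k<p. (b 0 - b (Suc k)) * a k)"
      using A.dual_weights_diff_pow[OF g' A.resolutionD(1)[OF F], of "Suc _"]
      by (intro dvd_sum dvd_mult2) (simp add: b_def)
    moreover have "b 0 * (\<Sum>k<p. a k) = (\<Sum>k<p. b (Suc k) * a k) + (\<Sum>k<p. (b 0 - b (Suc k)) * a k)"
      by (simp add: left_diff_distrib sum_subtractf sum_distrib_left)
    ultimately have "int p dvd b 0 * (\<Sum>k<p. a k)" by simp
    moreover have "(\<Sum>k<p. a k) = (\<Sum>ys\<in>Y. h ys * norm_op p u G ys)"
      unfolding a_def norm_op_def sum_distrib_left by (rule sum.swap)
    moreover have "b 0 = (\<Sum>xs\<in>X. g xs * diff_op t F xs)"
      unfolding b_def by (intro sum.cong) (simp_all add: dF lX)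
    ultimately show False using gF' hG prime_dvd_mult_iff[OF pi] by metis
  qed
qed

text \<open>As s and d agree modulo 2, any dual of an even class serves in the two preceding
  arguments. If both degrees are odd, both lengths are even, the join is a plain product, and
  averaging yields d F times s G directly.\<close>

lemma not_null_mod_join_2:
  assumes p: "p = 2" and nA: "\<not> A.null_mod m" and nB: "\<not> B.null_mod n"
  shows "\<not> J.null_mod (m + n + 1)"
proof -
  have pr: "prime p" using p by simp
  obtain F where F: "A.resolution F" using A.resolution_exists by blast
  obtain G where G: "B.resolution G" using B.resolution_exists by blast
  obtain g X where g: "A.dual_weights (Suc m) (res_op p t (Suc m)) g X"
    and gF: "\<not> int p dvd (\<Sum>xs\<in>X. g xs * res_op p t (Suc m) F xs)"
    using A.dual_weights_exist[OF pr F nA] by blast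
  obtain h Y where h: "B.dual_weights (Suc n) (res_op p u (Suc n)) h Y"
    and hG: "\<not> int p dvd (\<Sum>ys\<in>Y. h ys * res_op p u (Suc n) G ys)"
    using B.dual_weights_exist[OF pr G nB] by blast
  show ?thesis
  proof (cases "even m")
    case True
    then show ?thesis
      using not_null_mod_join_left[OF pr F True _ _ nB, of g X] g gF A.dual_weights_2_iff[OF p]
      by (simp add: res_op_def)
  next
    case mo: False
    show ?thesis
    proof (cases "even n")
      case True
      then show ?thesis
        using not_null_mod_join_right[OF pr G True _ _ nA, of h Y] h hG B.dual_weights_2_iff[OF p]
        by (simp add: res_op_def)
    next
      case no: False
      have g': "A.dual_weights (Suc m) (diff_op t) g X" and gF': "\<not> int p dvd (\<Sum>xs\<in>X. g xs * diff_op t F xs)"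
        using g gF mo by (simp_all add: res_op_def)
      have h': "B.dual_weights (Suc n) (norm_op p u) h Y"
        using h no B.dual_weights_2_iff[OF p] by (simp add: res_op_def)
      have hG': "\<not> int p dvd (\<Sum>ys\<in>Y. h ys * norm_op p u G ys)"
        using hG no p dvd_weighted_norm_2_iff[where X = Y and g = h and t = u and f = G] by (simp add: res_op_def)
      have lX: "length xs = Suc m" if "xs \<in> X" for xs using g that by (simp add: A.dual_weights_def)
      have lY: "length ys = Suc n" if "ys \<in> Y" for ys using h that by (simp add: B.dual_weights_def)
      show ?thesis
      proof
        assume nm: "J.null_mod (m + n + 1)"
        have "pairing g X h Y (\<lambda>xs ys. \<Sum>j<p.
            join_res F G xs (map (u ^^ j) ys) - join_res F G (map t xs) (map (u ^^ Suc j) ys)) =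
          pairing g X h Y (\<lambda>xs ys. diff_op t F xs * norm_op p u G ys)"
        proof (rule pairing_cong)
          fix xs ys assume "xs \<in> X" "ys \<in> Y"
          then have "even (length ys)" using lY no by simp
          then have "(\<Sum>j<p. join_res F G xs (map (u ^^ j) ys) - join_res F G (map t xs) (map (u ^^ Suc j) ys)) =
              F xs * (\<Sum>j<p. G (map (u ^^ j) ys)) - F (map t xs) * (\<Sum>j<p. G (map (u ^^ Suc j) ys))"
            by (simp add: join_res_def sum_subtractf sum_distrib_left)
          then show "(\<Sum>j<p. join_res F G xs (map (u ^^ j) ys) - join_res F G (map t xs) (map (u ^^ Suc j) ys)) =
              diff_op t F xs * norm_op p u G ys"
            unfolding sum_shift_u[of G] by (simp only: diff_op_def norm_op_def left_diff_distrib)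
        qed
        then have "int p dvd (\<Sum>xs\<in>X. g xs * diff_op t F xs) * (\<Sum>ys\<in>Y. h ys * norm_op p u G ys)"
          using dvd_pairing_even_left[OF F G nm _ g' h'] mo no by (simp add: pairing_product)
        moreover have "prime (int p)" using p by simp
        ultimately show False using gF' hG' prime_dvd_mult_iff by blast
      qed
    qed
  qed
qed

text \<open>Each factor is an invariant subcomplex of the join, reached by putting the empty list in
  the other argument. This supplies the lower bound when one index is 0 and there is no non-zero
  class to multiply with.\<close>

lemma null_mod_restrict:
  assumes "J.null_mod k"
  shows "A.null_mod k" "B.null_mod k"
proof -
  let ?J = "complex_join K L" and ?v = "map_sum t u"
  obtain \<theta> where \<theta>: "J.resolution \<theta>" using J.resolution_exists by blast
  obtain \<chi> \<psi> where \<chi>: "\<chi> \<in> alt_n ?J k" "\<chi> [] = 0" and \<psi>: "\<psi> \<in> alt_n ?J (Suc k)"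
    and eq: "\<And>zs. length zs = Suc k \<Longrightarrow> res_op p ?v (Suc k) \<theta> zs =
        coboundary ?J (res_op p ?v (Suc k) \<chi>) zs + int p * res_op p ?v (Suc k) \<psi> zs"
    using assms J.null_mod_iff[OF \<theta>] by blast
  have \<chi>': "res_op p ?v (Suc k) \<chi> \<in> alt ?J" by (intro J.res_op_alt alt_n_alt[OF \<chi>(1)])
  have al: "(\<lambda>xs. join_restrict f xs []) \<in> alt_n K n" "join_restrict f [] \<in> alt_n L n" if "f \<in> alt_n ?J n" for f n
    using bialtD[OF join_restrict_bialt[OF alt_n_alt[OF that]]]
    by (simp_all add: alt_n_def, simp_all add: join_restrict_def alt_n_outside[OF that])
  have r: "join_restrict (res_op p ?v n f) xs [] = res_op p t n (\<lambda>xs. join_restrict f xs []) xs"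
    "join_restrict (res_op p ?v n f) [] ys = res_op p u n (join_restrict f []) ys" for n f xs ys
    by (simp_all add: res_op_def join_restrict_norm_op join_restrict_diff_op)
      (simp_all add: norm_op_def diff_op_def)
  have c: "join_restrict (coboundary ?J f) xs [] = coboundary K (\<lambda>xs. join_restrict f xs []) xs"
    "join_restrict (coboundary ?J f) [] ys = coboundary L (join_restrict f []) ys" if "f \<in> alt ?J" for f xs ys
    by (simp_all add: join_restrict_coboundary[OF that]) (simp_all add: coboundary_eq)
  have b: "join_restrict \<theta> \<in> bialt K L" by (rule join_restrict_bialt[OF J.resolutionD(1)[OF \<theta>]])
  have jr: "join_restrict (coboundary ?J \<theta>) xs ys = join_restrict (res_op p ?v (length xs + length ys) \<theta>) xs ys" for xs ys
    using J.resolutionD(3)[OF \<theta>, of "map Inl xs @ map Inr ys"] by (simp add: join_restrict_def)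
  have 1: "A.resolution (\<lambda>xs. join_restrict \<theta> xs [])" and 2: "B.resolution (join_restrict \<theta> [])"
    using bialtD[OF b] J.resolutionD(2)[OF \<theta>] jr[of _ "[]"] jr[of "[]"]
    by (simp_all add: A.resolution_def B.resolution_def c[OF J.resolutionD(1)[OF \<theta>]] r)
      (simp_all add: join_restrict_def)
  have e: "join_restrict (res_op p ?v (Suc k) \<theta>) xs ys =
      join_restrict (coboundary ?J (res_op p ?v (Suc k) \<chi>)) xs ys
      + int p * join_restrict (res_op p ?v (Suc k) \<psi>) xs ys" if "length xs + length ys = Suc k" for xs ys
    using eq[of "map Inl xs @ map Inr ys"] that by (simp add: join_restrict_def)
  have r': "(\<lambda>xs. join_restrict (res_op p ?v n f) xs []) = res_op p t n (\<lambda>xs. join_restrict f xs [])"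
    "join_restrict (res_op p ?v n f) [] = res_op p u n (join_restrict f [])" for n f
    by (simp_all add: fun_eq_iff r)
  show "A.null_mod k"
    unfolding A.null_mod_iff[OF 1]
  proof (intro bexI[OF _ al(1)[OF \<chi>(1)]] bexI[OF _ al(1)[OF \<psi>]] conjI allI impI)
    show "join_restrict \<chi> [] [] = 0" using \<chi>(2) by (simp add: join_restrict_def)
    fix xs :: "'a list" assume "length xs = Suc k"
    then show "res_op p t (Suc k) (\<lambda>xs. join_restrict \<theta> xs []) xs =
        coboundary K (res_op p t (Suc k) (\<lambda>xs. join_restrict \<chi> xs [])) xs
        + int p * res_op p t (Suc k) (\<lambda>xs. join_restrict \<psi> xs []) xs"
      using e[of xs "[]"] by (simp add: r c[OF \<chi>'] r')
  qed
  show "B.null_mod k"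
    unfolding B.null_mod_iff[OF 2]
  proof (intro bexI[OF _ al(2)[OF \<chi>(1)]] bexI[OF _ al(2)[OF \<psi>]] conjI allI impI)
    show "join_restrict \<chi> [] [] = 0" using \<chi>(2) by (simp add: join_restrict_def)
    fix ys :: "'b list" assume "length ys = Suc k"
    then show "res_op p u (Suc k) (join_restrict \<theta> []) ys =
        coboundary L (res_op p u (Suc k) (join_restrict \<chi> [])) ys
        + int p * res_op p u (Suc k) (join_restrict \<psi> []) ys"
      using e[of "[]" ys] by (simp add: r c[OF \<chi>'] r')
  qed
qed

text \<open>Combined with the upper bound by the sum of the integral indices, this determines the
  index in (2) and leaves the two values of (3).\<close>

lemma smith_index_p_join_ge_2:
  assumes "p = 2"
  shows "smith_index_p p K t + smith_index_p p L u \<le> smith_index_p p (complex_join K L) (map_sum t u)"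
proof -
  let ?k = "smith_index_p p (complex_join K L) (map_sum t u)"
  have nm: "J.null_mod ?k" using J.smith_index_p_le_iff by blast
  have "smith_index_p p K t \<le> ?k" "smith_index_p p L u \<le> ?k"
    unfolding A.smith_index_p_le_iff B.smith_index_p_le_iff by (rule null_mod_restrict[OF nm])+
  moreover have "smith_index_p p K t + smith_index_p p L u \<le> ?k"
    if "smith_index_p p K t = Suc m" "smith_index_p p L u = Suc n" for m n
  proof (rule ccontr)
    assume "\<not> smith_index_p p K t + smith_index_p p L u \<le> ?k"
    then have "?k \<le> m + n + 1" using that by simp
    moreover have "\<not> A.null_mod m" "\<not> B.null_mod n"
      using that by (simp_all add: A.smith_index_p_le_iff[symmetric] B.smith_index_p_le_iff[symmetric])
    ultimately show False using not_null_mod_join_2[OF assms] J.null_mod_mono[OF nm] by blast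
  qed
  ultimately show ?thesis by (cases "smith_index_p p K t"; cases "smith_index_p p L u") auto
qed

lemma smith_index_join_eq_2:
  assumes "p = 2" "smith_index_p p K t = smith_index p K t" "smith_index_p p L u = smith_index p L u"
  shows "smith_index_p p (complex_join K L) (map_sum t u) = smith_index p (complex_join K L) (map_sum t u) \<and>
    smith_index p (complex_join K L) (map_sum t u) = smith_index p K t + smith_index p L u"
  using smith_index_join_le J.smith_index_p_le smith_index_p_join_ge_2[OF assms(1)] assms(2,3) by linarith

lemma smith_index_join_cases_2:
  assumes "p = 2" "smith_index_p p K t + 1 = smith_index p K t" "smith_index_p p L u = smith_index p L u"
  shows "smith_index p (complex_join K L) (map_sum t u) = smith_index p K t + smith_index p L u \<or>
    smith_index p (complex_join K L) (map_sum t u) + 1 = smith_index p K t + smith_index p L u"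
  using smith_index_join_le J.smith_index_p_le smith_index_p_join_ge_2[OF assms(1)] assms(2,3) by linarith

lemma indices_eq_if_not_null_mod:
  assumes "smith_index p K t = Suc m" "smith_index p L u = Suc n" "\<not> J.null_mod (m + n + 1)"
  shows "smith_index_p p (complex_join K L) (map_sum t u) = smith_index p (complex_join K L) (map_sum t u) \<and>
    smith_index p (complex_join K L) (map_sum t u) = smith_index p K t + smith_index p L u"
  using smith_index_join_le J.smith_index_p_le assms J.smith_index_p_le_iff[of "m + n + 1"] by linarith

end

subsection \<open>Dual chains as functionals\<close>

text \<open>Summing over all orderings of each simplex multiplies the pairing by a factorial but
  avoids representatives, so that translations and deletions of vertices are mere reindexings. The
  factor cancels over the integers.\<close>

definition list_pairing :: "'a set set \<Rightarrow> nat \<Rightarrow> ('a list \<Rightarrow> int) \<Rightarrow> ('a list \<Rightarrow> int) \<Rightarrow> int" where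
  "list_pairing K n f c = (\<Sum>xs | simplex_list K xs \<and> length xs = n. f xs * c xs)"

context Zp_action
begin

lemma simplex_lists_eq:
  "{xs. simplex_list K xs \<and> length xs = n} = (\<Union>\<sigma>\<in>{\<sigma>\<in>K. card \<sigma> = n}. {xs. set xs = \<sigma> \<and> distinct xs})"
  by (auto simp: simplex_list_def distinct_card)

lemma list_pairing_eq_eval:
  assumes f: "alternating f" and c: "alternating c"
  shows "list_pairing K (Suc j) f c = fact (Suc j) * cochain_eval K j f c"
proof -
  let ?S = "{\<sigma>\<in>K. card \<sigma> = Suc j}"
  have "list_pairing K (Suc j) f c = (\<Sum>\<sigma>\<in>?S. \<Sum>xs | set xs = \<sigma> \<and> distinct xs. f xs * c xs)"
    unfolding list_pairing_def simplex_lists_eq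
  proof (rule sum.UNION_disjoint)
    show "finite ?S" using finite_K by simp
    show "\<forall>\<sigma>\<in>?S. finite {xs. set xs = \<sigma> \<and> distinct xs}"
      using finite_simplex finite_permutations_of_set unfolding permutations_of_set_def by blast
  qed auto
  also have "\<dots> = (\<Sum>\<sigma>\<in>?S. fact (Suc j) * (let xs = (SOME xs. distinct xs \<and> set xs = \<sigma>) in f xs * c xs))"
  proof (rule sum.cong[OF refl])
    fix \<sigma> assume s: "\<sigma> \<in> ?S"
    define ys where "ys = (SOME xs. distinct xs \<and> set xs = \<sigma>)"
    have "\<exists>xs. distinct xs \<and> set xs = \<sigma>"
      using finite_distinct_list[of \<sigma>] s finite_simplex by auto
    then have ys: "distinct ys" "set ys = \<sigma>" unfolding ys_def by (metis (mono_tags, lifting) someI_ex)+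
    have "(\<Sum>xs | set xs = \<sigma> \<and> distinct xs. f xs * c xs) = (\<Sum>xs | set xs = \<sigma> \<and> distinct xs. f ys * c ys)"
      by (rule sum.cong[OF refl], rule alternating_same_set[OF f c]) (use ys in auto)
    also have "\<dots> = fact (Suc j) * (f ys * c ys)"
    proof -
      have "card {xs. set xs = \<sigma> \<and> distinct xs} = fact (Suc j)"
        using card_permutations_of_set[of \<sigma>] s finite_simplex by (simp add: permutations_of_set_def)
      then show ?thesis by (simp del: fact_Suc)
    qed
    finally show "(\<Sum>xs | set xs = \<sigma> \<and> distinct xs. f xs * c xs) =
        fact (Suc j) * (let xs = (SOME xs. distinct xs \<and> set xs = \<sigma>) in f xs * c xs)"
      by (simp add: ys_def Let_def)
  qed
  finally show ?thesis by (simp add: cochain_eval_def sum_distrib_left)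
qed

lemma eval_eq_iff_list_pairing:
  assumes "alternating f" "alternating c" "alternating f'" "alternating c'"
  shows "cochain_eval K j f c = cochain_eval K j f' c' \<longleftrightarrow>
    list_pairing K (Suc j) f c = list_pairing K (Suc j) f' c'"
  using list_pairing_eq_eval[of _ _ j] assms fact_nonzero[of "Suc j", where 'a = int]
  by (simp del: fact_Suc)

lemma map_inv_t: "map (inv_into UNIV t) (map t xs) = xs" "map t (map (inv_into UNIV t) xs) = xs"
  using t_bij by (simp_all add: comp_def bij_is_inj bij_is_surj surj_f_inv_f)

lemma list_pairing_translate:
  "list_pairing K n (\<lambda>xs. f (map t xs)) c = list_pairing K n f (chain_map t c)"
  unfolding list_pairing_def chain_map_def
proof (rule sum.reindex_bij_witness[of _ "map (inv_into UNIV t)" "map t"])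
  fix xs assume "xs \<in> {xs. simplex_list K xs \<and> length xs = n}"
  then show "map (inv_into UNIV t) xs \<in> {xs. simplex_list K xs \<and> length xs = n}"
    using simplex_list_map(1)[of "map (inv_into UNIV t) xs"] map_inv_t(2)[of xs] by simp
qed (simp_all add: map_inv_t del: map_map)

lemma list_pairing_translate_pow:
  "list_pairing K n (\<lambda>xs. f (map (t ^^ k) xs)) c = list_pairing K n f ((chain_map t ^^ k) c)"
proof (induction k arbitrary: f)
  case (Suc k)
  have "(\<lambda>xs. f (map (t ^^ Suc k) xs)) = (\<lambda>xs. (\<lambda>ys. f (map t ys)) (map (t ^^ k) xs))" by simp
  then have "list_pairing K n (\<lambda>xs. f (map (t ^^ Suc k) xs)) c =
      list_pairing K n (\<lambda>ys. f (map t ys)) ((chain_map t ^^ k) c)" using Suc[of "\<lambda>ys. f (map t ys)"] by metis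
  also have "\<dots> = list_pairing K n f ((chain_map t ^^ Suc k) c)" by (simp add: list_pairing_translate)
  finally show ?case .
qed simp

lemma list_pairing_norm: "list_pairing K n (norm_op p t f) c = list_pairing K n f (op_s p (chain_map t) c)"
proof -
  have "list_pairing K n (norm_op p t f) c = (\<Sum>k<p. list_pairing K n (\<lambda>xs. f (map (t ^^ k) xs)) c)"
    unfolding list_pairing_def norm_op_def sum_distrib_right by (rule sum.swap)
  also have "\<dots> = (\<Sum>k<p. list_pairing K n f ((chain_map t ^^ k) c))"
    by (simp only: list_pairing_translate_pow)
  also have "\<dots> = list_pairing K n f (op_s p (chain_map t) c)"
    unfolding list_pairing_def op_s_def sum_distrib_left by (rule sum.swap)
  finally show ?thesis .
qed

lemma list_pairing_diff: "list_pairing K n (diff_op t f) c = list_pairing K n f (op_d (chain_map t) c)"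
proof -
  have "list_pairing K n (diff_op t f) c = list_pairing K n f c - list_pairing K n (\<lambda>xs. f (map t xs)) c"
    by (simp add: list_pairing_def diff_op_def left_diff_distrib sum_subtractf)
  also have "\<dots> = list_pairing K n f (op_d (chain_map t) c)"
    unfolding list_pairing_translate
    by (simp add: list_pairing_def op_d_def right_diff_distrib sum_subtractf)
  finally show ?thesis .
qed

lemma alternating_move_front:
  assumes "alternating c"
  shows "c (us @ v # vs) = (- 1) ^ length us * c (v # us @ vs)"
proof (induction us arbitrary: vs rule: rev_induct)
  case (snoc w us)
  have "c ((us @ [w]) @ v # vs) = - c (us @ v # w # vs)"
    using alternatingD[OF assms, of us w v vs] by simp
  moreover have "c (us @ v # w # vs) = (- 1) ^ length us * c (v # us @ w # vs)"
    using snoc.IH[of "w # vs"] .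
  ultimately show ?case by simp
qed simp

text \<open>Once the deleted vertex is moved to the front, the sign of the coboundary cancels and
  all \<open>i + 2\<close> positions give the same sum; hence the factor, which is the quotient of
  the two factorials in \<open>list_pairing_eq_eval\<close>.\<close>

lemma list_pairing_coboundary:
  assumes f: "f \<in> alt K" and c: "c \<in> alt K"
  shows "list_pairing K (Suc (Suc i)) (coboundary K f) c =
    int (Suc (Suc i)) * list_pairing K (Suc i) f (boundary K c)"
proof -
  let ?n = "Suc (Suc i)"
  let ?S = "{xs. simplex_list K xs \<and> length xs = ?n}"
  let ?S' = "{xs. simplex_list K xs \<and> length xs = Suc i}"
  let ?del = "\<lambda>j xs. take j xs @ drop (Suc j) xs"
  have tm: "(- 1) ^ j * f (?del j xs) * c xs = f (?del j xs) * c (xs ! j # ?del j xs)"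
    if "xs \<in> ?S" "j < ?n" for xs j
  proof -
    have "c xs = c (take j xs @ xs ! j # drop (Suc j) xs)"
      using that by (simp add: id_take_nth_drop[symmetric])
    also have "\<dots> = (- 1) ^ j * c (xs ! j # ?del j xs)"
      using that by (subst alternating_move_front[OF alt_alternating[OF c]]) simp
    finally have "(- 1) ^ j * c xs = ((- 1) ^ j * (- 1) ^ j) * c (xs ! j # ?del j xs)" by simp
    also have "(- 1) ^ j * (- 1) ^ j = (1::int)" by (simp flip: power_add)
    finally show ?thesis by (simp add: mult_ac)
  qed
  have reindex: "(\<Sum>xs\<in>?S. f (?del j xs) * c (xs ! j # ?del j xs)) = (\<Sum>zs\<in>?S. f (tl zs) * c zs)"
    if j: "j < ?n" for j
  proof (rule sum.reindex_bij_witness[of _ "\<lambda>zs. take j (tl zs) @ hd zs # drop j (tl zs)"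
        "\<lambda>xs. xs ! j # ?del j xs"])
    fix xs assume xs: "xs \<in> ?S"
    have m: "mset (xs ! j # ?del j xs) = mset xs"
    proof -
      have "xs = take j xs @ xs ! j # drop (Suc j) xs" using xs j by (intro id_take_nth_drop) simp
      then have "mset xs = mset (take j xs @ xs ! j # drop (Suc j) xs)" by (rule arg_cong)
      then show ?thesis by simp
    qed
    show "take j (tl (xs ! j # ?del j xs)) @ hd (xs ! j # ?del j xs) # drop j (tl (xs ! j # ?del j xs)) = xs"
      using xs j by (simp add: id_take_nth_drop[symmetric])
    show "xs ! j # ?del j xs \<in> ?S"
      using xs mset_eq_setD[OF m] mset_eq_length[OF m] mset_eq_imp_distinct_iff[OF m]
      unfolding simplex_list_def by simp
    show "f (tl (xs ! j # ?del j xs)) * c (xs ! j # ?del j xs) = f (?del j xs) * c (xs ! j # ?del j xs)"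
      by simp
  next
    fix zs assume zs: "zs \<in> ?S"
    then obtain z ws where z: "zs = z # ws" by (cases zs) auto
    let ?xs = "take j ws @ z # drop j ws"
    have m: "mset ?xs = mset zs"
    proof -
      have "mset (take j ws) + mset (drop j ws) = mset ws" by (simp flip: mset_append)
      then show ?thesis by (simp add: z)
    qed
    have lj: "length (take j ws) = j" using zs j z by simp
    show "(take j (tl zs) @ hd zs # drop j (tl zs)) ! j # ?del j (take j (tl zs) @ hd zs # drop j (tl zs)) = zs"
      using lj by (simp add: z nth_append)
    show "take j (tl zs) @ hd zs # drop j (tl zs) \<in> ?S"
      using zs mset_eq_setD[OF m] mset_eq_length[OF m] mset_eq_imp_distinct_iff[OF m]
      unfolding simplex_list_def by (simp add: z)
  qed
  have "list_pairing K ?n (coboundary K f) c = (\<Sum>xs\<in>?S. \<Sum>j<?n. (- 1) ^ j * f (?del j xs) * c xs)"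
    unfolding list_pairing_def
    by (intro sum.cong refl)
      (simp add: coboundary_eq list_cob_def sum_distrib_right del: sum.lessThan_Suc)
  also have "\<dots> = (\<Sum>xs\<in>?S. \<Sum>j<?n. f (?del j xs) * c (xs ! j # ?del j xs))"
    by (intro sum.cong refl tm) auto
  also have "\<dots> = (\<Sum>j<?n. \<Sum>xs\<in>?S. f (?del j xs) * c (xs ! j # ?del j xs))"
    by (rule sum.swap)
  also have "\<dots> = (\<Sum>j<?n. \<Sum>zs\<in>?S. f (tl zs) * c zs)"
    by (intro sum.cong refl reindex) auto
  also have "\<dots> = int ?n * (\<Sum>zs\<in>?S. f (tl zs) * c zs)" by simp
  also have "(\<Sum>zs\<in>?S. f (tl zs) * c zs) = (\<Sum>(v, ys)\<in>\<Union>K \<times> ?S'. f ys * c (v # ys))"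
  proof -
    let ?h = "\<lambda>(v, ys). v # ys"
    have inj: "inj_on ?h (\<Union>K \<times> ?S')" by (auto simp: inj_on_def)
    \<comment> \<open>The range is enlarged to every vertex in front of every face, as in the
      formula for the boundary; \<open>c\<close> vanishes on the added lists.\<close>
    have "(\<Sum>zs\<in>?S. f (tl zs) * c zs) = (\<Sum>zs\<in>?h ` (\<Union>K \<times> ?S'). f (tl zs) * c zs)"
    proof (rule sum.mono_neutral_left)
      show "finite (?h ` (\<Union>K \<times> ?S'))"
        using finite_K finite_simplex finite_simplex_lists[of "Suc i"] by (intro finite_imageI finite_cartesian_product) auto
      show "?S \<subseteq> ?h ` (\<Union>K \<times> ?S')"
      proof
        fix zs assume zs: "zs \<in> ?S"
        then obtain z ws where z: "zs = z # ws" by (cases zs) auto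
        have "simplex_list K ws" using simplex_list_subface[OF complex, of zs 0] zs z by simp
        moreover have "z \<in> \<Union>K" using zs z by (auto simp: simplex_list_def)
        ultimately have "(z, ws) \<in> \<Union>K \<times> ?S'" using zs z by simp
        then show "zs \<in> ?h ` (\<Union>K \<times> ?S')" unfolding z by (rule rev_image_eqI) simp
      qed
      show "\<forall>zs\<in>?h ` (\<Union>K \<times> ?S') - ?S. f (tl zs) * c zs = 0"
        using alt_outside[OF c] by auto
    qed
    also have "\<dots> = (\<Sum>(v, ys)\<in>\<Union>K \<times> ?S'. f ys * c (v # ys))"
      unfolding sum.reindex[OF inj] by (rule sum.cong) auto
    finally show ?thesis .
  qed
  also have "(\<Sum>(v, ys)\<in>\<Union>K \<times> ?S'. f ys * c (v # ys)) = (\<Sum>v\<in>\<Union>K. \<Sum>ys\<in>?S'. f ys * c (v # ys))"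
    by (rule sum.cartesian_product[symmetric])
  also have "\<dots> = (\<Sum>ys\<in>?S'. \<Sum>v\<in>\<Union>K. f ys * c (v # ys))" by (rule sum.swap)
  also have "\<dots> = list_pairing K (Suc i) f (boundary K c)"
    unfolding list_pairing_def by (intro sum.cong refl) (auto simp: boundary_def sum_distrib_left)
  finally show ?thesis .
qed

lemma alternating_boundary:
  assumes "alternating c"
  shows "alternating (boundary K c)"
proof -
  have "boundary K c (xs @ a # b # ys) = - boundary K c (xs @ b # a # ys)" for xs a b ys
    using alternatingD[OF assms, of "_ # xs" a b ys] by (simp add: boundary_def sum_negf[symmetric])
  then show ?thesis unfolding alternating_def by blast
qed

lemma alternating_chain_map_pow: "alternating c \<Longrightarrow> alternating ((chain_map t ^^ k) c)"
  by (induction k) (auto simp: chain_map_def[abs_def] intro: alternating_translate)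

lemma alternating_op_s: 
  assumes "alternating c"
  shows "alternating (op_s p (chain_map t) c)"
proof -
  have "op_s p (chain_map t) c (xs @ a # b # ys) = - op_s p (chain_map t) c (xs @ b # a # ys)" for xs a b ys
    unfolding op_s_def sum_negf[symmetric]
    by (intro sum.cong refl alternatingD alternating_chain_map_pow assms)
  then show ?thesis unfolding alternating_def by blast
qed

lemma alternating_op_d: "alternating c \<Longrightarrow> alternating (op_d (chain_map t) c)"
  using alternating_lincomb[of c "chain_map t c" 1 "-1"] alternating_chain_map_pow[of c 1]
  by (simp add: op_d_def[abs_def])

lemma eval_coboundary:
  assumes f: "f \<in> alt K" and c: "c \<in> alt K"
  shows "cochain_eval K (Suc i) (coboundary K f) c = cochain_eval K i f (boundary K c)"
proof -
  have "fact (Suc (Suc i)) * cochain_eval K (Suc i) (coboundary K f) c =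
      fact (Suc (Suc i)) * cochain_eval K i f (boundary K c)"
    using list_pairing_coboundary[OF assms, of i]
      list_pairing_eq_eval[OF alt_alternating[OF coboundary_alt[OF f]] alt_alternating[OF c], of "Suc i"]
      list_pairing_eq_eval[OF alt_alternating[OF f] alternating_boundary[OF alt_alternating[OF c]], of i]
    by simp
  then show ?thesis by (simp del: fact_Suc)
qed

lemma dvd_eval: "(\<And>xs. d dvd c xs) \<Longrightarrow> d dvd cochain_eval K j f c"
  unfolding cochain_eval_def Let_def by (intro dvd_sum dvd_mult) blast

text \<open>By adjointness of boundary and coboundary, boundary-equivariance says that
  \<open>c\<close> kills d of coboundaries. The dual condition on s of the boundary makes the value
  independent of the representative, so \<phi> can be exchanged for the term of any
  resolution.\<close>

lemma dual_weights_if_smith_dual: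
  assumes dual: "smith_dual p K t j c" and be: "boundary_equivariant_mod p K t c" and j: "0 < j"
    and F: "resolution F"
  obtains g X where "dual_weights (Suc j) (diff_op t) g X"
    "\<not> int p dvd (\<Sum>xs\<in>X. g xs * norm_op p t F xs)"
proof -
  obtain i where i: "j = Suc i" using j gr0_implies_Suc by blast
  have ej: "even j" and c_n: "c \<in> alt_n K (Suc j)"
    and s: "\<And>xs. int p dvd op_s p (chain_map t) (boundary K c) xs"
    using dual by (auto simp: smith_dual_def alternating_functions_eq_alt_n)
  obtain \<phi> where \<phi>: "\<phi> \<in> alt_n K (Suc j)"
    and cls: "smith_class p K t j = cohomology_class (cochain_group_d K t) (\<lambda>_. coboundary K) j
            (op_s p (cochain_map t) \<phi>)"
    and nd: "\<not> int p dvd cochain_eval K j \<phi> (op_s p (chain_map t) c)"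
    using dual by (auto simp: smith_dual_def alternating_functions_eq_alt_n)
  have c: "c \<in> alt K" and ca: "alternating c" using alt_n_alt[OF c_n] alt_alternating by auto
  have d: "int p dvd op_d (chain_map t) (boundary K c) xs" for xs
    using be by (simp add: boundary_equivariant_mod_def)
  have norm: "norm_op p t f \<in> alt K" and diff: "diff_op t f \<in> alt K" if "f \<in> alt K" for f
    using res_op_alt[OF that, of 1] res_op_alt[OF that, of 0] by (simp_all add: res_op_def)
  have ev_s: "cochain_eval K k (norm_op p t f) b = cochain_eval K k f (op_s p (chain_map t) b)"
    if "f \<in> alt K" "alternating b" for f k b
    using that eval_eq_iff_list_pairing[of "norm_op p t f" b f "op_s p (chain_map t) b" k]
      alt_alternating[OF norm] alt_alternating alternating_op_s list_pairing_norm by blast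
  have ev_d: "cochain_eval K k (diff_op t f) b = cochain_eval K k f (op_d (chain_map t) b)"
    if "f \<in> alt K" "alternating b" for f k b
    using that eval_eq_iff_list_pairing[of "diff_op t f" b f "op_d (chain_map t) b" k]
      alt_alternating[OF diff] alt_alternating alternating_op_d list_pairing_diff by blast
  \<comment> \<open>The same choice as in \<open>cochain_eval\<close>, so that the weighted sum over
    these lists is literally the evaluation.\<close>
  define rp where "rp \<sigma> = (SOME xs. distinct xs \<and> set xs = \<sigma>)" for \<sigma> :: "'a set"
  define S where "S = {\<sigma>\<in>K. card \<sigma> = Suc j}"
  have rp: "distinct (rp \<sigma>)" "set (rp \<sigma>) = \<sigma>" if "\<sigma> \<in> S" for \<sigma>
  proof -
    have "\<exists>xs. distinct xs \<and> set xs = \<sigma>"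
      using finite_distinct_list[of \<sigma>] that finite_simplex by (auto simp: S_def)
    then show "distinct (rp \<sigma>)" "set (rp \<sigma>) = \<sigma>" unfolding rp_def by (metis (mono_tags, lifting) someI_ex)+
  qed
  have "inj_on rp S" using rp(2) by (metis inj_onI)
  then have ev: "(\<Sum>xs\<in>rp ` S. c xs * f xs) = cochain_eval K j f c" for f
    unfolding cochain_eval_def Let_def rp_def[symmetric] S_def[symmetric]
    by (simp add: sum.reindex mult.commute)
  have "int p dvd (\<Sum>xs\<in>rp ` S. c xs * diff_op t (coboundary K f) xs)" if f: "f \<in> alt K" for f
  proof -
    have "diff_op t (coboundary K f) = coboundary K (diff_op t f)"
      using coboundary_res_op[of 0 f] by (simp add: fun_eq_iff res_op_def)
    then have "(\<Sum>xs\<in>rp ` S. c xs * diff_op t (coboundary K f) xs) = cochain_eval K i f (op_d (chain_map t) (boundary K c))"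
      by (simp add: ev i eval_coboundary[OF diff[OF f] c] ev_d[OF f alternating_boundary[OF ca]])
    then show ?thesis using dvd_eval[of "int p", OF d] by simp
  qed
  moreover have "length xs = Suc j" if "xs \<in> rp ` S" for xs
    using that rp distinct_card by (fastforce simp: S_def)
  ultimately have "dual_weights (Suc j) (diff_op t) c (rp ` S)"
    using finite_K by (simp add: dual_weights_def S_def)
  moreover have "\<not> int p dvd (\<Sum>xs\<in>rp ` S. c xs * norm_op p t F xs)"
  proof
    assume *: "int p dvd (\<Sum>xs\<in>rp ` S. c xs * norm_op p t F xs)"
    have "cohomology_class (smith_complex p K t j) (\<lambda>_. coboundary K) j (norm_op p t \<phi>) =
        cohomology_class (smith_complex p K t j) (\<lambda>_. coboundary K) j (res_op p t (Suc j) (part (Suc j) F))"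
      using cls ej unfolding smith_class_eq[OF F] by (simp add: smith_complex_def op_s_cochain_map)
    then obtain \<chi> where \<chi>: "\<chi> \<in> alt_n K j" 
      and eq: "(\<lambda>xs. norm_op p t \<phi> xs - res_op p t (Suc j) (part (Suc j) F) xs) = coboundary K (res_op p t (Suc j) \<chi>)"
      unfolding smith.class_eq_class_iff smith_coboundaries by blast
    have \<chi>a: "\<chi> \<in> alt K" by (rule alt_n_alt[OF \<chi>])
    have "norm_op p t F xs = norm_op p t \<phi> xs - coboundary K (norm_op p t \<chi>) xs" if "length xs = Suc j" for xs
      using fun_cong[OF eq, of xs] that ej by (simp add: res_op_part) (simp add: res_op_def)
    then have "(\<Sum>xs\<in>rp ` S. c xs * norm_op p t F xs) =
        (\<Sum>xs\<in>rp ` S. c xs * (norm_op p t \<phi> xs - coboundary K (norm_op p t \<chi>) xs))"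
      using \<open>\<And>xs. xs \<in> rp ` S \<Longrightarrow> length xs = Suc j\<close> by (intro sum.cong) auto
    also have "\<dots> = cochain_eval K j (norm_op p t \<phi>) c - cochain_eval K j (coboundary K (norm_op p t \<chi>)) c"
      by (simp add: right_diff_distrib sum_subtractf ev)
    also have "cochain_eval K j (coboundary K (norm_op p t \<chi>)) c = cochain_eval K i \<chi> (op_s p (chain_map t) (boundary K c))"
      by (simp add: i eval_coboundary[OF norm[OF \<chi>a] c] ev_s[OF \<chi>a alternating_boundary[OF ca]])
    also have "cochain_eval K j (norm_op p t \<phi>) c = cochain_eval K j \<phi> (op_s p (chain_map t) c)"
      by (rule ev_s[OF alt_n_alt[OF \<phi>] ca])
    finally have "int p dvd cochain_eval K j \<phi> (op_s p (chain_map t) c)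
        - cochain_eval K i \<chi> (op_s p (chain_map t) (boundary K c))" using * by simp
    then have "int p dvd cochain_eval K j \<phi> (op_s p (chain_map t) c)"
      using dvd_eval[of "int p", OF s] by (simp add: dvd_diff_left_iff)
    then show False using nd by simp
  qed
  ultimately show ?thesis by (rule that)
qed

end

context Zp_pair
begin

lemma smith_index_join_eq_odd:
  assumes p: "prime p"
    and K: "smith_index_p p K t = smith_index p K t" "0 < smith_index p K t - 1"
    and L: "smith_index_p p L u = smith_index p L u" "0 < smith_index p L u - 1"
    and dual: "(even (smith_index p K t - 1) \<and>
        (\<exists>c. smith_dual p K t (smith_index p K t - 1) c \<and> boundary_equivariant_mod p K t c)) \<or>
       (even (smith_index p L u - 1) \<and>
        (\<exists>c. smith_dual p L u (smith_index p L u - 1) c \<and> boundary_equivariant_mod p L u c))"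
  shows "smith_index_p p (complex_join K L) (map_sum t u) = smith_index p (complex_join K L) (map_sum t u) \<and>
    smith_index p (complex_join K L) (map_sum t u) = smith_index p K t + smith_index p L u"
proof -
  obtain m n where m: "smith_index p K t = Suc m" and n: "smith_index p L u = Suc n"
    using K(2) L(2) by (metis diff_0_eq_0 less_irrefl not0_implies_Suc)
  have nA: "\<not> A.null_mod m" and nB: "\<not> B.null_mod n"
    using K(1) L(1) m n by (simp_all add: A.smith_index_p_le_iff[symmetric] B.smith_index_p_le_iff[symmetric])
  have mn: "0 < m" "0 < n" using K(2) L(2) m n by simp_all
  have "\<not> J.null_mod (m + n + 1)"
    using dual
  proof
    assume "even (smith_index p K t - 1) \<and>
        (\<exists>c. smith_dual p K t (smith_index p K t - 1) c \<and> boundary_equivariant_mod p K t c)"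
    then obtain c where c: "even m" "smith_dual p K t m c" "boundary_equivariant_mod p K t c" using m by auto
    obtain F where F: "A.resolution F" using A.resolution_exists by blast
    show ?thesis
      by (rule A.dual_weights_if_smith_dual[OF c(2,3) mn(1) F])
        (rule not_null_mod_join_left[OF p F c(1) _ _ nB])
  next
    assume "even (smith_index p L u - 1) \<and>
        (\<exists>c. smith_dual p L u (smith_index p L u - 1) c \<and> boundary_equivariant_mod p L u c)"
    then obtain c where c: "even n" "smith_dual p L u n c" "boundary_equivariant_mod p L u c" using n by auto
    obtain G where G: "B.resolution G" using B.resolution_exists by blast
    show ?thesis
      by (rule B.dual_weights_if_smith_dual[OF c(2,3) mn(2) G])
        (rule not_null_mod_join_right[OF p G c(1) _ _ nA])
  qed
  then show ?thesis by (rule indices_eq_if_not_null_mod[OF m n])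
qed

end

subsection \<open>Two-dimensional complexes with an involution\<close>

text \<open>The norm of a resolution is 1 at a vertex, but the normal form of a class vanishing
  modulo p would make it a multiple of p.\<close>

lemma (in Zp_action) not_null_mod_0:
  assumes "1 < p" "{v} \<in> K"
  shows "\<not> null_mod 0"
proof
  assume "null_mod 0"
  then obtain F \<psi> where F: "resolution F" and "\<psi> \<in> alt_n K (Suc 0)"
    and "\<And>xs. Suc 0 < length xs \<Longrightarrow> F xs = 0"
    and eq: "\<And>xs. length xs = Suc 0 \<Longrightarrow> F xs = lift_op (Suc 0) \<psi> xs"
    and "\<And>xs. res_op p t (Suc 0) (coboundary K \<psi>) xs = 0"
    by (rule null_mod_normal_form) (rule that)
  have "1 = norm_op p t F [v]"
    using resolutionD(3)[OF F, of "[v]"] resolutionD(2)[OF F] assms(2)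
    by (simp add: coboundary_eq simplex_list_def list_cob_Cons res_op_def)
  also have "\<dots> = norm_op p t (lift_op (Suc 0) \<psi>) [v]"
    unfolding norm_op_def by (intro sum.cong refl eq) simp
  also have "\<dots> = int p * norm_op p t \<psi> [v]"
    using res_op_lift_op[of "Suc 0" \<psi> "[v]"] by (simp add: res_op_def)
  finally have "int p dvd 1" by (metis dvd_triv_left)
  then show False using assms(1) by simp
qed

section \<open>Complexes on ten vertices given by tables\<close>

lemma permute_cases:
  assumes "alternating f" "distinct xs" "distinct ys" "set xs = set ys"
  shows "f xs = f ys \<or> f xs = - f ys"
proof -
  have "mset xs = mset ys" using assms by (simp add: set_eq_iff_mset_eq_distinct)
  then obtain \<pi> where p: "\<pi> permutes {..<length ys}" "permute_list \<pi> ys = xs"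
    using mset_eq_permutation by metis
  then show ?thesis
    using alternating_permute[OF assms(1) p(1)] by (auto simp: sign_def split: if_splits)
qed

text \<open>The vertices are 0 to 9 with i and i + 5 interchanged. Other numbers are fixed, as
  \<open>permutes\<close> requires.\<close>

definition opp :: "nat \<Rightarrow> nat" where
  "opp i = (if i < 5 then i + 5 else if i < 10 then i - 5 else i)"

lemma opp_opp [simp]: "opp (opp i) = i"
  by (auto simp: opp_def)

lemma opp_pow: "opp ^^ k = (if even k then id else opp)"
  by (induction k) (auto simp: fun_eq_iff)

definition triangle_complex :: "(nat \<times> nat \<times> nat) list \<Rightarrow> nat set set" where
  "triangle_complex T = {\<sigma>. \<exists>(a, b, c)\<in>set T. \<sigma> \<subseteq> {a, b, c} \<or> \<sigma> \<subseteq> {opp a, opp b, opp c}}"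

definition edge_table :: "(nat \<times> nat) list \<Rightarrow> nat \<Rightarrow> nat \<Rightarrow> int" where
  "edge_table E x y = of_bool ((x, y) \<in> set E) - of_bool ((y, x) \<in> set E)"

text \<open>The first condition keeps a vertex and its image out of a common triangle, which gives
  freeness.\<close>

locale involution_complex =
  fixes T :: "(nat \<times> nat \<times> nat) list"
  assumes proper: "\<forall>(a, b, c)\<in>set T. distinct [a, b, c, opp a, opp b, opp c]"
    and vertices: "(\<Union>(a, b, c)\<in>set T. {a, b, c, opp a, opp b, opp c}) = {..<10}"
begin

abbreviation "K \<equiv> triangle_complex T"

definition triangles :: "(nat \<times> nat \<times> nat) set" where
  "triangles = set T \<union> (\<lambda>(a, b, c). (opp a, opp b, opp c)) ` set T"

lemma triangles_I: "(a, b, c) \<in> set T \<Longrightarrow> (a, b, c) \<in> triangles" "(a, b, c) \<in> set T \<Longrightarrow> (opp a, opp b, opp c) \<in> triangles"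
  using imageI[of "(a, b, c)" "set T" "\<lambda>(a, b, c). (opp a, opp b, opp c)"] by (simp_all add: triangles_def)

lemma triangles_cases:
  assumes "(a, b, c) \<in> triangles"
  obtains "(a, b, c) \<in> set T" | a' b' c' where "(a', b', c') \<in> set T" "a = opp a'" "b = opp b'" "c = opp c'"
proof -
  have "(a, b, c) \<in> set T \<or> (\<exists>x\<in>set T. (a, b, c) = (case x of (a, b, c) \<Rightarrow> (opp a, opp b, opp c)))"
    using assms by (simp add: triangles_def image_iff)
  then show ?thesis
  proof
    assume "\<exists>x\<in>set T. (a, b, c) = (case x of (a, b, c) \<Rightarrow> (opp a, opp b, opp c))"
    then obtain x where x: "x \<in> set T" "(a, b, c) = (case x of (a, b, c) \<Rightarrow> (opp a, opp b, opp c))"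
      by (rule bexE)
    obtain a' b' c' where "x = (a', b', c')" by (rule prod_cases3)
    then show ?thesis using x that(2)[of a' b' c'] by simp
  qed (rule that(1))
qed

lemma K_eq: "K = (\<Union>(a, b, c)\<in>triangles. Pow {a, b, c})"
proof (intro equalityI subsetI)
  fix \<sigma> assume "\<sigma> \<in> K"
  then obtain a b c where "(a, b, c) \<in> set T" "\<sigma> \<subseteq> {a, b, c} \<or> \<sigma> \<subseteq> {opp a, opp b, opp c}"
    unfolding triangle_complex_def by blast
  then show "\<sigma> \<in> (\<Union>(a, b, c)\<in>triangles. Pow {a, b, c})" using triangles_I[of a b c] by blast
next
  fix \<sigma> assume "\<sigma> \<in> (\<Union>(a, b, c)\<in>triangles. Pow {a, b, c})"
  then obtain a b c where abc: "(a, b, c) \<in> triangles" "\<sigma> \<subseteq> {a, b, c}" by blast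
  from abc(1) show "\<sigma> \<in> K"
    by (rule triangles_cases) (use abc(2) in \<open>unfold triangle_complex_def, blast+\<close>)
qed

lemma K_cases:
  assumes "\<sigma> \<in> K"
  obtains a b c where "(a, b, c) \<in> triangles" "\<sigma> \<subseteq> {a, b, c}"
  using assms unfolding K_eq by blast

lemma K_I: "(a, b, c) \<in> triangles \<Longrightarrow> \<sigma> \<subseteq> {a, b, c} \<Longrightarrow> \<sigma> \<in> K"
  unfolding K_eq by blast

lemma triangles_opp: "(a, b, c) \<in> triangles \<Longrightarrow> (opp a, opp b, opp c) \<in> triangles"
  by (erule triangles_cases) (simp_all add: triangles_I)

lemma triangles_proper: "(a, b, c) \<in> triangles \<Longrightarrow> distinct [a, b, c, opp a, opp b, opp c]"
  using proper by (elim triangles_cases) auto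

lemma vertices': "\<Union>K = {..<10}"
proof -
  have "\<Union>K = (\<Union>(a, b, c)\<in>triangles. {a, b, c})" unfolding K_eq by blast
  also have "\<dots> = (\<Union>(a, b, c)\<in>set T. {a, b, c, opp a, opp b, opp c})"
  proof (intro equalityI subsetI)
    fix x assume "x \<in> (\<Union>(a, b, c)\<in>triangles. {a, b, c})"
    then obtain a b c where abc: "(a, b, c) \<in> triangles" "x \<in> {a, b, c}" by blast
    from abc(1) show "x \<in> (\<Union>(a, b, c)\<in>set T. {a, b, c, opp a, opp b, opp c})"
      by (rule triangles_cases) (use abc(2) in blast)+
  next
    fix x assume "x \<in> (\<Union>(a, b, c)\<in>set T. {a, b, c, opp a, opp b, opp c})"
    then obtain a b c where "(a, b, c) \<in> set T" "x \<in> {a, b, c} \<or> x \<in> {opp a, opp b, opp c}" by blast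
    then show "x \<in> (\<Union>(a, b, c)\<in>triangles. {a, b, c})" using triangles_I[of a b c] by blast
  qed
  finally show ?thesis by (simp only: vertices)
qed

lemma triangles_nonempty: "triangles \<noteq> {}"
proof -
  have "0 \<in> \<Union>K" unfolding vertices' by simp
  then show ?thesis unfolding K_eq by blast
qed

lemma Zp_complex_K: "Zp_complex 2 K opp"
proof -
  have "finite triangles" by (simp add: triangles_def)
  then have "finite K" unfolding K_eq by auto
  moreover have "finite \<sigma>" if "\<sigma> \<in> K" for \<sigma>
    using that by (rule K_cases) (simp add: finite_subset)
  moreover have "{} \<in> K" using triangles_nonempty K_I[of _ _ _ "{}"] by auto
  moreover have "\<tau> \<in> K" if "\<sigma> \<in> K" "\<tau> \<subseteq> \<sigma>" for \<sigma> \<tau>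
    using that unfolding K_eq by blast
  ultimately have "abstract_complex K" by (auto simp: abstract_complex_def)
  moreover have "opp permutes \<Union>K"
    unfolding vertices'
  proof (rule bij_imp_permutes)
    show "bij_betw opp {..<10} {..<10}"
      by (rule bij_betw_byWitness[of _ opp]) (auto simp: opp_def)
  qed (simp add: opp_def)
  moreover have im: "opp ` \<sigma> \<in> K" if "\<sigma> \<in> K" for \<sigma>
  proof -
    obtain a b c where abc: "(a, b, c) \<in> triangles" "\<sigma> \<subseteq> {a, b, c}" using \<open>\<sigma> \<in> K\<close> by (rule K_cases)
    then have "opp ` \<sigma> \<subseteq> {opp a, opp b, opp c}" by auto
    then show ?thesis by (rule K_I[OF triangles_opp[OF abc(1)]])
  qed
  moreover have "(`) opp ` K = K"
  proof (intro equalityI subsetI)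
    fix \<sigma> assume "\<sigma> \<in> K"
    moreover have "\<sigma> = opp ` opp ` \<sigma>" by (simp add: image_image)
    ultimately show "\<sigma> \<in> (`) opp ` K" using im by blast
  qed (use im in auto)
  moreover have "(opp ^^ k) ` \<sigma> \<noteq> \<sigma>" if "\<sigma> \<in> K" "\<sigma> \<noteq> {}" "\<not> 2 dvd k" for \<sigma> k
  proof
    assume "(opp ^^ k) ` \<sigma> = \<sigma>"
    then have eq: "opp ` \<sigma> = \<sigma>" using that by (simp add: opp_pow)
    obtain a b c where abc: "(a, b, c) \<in> triangles" "\<sigma> \<subseteq> {a, b, c}" using \<open>\<sigma> \<in> K\<close> by (rule K_cases)
    obtain v where "v \<in> \<sigma>" using \<open>\<sigma> \<noteq> {}\<close> by blast
    then have "v \<in> {a, b, c}" "opp v \<in> {a, b, c}" using eq abc(2) by blast+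
    then show False using triangles_proper[OF abc(1)] by auto
  qed
  moreover have "opp ^^ 2 = id" by (simp add: opp_pow)
  ultimately show ?thesis unfolding Zp_complex_def by blast
qed

sublocale Zp_action 2 K opp
  by unfold_locales (simp_all add: Zp_complex_K)

lemma simplex_length: "simplex_list K xs \<Longrightarrow> length xs \<le> 3"
proof -
  assume s: "simplex_list K xs"
  then have "set xs \<in> K" by (simp add: simplex_list_def)
  then obtain a b c where "set xs \<subseteq> {a, b, c}" by (rule K_cases)
  then have "card (set xs) \<le> card {a, b, c}" by (intro card_mono) auto
  also have "\<dots> \<le> 3" by (simp add: card_insert_le_m1)
  finally show ?thesis using s by (simp add: simplex_list_def distinct_card)
qed

lemma triangle_simplex: "(a, b, c) \<in> triangles \<Longrightarrow> simplex_list K [a, b, c]"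
  and edge_simplex: "(a, b, c) \<in> triangles \<Longrightarrow> (x, y) \<in> {(a, b), (a, c), (b, c)} \<Longrightarrow> simplex_list K [x, y]"
  using triangles_proper[of a b c] K_I[of a b c] by (auto simp: simplex_list_def)

lemma edge_cases:
  assumes "simplex_list K [x, y]"
  obtains a b c where "(a, b, c) \<in> triangles"
    "(x, y) \<in> {(a, b), (a, c), (b, c)} \<or> (y, x) \<in> {(a, b), (a, c), (b, c)}"
proof -
  have "{x, y} \<in> K" and ne: "x \<noteq> y" using assms by (simp_all add: simplex_list_def)
  from this(1) obtain a b c where "(a, b, c) \<in> triangles" "{x, y} \<subseteq> {a, b, c}" by (rule K_cases)
  with ne show ?thesis using that by auto
qed

lemma triangle_cases:
  assumes "simplex_list K xs" "length xs = 3"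
  obtains a b c where "(a, b, c) \<in> triangles" "set xs = {a, b, c}"
proof -
  have "set xs \<in> K" using assms by (simp add: simplex_list_def)
  then obtain a b c where abc: "(a, b, c) \<in> triangles" "set xs \<subseteq> {a, b, c}" by (rule K_cases)
  have "card (set xs) = 3" using assms by (simp add: simplex_list_def distinct_card)
  moreover have "card {a, b, c} = 3" using triangles_proper[OF abc(1)] by simp
  ultimately have "set xs = {a, b, c}" using abc(2) by (intro card_subset_eq) auto
  then show ?thesis using that abc(1) by blast
qed

lemma alt_3_eq_0:
  assumes f: "f \<in> alt_n K 3" and z: "\<And>a b c. (a, b, c) \<in> triangles \<Longrightarrow> f [a, b, c] = 0"
  shows "f xs = 0"
proof (cases "simplex_list K xs \<and> length xs = 3")
  case True
  then obtain a b c where abc: "(a, b, c) \<in> triangles" "set xs = {a, b, c}" using triangle_cases by blast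
  have "f xs = f [a, b, c] \<or> f xs = - f [a, b, c]"
    using abc True triangles_proper[OF abc(1)]
    by (intro permute_cases[OF alt_alternating[OF alt_n_alt[OF f]]]) (auto simp: simplex_list_def)
  then show ?thesis using z[OF abc(1)] by simp
next
  case False
  then show ?thesis using alt_n_outside[OF f] alt_outside[OF alt_n_alt[OF f]] by blast
qed

lemma alt_3_dvd:
  assumes f: "f \<in> alt_n K 3" and z: "\<And>a b c. (a, b, c) \<in> triangles \<Longrightarrow> d dvd f [a, b, c]"
  shows "d dvd f xs"
proof (cases "simplex_list K xs \<and> length xs = 3")
  case True
  then obtain a b c where abc: "(a, b, c) \<in> triangles" "set xs = {a, b, c}" using triangle_cases by blast
  have "f xs = f [a, b, c] \<or> f xs = - f [a, b, c]"
    using abc True triangles_proper[OF abc(1)]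
    by (intro permute_cases[OF alt_alternating[OF alt_n_alt[OF f]]]) (auto simp: simplex_list_def)
  then show ?thesis using z[OF abc(1)] by auto
next
  case False
  then have "f xs = 0" using alt_n_outside[OF f] alt_outside[OF alt_n_alt[OF f]] by blast
  then show ?thesis by simp
qed

lemma coboundary_triangle:
  assumes "(a, b, c) \<in> triangles"
  shows "coboundary K f [a, b, c] = f [b, c] - f [a, c] + f [a, b]"
  using triangle_simplex[OF assms] by (simp add: coboundary_eq list_cob_Cons)

definition edge_cochain :: "(nat \<times> nat) list \<Rightarrow> nat list \<Rightarrow> int" where
  "edge_cochain E xs =
    (if simplex_list K xs \<and> length xs = 2 then edge_table E (xs ! 0) (xs ! 1) else 0)"

lemma edge_cochain_alt_n: "edge_cochain E \<in> alt_n K 2"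
proof -
  have "edge_cochain E (us @ a # b # vs) = - edge_cochain E (us @ b # a # vs)" for us a b vs
  proof (cases "us = [] \<and> vs = []")
    case True
    then show ?thesis
      using simplex_list_swap[of K "[]" a b "[]"] by (simp add: edge_cochain_def edge_table_def)
  next
    case False
    then show ?thesis by (auto simp: edge_cochain_def)
  qed
  then have "alternating (edge_cochain E)" unfolding alternating_def by blast
  then show ?thesis by (auto simp: alt_n_def alt_def edge_cochain_def)
qed

lemma edge_cochain_coboundary:
  assumes "(a, b, c) \<in> triangles"
  shows "coboundary K (edge_cochain E) [a, b, c] = edge_table E b c - edge_table E a c + edge_table E a b"
  using edge_simplex[OF assms] by (simp add: coboundary_triangle[OF assms] edge_cochain_def)

lemma coboundary_edge_cochain_alt_n: "coboundary K (edge_cochain E) \<in> alt_n K 3"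
  using coboundary_alt_n[OF edge_cochain_alt_n[of E]] by (simp add: numeral_3_eq_3 numeral_2_eq_2)

definition vertex_cochain :: "nat list \<Rightarrow> int" where
  "vertex_cochain xs = (if simplex_list K xs \<and> length xs = 1 then of_bool (xs ! 0 < 5) else 0)"

lemma vertex_cochain_alt_n: "vertex_cochain \<in> alt_n K 1"
proof -
  have "vertex_cochain (us @ a # b # vs) = - vertex_cochain (us @ b # a # vs)" for us a b vs
    by (simp add: vertex_cochain_def)
  then have "alternating vertex_cochain" unfolding alternating_def by blast
  then show ?thesis by (auto simp: alt_n_def alt_def vertex_cochain_def)
qed

text \<open>The degree 1 equation of a resolution, with the indicator of the vertices 0 to 4 in
  degree 0 and the table \<open>E\<close> in degree 1.\<close>

definition compatible :: "(nat \<times> nat) list \<Rightarrow> bool" where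
  "compatible E \<longleftrightarrow> (\<forall>(a, b, c)\<in>triangles. \<forall>(x, y)\<in>{(a, b), (a, c), (b, c)}.
     of_bool (y < 5) - of_bool (x < 5) = edge_table E x y - edge_table E (opp x) (opp y))"

lemma compatibleD:
  assumes "compatible E" "(a, b, c) \<in> triangles" "(x, y) \<in> {(a, b), (a, c), (b, c)}"
  shows "of_bool (y < 5) - of_bool (x < 5) = edge_table E x y - edge_table E (opp x) (opp y)"
  using bspec[OF bspec[OF assms(1)[unfolded compatible_def] assms(2), unfolded prod.case] assms(3)]
  by simp

lemma edge_table_swap: "edge_table E x y = - edge_table E y x"
  by (simp add: edge_table_def)

lemma diff_edge_cochain:
  assumes "compatible E"
  shows "diff_op opp (edge_cochain E) xs = coboundary K vertex_cochain xs"
proof (cases "simplex_list K xs \<and> length xs = 2")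
  case True
  then obtain x y where xy: "xs = [x, y]"
    by (auto simp: numeral_2_eq_2 length_Suc_conv)
  have s: "simplex_list K [x, y]" using True xy by simp
  have e: "of_bool (y < 5) - of_bool (x < 5) = edge_table E x y - edge_table E (opp x) (opp y)"
  proof -
    obtain a b c where abc: "(a, b, c) \<in> triangles"
      "(x, y) \<in> {(a, b), (a, c), (b, c)} \<or> (y, x) \<in> {(a, b), (a, c), (b, c)}"
      by (rule edge_cases[OF s])
    from abc(2) show ?thesis
    proof
      assume "(y, x) \<in> {(a, b), (a, c), (b, c)}"
      from compatibleD[OF assms abc(1) this] show ?thesis
        unfolding edge_table_swap[of E y x] edge_table_swap[of E "opp y" "opp x"] by linarith
    qed (rule compatibleD[OF assms abc(1)])
  qed
  have v: "simplex_list K [x]" "simplex_list K [y]"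
    using simplex_list_subface[OF complex s, of 1] simplex_list_subface[OF complex s, of 0] by simp_all
  have s': "simplex_list K [opp x, opp y]" using simplex_list_map(1)[of "[x, y]"] s by simp
  show ?thesis
    using e s s' v by (simp add: xy diff_op_def edge_cochain_def coboundary_eq list_cob_Cons vertex_cochain_def)
next
  case False
  have "coboundary K vertex_cochain \<in> alt_n K 2"
    using coboundary_alt_n[OF vertex_cochain_alt_n] by (simp add: numeral_2_eq_2)
  then have "coboundary K vertex_cochain xs = 0"
    using False alt_n_outside alt_outside alt_n_alt by blast
  then show ?thesis using False by (auto simp: diff_op_def edge_cochain_def)
qed

definition glue :: "(nat \<times> nat) list \<Rightarrow> (nat list \<Rightarrow> int) \<Rightarrow> nat list \<Rightarrow> int" where
  "glue E h xs = (if xs = [] then 1 else vertex_cochain xs + edge_cochain E xs + h xs)"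

lemma glue_simps:
  assumes "h \<in> alt_n K 3"
  shows "length xs = 1 \<Longrightarrow> glue E h xs = vertex_cochain xs"
    "length xs = 2 \<Longrightarrow> glue E h xs = edge_cochain E xs"
    "length xs = 3 \<Longrightarrow> glue E h xs = h xs"
    "3 < length xs \<Longrightarrow> glue E h xs = 0"
  using alt_n_outside[OF assms] by (auto simp: glue_def vertex_cochain_def edge_cochain_def)

text \<open>The indicator of 0 to 4 contains exactly one vertex of each orbit, so its norm is 1;
  degree 1 is compatibility, degree 2 is the hypothesis on \<open>h\<close>, and there are no
  simplices beyond.\<close>

lemma glue_resolution:
  assumes comp: "compatible E" and h: "h \<in> alt_n K 3"
    and norm: "\<And>xs. norm_op 2 opp h xs = coboundary K (edge_cochain E) xs"
  shows "resolution (glue E h)"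
proof -
  have "(\<lambda>xs. (if xs = [] then 1 else 0) + (vertex_cochain xs + (edge_cochain E xs + h xs))) \<in> alt K"
    by (intro alt_add alt_n_alt[OF empty_unit_alt_n] alt_n_alt[OF vertex_cochain_alt_n]
        alt_n_alt[OF edge_cochain_alt_n] alt_n_alt[OF h])
  moreover have "(\<lambda>xs. (if xs = [] then 1 else 0) + (vertex_cochain xs + (edge_cochain E xs + h xs))) = glue E h"
    using alt_n_outside[OF h, of "[]"] by (auto simp: glue_def fun_eq_iff vertex_cochain_def edge_cochain_def)
  ultimately have alt: "glue E h \<in> alt K" by simp
  have "coboundary K (glue E h) xs = res_op 2 opp (length xs) (glue E h) xs" for xs
  proof -
    have cc: "coboundary K (glue E h) xs = coboundary K f xs"
      if "\<And>ys. length ys + 1 = length xs \<Longrightarrow> glue E h ys = f ys" for f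
      using that by (rule coboundary_cong)
    have "length xs = 0 \<or> length xs = 1 \<or> length xs = 2 \<or> length xs = 3 \<or> 3 < length xs"
      by linarith
    then consider (0) "xs = []" | (1) "length xs = 1" | (2) "length xs = 2" | (3) "length xs = 3" | (4) "3 < length xs"
      by (elim disjE) (simp_all only: length_0_conv)
    then show ?thesis
    proof cases
      case 0
      then show ?thesis by (simp add: coboundary_eq res_op_def diff_op_def)
    next
      case 1
      then obtain v where v: "xs = [v]" by (auto simp: length_Suc_conv)
      show ?thesis
      proof (cases "simplex_list K [v]")
        case True
        then have "v < 10" using vertices' by (force simp: simplex_list_def)
        then have "of_bool (v < 5) + of_bool (opp v < 5) = (1::int)" by (auto simp: opp_def)
        moreover have "simplex_list K [opp v]" using True simplex_list_map(1)[of "[v]"] by simp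
        ultimately show ?thesis using True
          by (simp add: v res_op_def norm_op_involution glue_simps[OF h] vertex_cochain_def coboundary_eq list_cob_Cons)
            (simp add: glue_def)
      next
        case False
        then have "\<not> simplex_list K [opp v]" using simplex_list_map(1)[of "[v]"] by simp
        then show ?thesis using False alt_outside[OF alt]
          by (simp add: v res_op_def norm_op_involution coboundary_eq)
      qed
    next
      case 2
      have "coboundary K (glue E h) xs = coboundary K vertex_cochain xs"
        by (rule cc) (use 2 glue_simps(1)[OF h] in simp)
      then show ?thesis
        using diff_edge_cochain[OF comp, of xs] 2 by (simp add: res_op_def diff_op_def glue_simps[OF h])
    next
      case 3
      have "coboundary K (glue E h) xs = coboundary K (edge_cochain E) xs"
        by (rule cc) (use 3 glue_simps(2)[OF h] in simp)
      then show ?thesis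
        using norm[of xs] 3 by (simp add: res_op_def norm_op_involution glue_simps[OF h])
    next
      case 4
      then have "\<not> simplex_list K xs" "\<not> simplex_list K (map opp xs)"
        using simplex_length[of xs] simplex_length[of "map opp xs"] by auto
      then show ?thesis using alt_outside[OF alt]
        by (simp add: coboundary_eq res_op_def norm_op_involution diff_op_def)
    qed
  qed
  then show ?thesis using alt by (simp add: resolution_def glue_def)
qed

lemma null_3: "null 3"
proof -
  obtain F where F: "resolution F" using resolution_exists by blast
  have "F xs = 0" if "3 < length xs" for xs
    using alt_outside[OF resolutionD(1)[OF F]] simplex_length[of xs] that by fastforce
  then show ?thesis using F unfolding null_def by blast
qed

lemma resolution_equations:
  assumes F: "resolution F"
  shows "v < 10 \<Longrightarrow> F [v] + F [opp v] = 1"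
    and "simplex_list K [x, y] \<Longrightarrow> F [y] - F [x] = F [x, y] - F [opp x, opp y]"
    and "(a, b, c) \<in> triangles \<Longrightarrow> F [b, c] - F [a, c] + F [a, b] = F [a, b, c] + F [opp a, opp b, opp c]"
proof -
  show "F [v] + F [opp v] = 1" if "v < 10"
  proof -
    have "v \<in> \<Union>K" unfolding vertices' using that by simp
    then obtain \<sigma> where "\<sigma> \<in> K" "v \<in> \<sigma>" by blast
    then have "simplex_list K [v]" using complex by (simp add: simplex_list_def abstract_complex_def)
    then show ?thesis
      using resolutionD(3)[OF F, of "[v]"] resolutionD(2)[OF F]
      by (simp add: coboundary_eq list_cob_Cons res_op_def norm_op_involution)
  qed
  show "F [y] - F [x] = F [x, y] - F [opp x, opp y]" if "simplex_list K [x, y]"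
    using resolutionD(3)[OF F, of "[x, y]"] that
    by (simp add: coboundary_eq list_cob_Cons res_op_def diff_op_def)
  show "F [b, c] - F [a, c] + F [a, b] = F [a, b, c] + F [opp a, opp b, opp c]" if "(a, b, c) \<in> triangles"
    using resolutionD(3)[OF F, of "[a, b, c]"]
    by (simp add: coboundary_triangle[OF that] res_op_def norm_op_involution)
qed

lemma swap_edge: "f \<in> alt K \<Longrightarrow> f [x, y] = - f [y, x]"
  using alternatingD[OF alt_alternating, of f K "[]" x y "[]"] by simp

end

lemma lessThan_10: "{..<10::nat} = {0, 1, 2, 3, 4, 5, 6, 7, 8, 9}"
  by (simp add: lessThan_nat_numeral lessThan_Suc insert_commute)

definition all_triangles :: "(nat \<times> nat \<times> nat) list \<Rightarrow> (nat \<times> nat \<times> nat) list" where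
  "all_triangles T = T @ map (\<lambda>(a, b, c). (opp a, opp b, opp c)) T"

text \<open>A form over lists that can be checked by evaluation of the tables.\<close>

definition compatible_code :: "(nat \<times> nat) list \<Rightarrow> (nat \<times> nat \<times> nat) list \<Rightarrow> bool" where
  "compatible_code E T \<longleftrightarrow> list_all (\<lambda>(a, b, c). list_all (\<lambda>(x, y).
     of_bool (y < 5) - of_bool (x < 5) = edge_table E x y - edge_table E (opp x) (opp y))
     [(a, b), (a, c), (b, c)]) (all_triangles T)"

definition boundary_value :: "(nat \<times> nat) list \<Rightarrow> nat \<Rightarrow> nat \<Rightarrow> nat \<Rightarrow> int" where
  "boundary_value E a b c = edge_table E b c - edge_table E a c + edge_table E a b"

context involution_complex
begin

lemma triangles_eq: "triangles = set (all_triangles T)"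
  by (simp add: triangles_def all_triangles_def)

lemma compatibleI: "compatible_code E T \<Longrightarrow> compatible E"
  by (simp add: compatible_def compatible_code_def triangles_eq list_all_iff)

lemma edge_simplexI: "(a, b, c) \<in> triangles \<Longrightarrow> {x, y} \<subseteq> {a, b, c} \<Longrightarrow> x \<noteq> y \<Longrightarrow> simplex_list K [x, y]"
  using K_I[of a b c "{x, y}"] by (simp add: simplex_list_def)

lemma coboundary_edge_cochain_even:
  assumes "list_all (\<lambda>(a, b, c). even (boundary_value E a b c)) (all_triangles T)"
  obtains w where "w \<in> alt_n K 3" "\<And>xs. coboundary K (edge_cochain E) xs = 2 * w xs"
proof -
  have "2 dvd coboundary K (edge_cochain E) xs" for xs
  proof (rule alt_3_dvd[OF coboundary_edge_cochain_alt_n])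
    fix a b c assume abc: "(a, b, c) \<in> triangles"
    then have "even (boundary_value E a b c)" using assms unfolding triangles_eq list_all_iff by blast
    then show "2 dvd coboundary K (edge_cochain E) [a, b, c]"
      by (simp only: edge_cochain_coboundary[OF abc] boundary_value_def)
  qed
  then show ?thesis using alt_n_divide[OF coboundary_edge_cochain_alt_n[of E], of 2] that by auto
qed

lemma coboundary_alt_3_eq_0:
  assumes "f \<in> alt_n K 3"
  shows "coboundary K f xs = 0"
proof (cases "length xs = 4")
  case True
  then have "\<not> simplex_list K xs" using simplex_length[of xs] by auto
  then show ?thesis by (simp add: coboundary_eq)
next
  case False
  then show ?thesis using alt_n_outside[OF coboundary_alt_n[OF assms]] by simp
qed

end


subsection \<open>A double cover of the Moore space with first homology of order four\<close>

definition moore_triangles :: "(nat \<times> nat \<times> nat) list" where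
  "moore_triangles = [(0,4,7), (0,2,6), (0,1,7), (0,1,8), (0,1,3), (1,3,4), (1,4,8), (0,6,8),
     (0,2,9), (0,4,6), (1,8,9), (0,3,9)]"

text \<open>A degree 1 term chosen to be compatible and to have an even coboundary; half of this
  coboundary is the top term of the resolution below.\<close>

definition moore_edges :: "(nat \<times> nat) list" where
  "moore_edges = [(0,4), (6,0), (8,0), (8,1), (9,1), (5,2), (6,2), (5,4), (7,4), (8,4), (5,9)]"

lemma moore_involution_complex: "involution_complex moore_triangles"
proof
  show "\<forall>(a, b, c)\<in>set moore_triangles. distinct [a, b, c, opp a, opp b, opp c]"
    by (simp add: moore_triangles_def opp_def)
  show "(\<Union>(a, b, c)\<in>set moore_triangles. {a, b, c, opp a, opp b, opp c}) = {..<10}"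
    unfolding lessThan_10 by (rule equalityI) (simp_all add: moore_triangles_def opp_def)
qed

lemma moore_code:
  "compatible_code moore_edges moore_triangles"
  "list_all (\<lambda>(a, b, c). even (boundary_value moore_edges a b c)) (all_triangles moore_triangles)"
  by code_simp+

context involution_complex
begin

text \<open>Twice the loop \<open>0, 1, 5, 6\<close> is the boundary of the sum of 14 triangles, but the compatibility of
  \<open>f\<close> in degrees \<open>0\<close> and \<open>1\<close> makes its value on this loop odd.\<close>

lemma moore_not_closed:
  assumes T: "T = moore_triangles" and f: "f \<in> alt K" and r: "f [0] + f [5] = r" "odd r"
    and edge: "\<And>x y. simplex_list K [x, y] \<Longrightarrow> f [y] - f [x] = f [x, y] - f [opp x, opp y]"
    and tri: "\<And>a b c. (a, b, c) \<in> triangles \<Longrightarrow> f [b, c] - f [a, c] + f [a, b] = 0"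
  shows False
proof -
  have triangles: "triangles = set (all_triangles moore_triangles)" using triangles_eq unfolding T .
  note mem = triangles all_triangles_def moore_triangles_def opp_def
  have "f [2, 6] - f [0, 6] + f [0, 2] = 0" "f [1, 8] - f [0, 8] + f [0, 1] = 0"
    "f [1, 3] - f [0, 3] + f [0, 1] = 0" "f [6, 8] - f [0, 8] + f [0, 6] = 0"
    "f [2, 9] - f [0, 9] + f [0, 2] = 0" "f [8, 9] - f [1, 9] + f [1, 8] = 0"
    "f [3, 9] - f [0, 9] + f [0, 3] = 0" "f [9, 2] - f [5, 2] + f [5, 9] = 0"
    "f [6, 2] - f [5, 2] + f [5, 6] = 0" "f [6, 3] - f [5, 3] + f [5, 6] = 0"
    "f [8, 9] - f [6, 9] + f [6, 8] = 0" "f [9, 3] - f [6, 3] + f [6, 9] = 0"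
    "f [1, 3] - f [5, 3] + f [5, 1] = 0" "f [9, 1] - f [5, 1] + f [5, 9] = 0"
    by (rule tri, simp add: mem)+
  moreover have "f [9, 2] = - f [2, 9]" "f [6, 2] = - f [2, 6]" "f [9, 3] = - f [3, 9]"
    "f [9, 1] = - f [1, 9]" "f [5, 1] = - f [1, 5]" "f [6, 0] = - f [0, 6]"
    by (rule swap_edge[OF f])+
  ultimately have "f [0, 1] + f [1, 5] + f [5, 6] + f [6, 0] = 0" by linarith
  moreover have "f [1] - f [0] = f [0, 1] - f [5, 6]"
    using edge[OF edge_simplexI[of 0 1 7 0 1]] by (simp add: mem)
  moreover have "f [5] - f [1] = f [1, 5] - f [6, 0]"
    using edge[OF edge_simplexI[of 5 1 3 1 5]] by (simp add: mem)
  \<comment> \<open>Adding the two edge relations walks from 0 to its image 5; the loop relation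
    doubles the result, so f [5] - f [0] and with it r is even.\<close>
  ultimately have "r = 2 * (f [0, 1] + f [1, 5] + f [0])" using r(1) by (simp add: algebra_simps)
  then show False using r(2) by simp
qed

lemma moore_not_null_2:
  assumes T: "T = moore_triangles"
  shows "\<not> null 2"
proof
  assume "null 2"
  then obtain F where F: "resolution F" "\<And>xs. 2 < length xs \<Longrightarrow> F xs = 0" unfolding null_def by blast
  show False
  proof (rule moore_not_closed[OF T resolutionD(1)[OF F(1)], of 1])
    show "F [0] + F [5] = 1" using resolution_equations(1)[OF F(1), of 0] by (simp add: opp_def)
    show "F [b, c] - F [a, c] + F [a, b] = 0" if "(a, b, c) \<in> triangles" for a b c
      using resolution_equations(3)[OF F(1) that] F(2) by simp
  qed (simp_all add: resolution_equations(2)[OF F(1)])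
qed

text \<open>For p = 2 the operator p - s is d, so the normal form is \<psi> - \<psi>
  \<open>opp\<close> on edges. Walking along 0, 1, 5 then gives even increments, against F [0] + F
  [5] = 1.\<close>

lemma not_null_mod_1:
  assumes "simplex_list K [0, 1]" "simplex_list K [1, 5]"
  shows "\<not> null_mod 1"
proof
  assume "null_mod 1"
  then obtain F \<psi> where F: "resolution F" and \<psi>: "\<psi> \<in> alt_n K (Suc 1)"
    and "\<And>xs. Suc 1 < length xs \<Longrightarrow> F xs = 0"
    and eq: "\<And>xs. length xs = Suc 1 \<Longrightarrow> F xs = lift_op (Suc 1) \<psi> xs"
    and "\<And>xs. res_op 2 opp (Suc 1) (coboundary K \<psi>) xs = 0"
    by (rule null_mod_normal_form) (rule that)
  have "F [x, y] = \<psi> [x, y] - \<psi> [opp x, opp y]" for x y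
    using eq[of "[x, y]"] by (simp add: lift_op_def norm_op_involution)
  moreover have "F [1] - F [0] = F [0, 1] - F [5, 6]" "F [5] - F [1] = F [1, 5] - F [6, 0]"
    using resolution_equations(2)[OF F assms(1)] resolution_equations(2)[OF F assms(2)]
    by (simp_all add: opp_def)
  moreover have "F [0] + F [5] = 1" using resolution_equations(1)[OF F, of 0] by (simp add: opp_def)
  moreover have "opp 0 = 5" "opp 1 = 6" "opp 5 = 0" "opp 6 = 1" by (simp_all add: opp_def)
  ultimately have "2 * (\<psi> [0, 1] - \<psi> [5, 6] + \<psi> [1, 5] - \<psi> [6, 0] + F [0]) = 1" by simp
  then have "even (1::int)" by (metis dvd_triv_left)
  then show False by simp
qed

text \<open>Half the coboundary of the edge term, w, is invariant, because d of the edge term is a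
  coboundary. So the degree 2 equation has two solutions: w itself, and 2 \<psi> with s \<psi> = w.
  The first shows a norm as top term, the second makes the class vanish modulo 2.\<close>

lemma moore_resolution:
  assumes T: "T = moore_triangles"
  obtains F \<psi> where "resolution F" "\<psi> \<in> alt_n K 3" "\<And>xs. 3 < length xs \<Longrightarrow> F xs = 0"
    "\<And>xs. length xs = 3 \<Longrightarrow> F xs = norm_op 2 opp \<psi> xs" "\<And>xs. coboundary K \<psi> xs = 0"
    "null_mod 2"
proof -
  let ?e = "edge_cochain moore_edges"
  have comp: "compatible moore_edges" by (rule compatibleI) (simp add: T moore_code)
  obtain w where w: "w \<in> alt_n K 3" "\<And>xs. coboundary K ?e xs = 2 * w xs"
    by (rule coboundary_edge_cochain_even[of moore_edges]) (simp_all add: T moore_code that)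
  have inv: "w (map opp xs) = w xs" for xs
  proof -
    have "coboundary K (diff_op opp ?e) xs = 0"
      unfolding diff_edge_cochain[OF comp] by (rule coboundary_coboundary[OF complex])
    then have "coboundary K ?e xs = coboundary K ?e (map opp xs)"
      using coboundary_res_op[of 0 ?e xs] by (simp add: res_op_def diff_op_def)
    then show ?thesis by (simp add: w(2))
  qed
  obtain \<psi> where \<psi>: "\<psi> \<in> alt_n K 3" "\<And>xs. norm_op 2 opp \<psi> xs = w xs"
    using exact_norm[OF w(1) _ inv] by auto
  have "resolution (glue moore_edges w)"
    by (rule glue_resolution[OF comp w(1)]) (simp add: norm_op_involution inv w(2))
  moreover have "resolution (glue moore_edges (\<lambda>xs. 2 * \<psi> xs))"
  proof (rule glue_resolution[OF comp alt_n_cmult[OF \<psi>(1)]])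
    show "norm_op 2 opp (\<lambda>xs. 2 * \<psi> xs) xs = coboundary K ?e xs" for xs
      using \<psi>(2)[of xs] by (simp add: norm_op_involution w(2))
  qed
  then have "null_mod 2"
    by (rule null_mod_if_dvd) (simp add: glue_simps(3)[OF alt_n_cmult[OF \<psi>(1)]])
  ultimately show ?thesis
    using that[of "glue moore_edges w" \<psi>] \<psi> glue_simps[OF w(1)] coboundary_alt_3_eq_0[OF \<psi>(1)] by simp
qed

end


subsection \<open>The Klein bottle as a double cover of the Klein bottle\<close>

text \<open>A Moebius band with boundary \<open>0, 1, 5, 6\<close> and core \<open>2, 3, 4\<close>, glued to its image under \<open>opp\<close>.\<close>

definition klein_triangles :: "(nat \<times> nat \<times> nat) list" where
  "klein_triangles = [(0,2,3), (0,3,4), (0,1,4), (1,4,2), (1,5,2), (5,2,3), (5,3,4), (5,6,4), (6,4,2), (6,0,2)]"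

text \<open>The degree 1 term of the resolution. Its coboundary has to be s of half the coboundary
  of \<open>klein_torsion\<close>, which is the third table identity in
  \<open>klein_code\<close>.\<close>

definition klein_edges :: "(nat \<times> nat) list" where
  "klein_edges = [(5,1), (5,2), (5,3), (5,4), (6,2), (6,4)]"

text \<open>Half of the coboundary of this cochain is the cohomology class of order two of the Klein bottle.\<close>

definition klein_torsion :: "(nat \<times> nat) list" where
  "klein_torsion = [(3,0), (2,0), (4,0), (4,1), (4,2), (6,2)]"

lemma klein_involution_complex: "involution_complex klein_triangles"
proof
  show "\<forall>(a, b, c)\<in>set klein_triangles. distinct [a, b, c, opp a, opp b, opp c]"
    by (simp add: klein_triangles_def opp_def)
  show "(\<Union>(a, b, c)\<in>set klein_triangles. {a, b, c, opp a, opp b, opp c}) = {..<10}"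
    unfolding lessThan_10 by (rule equalityI) (simp_all add: klein_triangles_def opp_def)
qed

lemma klein_code:
  "compatible_code klein_edges klein_triangles"
  "list_all (\<lambda>(a, b, c). even (boundary_value klein_torsion a b c)) (all_triangles klein_triangles)"
  "list_all (\<lambda>(a, b, c). boundary_value klein_torsion a b c + boundary_value klein_torsion (opp a) (opp b) (opp c)
     = 2 * boundary_value klein_edges a b c) (all_triangles klein_triangles)"
  by code_simp+

context involution_complex
begin

text \<open>Modulo two, the boundary of the Moebius band is the loop \<open>0, 1, 5, 6\<close>.\<close>

lemma klein_not_null_mod_2:
  assumes T: "T = klein_triangles"
  shows "\<not> null_mod 2"
proof
  assume "null_mod 2"
  then obtain F \<psi> where F: "resolution F" and \<psi>: "\<psi> \<in> alt_n K (Suc 2)"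
    and "\<And>xs. Suc 2 < length xs \<Longrightarrow> F xs = 0"
    and eq: "\<And>xs. length xs = Suc 2 \<Longrightarrow> F xs = lift_op (Suc 2) \<psi> xs"
    and "\<And>xs. res_op 2 opp (Suc 2) (coboundary K \<psi>) xs = 0"
    by (rule null_mod_normal_form) (rule that)
  define N where "N a b c = norm_op 2 opp \<psi> [a, b, c]" for a b c
  have tri: "F [b, c] - F [a, c] + F [a, b] = 2 * N a b c" if "(a, b, c) \<in> triangles" for a b c
    using resolution_equations(3)[OF F that] eq[of "[a, b, c]"] eq[of "[opp a, opp b, opp c]"]
    by (simp add: lift_op_def N_def norm_op_involution)
  have triangles: "triangles = set (all_triangles klein_triangles)" using triangles_eq unfolding T .
  note mem = triangles all_triangles_def klein_triangles_def opp_def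
  have "F [2, 3] - F [0, 3] + F [0, 2] = 2 * N 0 2 3" "F [3, 4] - F [0, 4] + F [0, 3] = 2 * N 0 3 4"
    "F [1, 4] - F [0, 4] + F [0, 1] = 2 * N 0 1 4" "F [4, 2] - F [1, 2] + F [1, 4] = 2 * N 1 4 2"
    "F [5, 2] - F [1, 2] + F [1, 5] = 2 * N 1 5 2" "F [2, 3] - F [5, 3] + F [5, 2] = 2 * N 5 2 3"
    "F [3, 4] - F [5, 4] + F [5, 3] = 2 * N 5 3 4" "F [6, 4] - F [5, 4] + F [5, 6] = 2 * N 5 6 4"
    "F [4, 2] - F [6, 2] + F [6, 4] = 2 * N 6 4 2" "F [0, 2] - F [6, 2] + F [6, 0] = 2 * N 6 0 2"
    by (rule tri, simp add: mem)+
  \<comment> \<open>The ten relations are combined with signs so that the inner edges cancel, except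
    those of the core 2, 3, 4, which occur twice.\<close>
  then have "F [0, 1] + F [1, 5] + F [5, 6] + F [6, 0] = 2 * (F [2, 3] + F [3, 4] + F [4, 2]
      - N 0 2 3 - N 0 3 4 + N 0 1 4 - N 1 4 2 + N 1 5 2 - N 5 2 3 - N 5 3 4 + N 5 6 4 - N 6 4 2 + N 6 0 2)"
    by (simp add: algebra_simps)
  moreover have "F [1] - F [0] = F [0, 1] - F [5, 6]"
    using resolution_equations(2)[OF F edge_simplexI[of 0 1 4 0 1]] by (simp add: mem)
  moreover have "F [5] - F [1] = F [1, 5] - F [6, 0]"
    using resolution_equations(2)[OF F edge_simplexI[of 1 5 2 1 5]] by (simp add: mem)
  moreover have "F [0] + F [5] = 1" using resolution_equations(1)[OF F, of 0] by (simp add: opp_def)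
  ultimately have "2 * (F [0, 1] + F [1, 5] + F [0] - (F [2, 3] + F [3, 4] + F [4, 2]
      - N 0 2 3 - N 0 3 4 + N 0 1 4 - N 1 4 2 + N 1 5 2 - N 5 2 3 - N 5 3 4 + N 5 6 4 - N 6 4 2 + N 6 0 2)) = 1"
    by (simp add: algebra_simps)
  then have "even (1::int)" by (metis dvd_triv_left)
  then show False by simp
qed

text \<open>Half the coboundary of the torsion cochain solves the degree 2 equation and serves as
  top term; so twice the top term is a coboundary.\<close>

lemma klein_resolution:
  assumes T: "T = klein_triangles"
  obtains F \<omega> where "resolution F" "\<omega> \<in> alt_n K 2" "\<And>xs. 3 < length xs \<Longrightarrow> F xs = 0"
    "\<And>xs. length xs = 3 \<Longrightarrow> 2 * F xs = coboundary K \<omega> xs"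
proof -
  let ?e = "edge_cochain klein_edges" and ?\<omega> = "edge_cochain klein_torsion"
  have comp: "compatible klein_edges" by (rule compatibleI) (simp add: T klein_code)
  obtain h where h: "h \<in> alt_n K 3" "\<And>xs. coboundary K ?\<omega> xs = 2 * h xs"
    by (rule coboundary_edge_cochain_even[of klein_torsion]) (simp_all add: T klein_code that)
  let ?d = "\<lambda>xs. norm_op 2 opp h xs - coboundary K ?e xs"
  have "norm_op 2 opp h \<in> alt_n K 3" using res_op_alt_n[OF h(1), of 1] by (simp add: res_op_def)
  then have "?d \<in> alt_n K 3" by (rule alt_n_diff) (rule coboundary_edge_cochain_alt_n)
  then have "?d xs = 0" for xs
  proof (rule alt_3_eq_0)
    fix a b c assume abc: "(a, b, c) \<in> triangles"
    have mem: "(a, b, c) \<in> set (all_triangles klein_triangles)" using abc triangles_eq unfolding T by simp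
    have "boundary_value klein_torsion a b c + boundary_value klein_torsion (opp a) (opp b) (opp c)
        = 2 * boundary_value klein_edges a b c"
      using bspec[OF klein_code(3)[unfolded list_all_iff] mem] by (simp only: prod.case)
    then have "coboundary K ?\<omega> [a, b, c] + coboundary K ?\<omega> [opp a, opp b, opp c] = 2 * coboundary K ?e [a, b, c]"
      by (simp only: edge_cochain_coboundary[OF abc] edge_cochain_coboundary[OF triangles_opp[OF abc]] boundary_value_def)
    then show "?d [a, b, c] = 0" by (simp add: h(2) norm_op_involution)
  qed
  then have "resolution (glue klein_edges h)"
    by (intro glue_resolution[OF comp h(1)]) simp
  then show ?thesis
    using that[of "glue klein_edges h" ?\<omega>] edge_cochain_alt_n glue_simps[OF h(1)] h(2) by simp
qed

end

subsection \<open>Joins of the examples\<close>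

context Zp_pair
begin

text \<open>The top product is (\<psi>(x) + \<psi>(t x)) G(y). Subtracting the invariant \<psi>(x)
  G(y) + \<psi>(t x) G(u y) leaves \<psi>(t x) (G(y) - G(u y)). The degree 1 part of G has
  coboundary G + G u and \<omega> has coboundary 2 G, so their difference \<eta> has coboundary G u
  - G; as \<psi> is closed, the remainder is a coboundary.\<close>

lemma null_join_torsion:
  assumes p: "p = 2"
    and F: "A.resolution F" "\<And>xs. 3 < length xs \<Longrightarrow> F xs = 0"
    and \<psi>: "\<psi> \<in> alt_n K 3" "\<And>xs. coboundary K \<psi> xs = 0"
    and F3: "\<And>xs. length xs = 3 \<Longrightarrow> F xs = norm_op 2 t \<psi> xs"
    and G: "B.resolution G" "\<And>ys. 3 < length ys \<Longrightarrow> G ys = 0"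
    and \<omega>: "\<omega> \<in> alt_n L 2"
    and G3: "\<And>ys. length ys = 3 \<Longrightarrow> 2 * G ys = coboundary L \<omega> ys"
  shows "J.null 5"
proof -
  let ?J = "complex_join K L" and ?v = "map_sum t u" and ?\<theta> = "join_extend (join_res F G)"
  have \<theta>: "J.resolution ?\<theta>" by (rule join_resolution[OF F(1) G(1)])
  define \<eta> where "\<eta> ys = part 2 G ys - \<omega> ys" for ys
  have \<eta>: "\<eta> \<in> alt_n L 2"
    unfolding \<eta>_def by (intro alt_n_diff part_alt_n[OF B.resolutionD(1)[OF G(1)]] \<omega>)
  define X where "X xs ys = \<psi> (map t xs) * \<eta> ys" for xs ys
  have "X \<in> bialt K L"
    unfolding X_def bialt_def
    by (auto intro!: alt_mult_const alt_cmult alt_translate1 alt_n_alt[OF \<psi>(1)] alt_n_alt[OF \<eta>])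
  then have Xa: "join_extend X \<in> alt ?J" by (rule join_extend_alt)
  have X0: "X xs ys = 0" if "length xs + length ys \<noteq> 5" for xs ys
    using that alt_n_outside[OF \<psi>(1), of "map t xs"] alt_n_outside[OF \<eta>, of ys]
    by (cases "length xs = 3") (auto simp: X_def)
  have "X (lefts zs) (rights zs) = 0" if "length zs \<noteq> 5" for zs
    using that by (intro X0) (simp only: length_lefts_rights not_False_eq_True)
  then have Xn: "join_extend X \<in> alt_n ?J 5"
    using Xa by (simp add: alt_n_def join_extend_def)
  have "coboundary K (\<lambda>xs. X xs ys) xs = 0" for xs ys
    unfolding X_def by (simp add: coboundary_mult_const A.coboundary_translate \<psi>(2))
  moreover have "coboundary L (X xs) ys = \<psi> (map t xs) * coboundary L \<eta> ys" for xs ys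
    unfolding X_def by (rule coboundary_cmult)
  ultimately have cX: "join_restrict (coboundary ?J (join_extend X)) xs ys =
      (- 1) ^ length xs * (\<psi> (map t xs) * coboundary L \<eta> ys)" for xs ys
    by (simp add: join_restrict_coboundary[OF Xa])
  define W where "W xs ys = \<psi> xs * part 3 G ys + \<psi> (map t xs) * part 3 G (map u ys)" for xs ys
  have tt: "map t (map t xs) = xs" "map u (map u ys) = ys" for xs ys
    using A.t_period B.t_period
    by (simp_all add: p numeral_2_eq_2 comp_def[symmetric] fun_eq_iff del: map_map)
      (simp_all add: comp_def fun_eq_iff map_idI)
  have key: "join_res F G xs ys = W xs ys + join_restrict (coboundary ?J (join_extend X)) xs ys"
    if l: "length xs + length ys = 6" for xs ys
  proof (cases "length xs = 3")
    case True
    then have ly: "length ys = 3" using l by simp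
    have r2: "{..<2::nat} = {0, 1}" by auto
    \<comment> \<open>For p = 2 the triangle has the single entry k = 1, l = 0.\<close>
    have "join_res F G xs ys = F (map t xs) * G ys"
      unfolding join_res_def using True ly by (simp add: p r2)
    also have "F (map t xs) = \<psi> (map t xs) + \<psi> xs"
      using True F3[of "map t xs"] by (simp add: norm_op_involution tt del: map_map)
    finally have z: "join_res F G xs ys = (\<psi> (map t xs) + \<psi> xs) * G ys" .
    have "coboundary L (part 2 G) ys = G ys + G (map u ys)"
      using B.resolutionD(3)[OF G(1), of ys] ly
      by (simp add: coboundary_part res_op_def p norm_op_involution)
    then have c\<eta>: "coboundary L \<eta> ys = G (map u ys) - G ys"
      using G3[OF ly] unfolding \<eta>_def by (simp add: coboundary_diff)
    then show ?thesis
      unfolding z cX c\<eta> using True ly by (simp add: W_def part_def algebra_simps)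
  next
    case False
    then have "\<psi> xs = 0" "\<psi> (map t xs) = 0" using alt_n_outside[OF \<psi>(1)] by simp_all
    moreover have "join_res F G xs ys = 0"
      using False l by (intro join_res_eq_0[OF F(2) G(2)]) auto
    ultimately show ?thesis by (simp add: W_def cX)
  qed
  have WW: "W (map t xs) (map u ys) = W xs ys" for xs ys
    by (simp add: W_def tt del: map_map)
  have "res_op p ?v (Suc 5) ?\<theta> zs = coboundary ?J (res_op p ?v (Suc 5) (join_extend X)) zs"
    if lz: "length zs = Suc 5" for zs
  proof (rule join_restrict_inject[OF J.res_op_alt[OF J.resolutionD(1)[OF \<theta>]]
        coboundary_alt[OF J.res_op_alt[OF Xa]]])
    fix xs :: "'a list" and ys :: "'b list" assume "length xs + length ys = length zs"
    then have l: "length xs + length ys = 6" using lz by simp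
    have "coboundary ?J (res_op p ?v (Suc 5) (join_extend X)) =
        res_op p ?v (Suc 5) (coboundary ?J (join_extend X))"
      by (rule ext) (rule J.coboundary_res_op)
    then show "join_restrict (res_op p ?v (Suc 5) ?\<theta>) xs ys =
        join_restrict (coboundary ?J (res_op p ?v (Suc 5) (join_extend X))) xs ys"
      using key[OF l] key[of "map t xs" "map u ys"] l WW[of xs ys]
      by (simp add: res_op_def join_restrict_diff_op)
  qed
  moreover have "join_extend X [] = 0" using alt_n_outside[OF Xn, of "[]"] by simp
  ultimately show ?thesis
    using J.smith_class_null_iff[OF \<theta>] J.smith_class_eq_one_iff_null Xn by blast
qed

end

text \<open>For the two points \<open>w, w'\<close> of \<open>L\<close>, the difference of the slant products of a resolution of the
  join with \<open>w\<close> and \<open>w'\<close> is a resolution of an odd constant on \<open>K\<close>.\<close>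

lemma (in Zp_pair) suspension_slant:
  assumes p: "p = 2" and L: "{w} \<in> L" "u w = w'" "u w' = w"
    and \<theta>: "J.resolution \<theta>" and top: "\<And>zs. n < length zs \<Longrightarrow> \<theta> zs = 0"
  defines "f \<equiv> \<lambda>xs. join_restrict \<theta> xs [w] - join_restrict \<theta> xs [w']"
  shows "f \<in> alt K" "odd (f [])"
    "\<And>xs. n \<le> length xs \<Longrightarrow> f xs = 0"
    "\<And>xs. coboundary K f xs = (if odd (length xs) then f xs + f (map t xs) else f xs - f (map t xs))
       \<or> \<not> simplex_list K xs"
proof -
  let ?J = "complex_join K L" and ?R = "join_restrict \<theta>"
  have R: "?R \<in> bialt K L" by (rule join_restrict_bialt[OF J.resolutionD(1)[OF \<theta>]])
  show "f \<in> alt K" unfolding f_def by (intro alt_diff bialtD(1)[OF R])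
  have w': "{w'} \<in> L" using B.t_image_in[of "{w}"] L by simp
  \<comment> \<open>The term with the empty list does not depend on the point and cancels in the
    difference; the action exchanges the two points, which swaps the signs between s and d.\<close>
  have slant: "coboundary K (\<lambda>xs. ?R xs [v]) xs + (- 1) ^ length xs * ?R xs [] =
      (if odd (length xs) then ?R xs [v] - ?R (map t xs) [u v] else ?R xs [v] + ?R (map t xs) [u v])"
    if "{v} \<in> L" for xs v
  proof -
    have "coboundary L (?R xs) [v] = ?R xs []"
      using that by (simp add: coboundary_eq simplex_list_def list_cob_Cons)
    moreover have "join_restrict (coboundary ?J \<theta>) xs [v] =
        join_restrict (res_op p (map_sum t u) (Suc (length xs)) \<theta>) xs [v]"
      using J.resolutionD(3)[OF \<theta>, of "map Inl xs @ [Inr v]"] by (simp add: join_restrict_def)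
    moreover have "join_restrict (norm_op p (map_sum t u) \<theta>) xs [v] = ?R xs [v] + ?R (map t xs) [u v]"
      unfolding p by (simp add: join_restrict_def norm_op_involution comp_def)
    ultimately show ?thesis
      by (simp add: join_restrict_coboundary[OF J.resolutionD(1)[OF \<theta>]] res_op_def join_restrict_diff_op)
  qed
  have "coboundary K g [] = 0" for g :: "'a list \<Rightarrow> int" by (simp add: coboundary_eq)
  then have "?R [] [w] + ?R [] [w'] = 1"
    using slant[OF L(1), of "[]"] J.resolutionD(2)[OF \<theta>] L(2) by (simp add: join_restrict_def)
  then have "f [] = 1 - 2 * ?R [] [w']" by (simp add: f_def)
  then show "odd (f [])" by simp
  show "f xs = 0" if "n \<le> length xs" for xs
    using that top[of "map Inl xs @ [Inr w]"] top[of "map Inl xs @ [Inr w']"]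
    by (simp add: f_def join_restrict_def)
  show "coboundary K f xs = (if odd (length xs) then f xs + f (map t xs) else f xs - f (map t xs))
      \<or> \<not> simplex_list K xs" for xs
  proof -
    have "coboundary K f xs = coboundary K (\<lambda>xs. ?R xs [w]) xs - coboundary K (\<lambda>xs. ?R xs [w']) xs"
      unfolding f_def by (rule coboundary_diff)
    then show ?thesis
      using slant[OF L(1), of xs] slant[OF w', of xs] L(2,3)
      by (simp add: f_def split: if_splits)
  qed
qed

section \<open>The two-point complex and the indices of the examples\<close>

definition two_points :: "nat set set" where "two_points = {{}, {0}, {1}}"

lemma Zp_complex_two_points: "Zp_complex 2 two_points (transpose 0 1)"
proof -
  have pow: "(transpose 0 1 :: nat \<Rightarrow> nat) ^^ k = (if even k then id else transpose 0 1)" for k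
    by (induction k) (auto simp: fun_eq_iff)
  have subs: "\<tau> \<subseteq> {v} \<longleftrightarrow> \<tau> = {} \<or> \<tau> = {v}" for \<tau> and v :: nat by auto
  have U: "\<Union>two_points = {0, 1}" by (auto simp: two_points_def)
  have "abstract_complex two_points"
    by (auto simp: abstract_complex_def two_points_def subs)
  moreover have "transpose 0 1 permutes \<Union>two_points"
    unfolding U by (rule permutes_swap_id) auto
  moreover have "(`) (transpose 0 1) ` two_points = two_points"
    by (auto simp: two_points_def)
  moreover have "(transpose 0 1 :: nat \<Rightarrow> nat) ^^ 2 = id" by (subst pow) simp
  moreover have "((transpose 0 1) ^^ k) ` \<sigma> \<noteq> \<sigma>"
    if "\<sigma> \<in> two_points" "\<sigma> \<noteq> {}" "\<not> 2 dvd k" for \<sigma> k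
    using that unfolding pow by (auto simp: two_points_def)
  ultimately show ?thesis unfolding Zp_complex_def by blast
qed

lemma two_points_indices:
  "smith_index 2 two_points (transpose 0 1) = 1" "smith_index_p 2 two_points (transpose 0 1) = 1"
proof -
  interpret Zp_action 2 two_points "transpose 0 1"
    by (rule Zp_action.intro[OF Zp_complex_two_points]) simp
  obtain F where F: "resolution F" using resolution_exists by blast
  have "F xs = 0" if "1 < length xs" for xs
  proof -
    have "card \<sigma> \<le> 1" if "\<sigma> \<in> two_points" for \<sigma> using that by (auto simp: two_points_def)
    then have "\<not> simplex_list two_points xs"
      using that distinct_card[of xs] unfolding simplex_list_def by fastforce
    then show ?thesis by (rule alt_outside[OF resolutionD(1)[OF F]])
  qed
  then have n1: "null 1" using F unfolding null_def by blast
  have nm0: "\<not> null_mod 0" by (rule not_null_mod_0[of 0]) (simp_all add: two_points_def)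
  then have n0: "\<not> null 0" using null_mod_if_null by blast
  show "smith_index 2 two_points (transpose 0 1) = 1"
    using smith_index_le_iff[of 1] smith_index_le_iff[of 0] n1 n0 by simp
  show "smith_index_p 2 two_points (transpose 0 1) = 1"
    using smith_index_p_le_iff[of 1] smith_index_p_le_iff[of 0] null_mod_if_null[OF n1] nm0 by simp
qed

lemma (in involution_complex) index_eq_3:
  "\<not> null 2 \<Longrightarrow> smith_index 2 K opp = 3"
  using smith_index_le_iff[of 3] smith_index_le_iff[of 2] null_3 by simp

lemma (in involution_complex) index_p_eqI:
  "null_mod (Suc n) \<Longrightarrow> \<not> null_mod n \<Longrightarrow> smith_index_p 2 K opp = Suc n"
  using smith_index_p_le_iff[of "Suc n"] smith_index_p_le_iff[of n] by simp

lemma (in involution_complex) moore_indices: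
  assumes T: "T = moore_triangles"
  shows "smith_index 2 K opp = 3" "smith_index_p 2 K opp = 2"
proof -
  show "smith_index 2 K opp = 3" by (rule index_eq_3[OF moore_not_null_2[OF T]])
  have triangles: "triangles = set (all_triangles moore_triangles)" using triangles_eq unfolding T .
  note mem = triangles all_triangles_def moore_triangles_def opp_def
  have "\<not> null_mod 1"
    by (rule not_null_mod_1[OF edge_simplexI[of 0 1 7] edge_simplexI[of 5 1 3]]) (simp_all add: mem)
  moreover have "null_mod 2" by (rule moore_resolution[OF T])
  ultimately show "smith_index_p 2 K opp = 2"
    using index_p_eqI[of 1] by (simp add: numeral_2_eq_2)
qed

lemma (in involution_complex) klein_indices:
  assumes T: "T = klein_triangles"
  shows "smith_index 2 K opp = 3" "smith_index_p 2 K opp = 3"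
proof -
  have nm: "\<not> null_mod 2" by (rule klein_not_null_mod_2[OF T])
  then show "smith_index 2 K opp = 3" using index_eq_3 null_mod_if_null by blast
  show "smith_index_p 2 K opp = 3"
    using index_p_eqI[OF _ nm] null_mod_if_null[OF null_3] by (simp add: numeral_3_eq_3 numeral_2_eq_2)
qed

text \<open>A resolution of the join ending at length 3 would give, by the slant product, a function
  on \<open>K\<close> with odd augmentation that vanishes on triangles; the loop argument of
  \<open>moore_not_closed\<close> excludes this for every odd constant.\<close>

lemma moore_suspension_index:
  "smith_index 2 (complex_join (triangle_complex moore_triangles) two_points) (map_sum opp (transpose 0 1)) = 4"
proof -
  have C: "involution_complex moore_triangles" by (rule moore_involution_complex)
  have A: "Zp_action 2 (triangle_complex moore_triangles) opp"
    using involution_complex.Zp_complex_K[OF C] by (simp add: Zp_action_def)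
  have B: "Zp_action 2 two_points (transpose 0 1)"
    by (rule Zp_action.intro[OF Zp_complex_two_points]) simp
  have P: "Zp_pair 2 (triangle_complex moore_triangles) opp two_points (transpose 0 1)"
    using A B by (rule Zp_pair.intro)
  let ?K = "triangle_complex moore_triangles"
  let ?J = "complex_join ?K two_points" and ?v = "map_sum opp (transpose 0 1)"
  have J: "Zp_action 2 ?J ?v" using Zp_pair.Zp_complex_join[OF P] by (simp add: Zp_action_def)
  have "\<not> Zp_action.null 2 ?J ?v 3"
  proof
    assume "Zp_action.null 2 ?J ?v 3"
    then obtain \<theta> where \<theta>: "Zp_action.resolution 2 ?J ?v \<theta>" and top: "\<And>zs. 3 < length zs \<Longrightarrow> \<theta> zs = 0"
      unfolding Zp_action.null_def[OF J] by blast
    define f where "f xs = join_restrict \<theta> xs [0] - join_restrict \<theta> xs [1]" for xs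
    have f: "f \<in> alt ?K" "odd (f [])" "\<And>xs. 3 \<le> length xs \<Longrightarrow> f xs = 0"
      "\<And>xs. coboundary ?K f xs = (if odd (length xs) then f xs + f (map opp xs) else f xs - f (map opp xs))
        \<or> \<not> simplex_list ?K xs"
      using Zp_pair.suspension_slant[OF P refl, of 0 1 \<theta> 3] \<theta> top
      unfolding f_def by (simp_all add: two_points_def)
    have "{0} \<in> ?K"
      by (rule involution_complex.K_I[OF C involution_complex.triangles_I(1)[OF C, of 0 4 7]])
        (simp_all add: moore_triangles_def)
    then have s0: "simplex_list ?K [0]" by (simp add: simplex_list_def)
    show False
    proof (rule involution_complex.moore_not_closed[OF C refl f(1) _ f(2)])
      show "f [0] + f [5] = f []"
        using f(4)[of "[0]"] s0 by (simp add: coboundary_eq list_cob_Cons opp_def)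
      show "f [y] - f [x] = f [x, y] - f [opp x, opp y]" if "simplex_list ?K [x, y]" for x y
        using f(4)[of "[x, y]"] that by (simp add: coboundary_eq list_cob_Cons)
      show "f [b, c] - f [a, c] + f [a, b] = 0" if "(a, b, c) \<in> involution_complex.triangles moore_triangles" for a b c
        using f(4)[of "[a, b, c]"] f(3)[of "[a, b, c]"] f(3)[of "[opp a, opp b, opp c]"]
          involution_complex.triangle_simplex[OF C that]
        by (simp add: coboundary_eq list_cob_Cons)
    qed
  qed
  then have "4 \<le> smith_index 2 ?J ?v"
    using Zp_action.smith_index_le_iff[OF J, of 3] by simp
  moreover have "smith_index 2 ?J ?v \<le> 3 + 1"
    using Zp_pair.smith_index_join_le[OF P]
    unfolding two_points_indices involution_complex.moore_indices[OF C refl] .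
  ultimately show ?thesis by simp
qed

text \<open>Only the values 5 and 6 are possible by the lower bound modulo 2, and the class of order
  two on the Klein bottle rules out 6.\<close>

lemma moore_klein_index:
  "smith_index 2 (complex_join (triangle_complex moore_triangles) (triangle_complex klein_triangles)) (map_sum opp opp) = 5"
proof -
  have C: "involution_complex moore_triangles" by (rule moore_involution_complex)
  have D: "involution_complex klein_triangles" by (rule klein_involution_complex)
  let ?K = "triangle_complex moore_triangles" and ?L = "triangle_complex klein_triangles"
  have A: "Zp_action 2 ?K opp" using involution_complex.Zp_complex_K[OF C] by (simp add: Zp_action_def)
  have B: "Zp_action 2 ?L opp" using involution_complex.Zp_complex_K[OF D] by (simp add: Zp_action_def)
  have P: "Zp_pair 2 ?K opp ?L opp" using A B by (rule Zp_pair.intro)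
  let ?J = "complex_join ?K ?L" and ?v = "map_sum opp opp"
  have J: "Zp_action 2 ?J ?v" using Zp_pair.Zp_complex_join[OF P] by (simp add: Zp_action_def)
  obtain F \<psi> where F: "Zp_action.resolution 2 ?K opp F" "\<psi> \<in> alt_n ?K 3" "\<And>xs. 3 < length xs \<Longrightarrow> F xs = 0"
    "\<And>xs. length xs = 3 \<Longrightarrow> F xs = norm_op 2 opp \<psi> xs" "\<And>xs. coboundary ?K \<psi> xs = 0"
    "Zp_action.null_mod 2 ?K opp 2"
    by (rule involution_complex.moore_resolution[OF C refl]) (rule that)
  obtain G \<omega> where G: "Zp_action.resolution 2 ?L opp G" "\<omega> \<in> alt_n ?L 2" "\<And>ys. 3 < length ys \<Longrightarrow> G ys = 0"
    "\<And>ys. length ys = 3 \<Longrightarrow> 2 * G ys = coboundary ?L \<omega> ys"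
    by (rule involution_complex.klein_resolution[OF D refl]) (rule that)
  have "Zp_action.null 2 ?J ?v 5"
    by (rule Zp_pair.null_join_torsion[OF P refl F(1,3,2,5,4) G(1,3,2,4)])
  then have "smith_index 2 ?J ?v \<le> 5" using Zp_action.smith_index_le_iff[OF J] by blast
  then show ?thesis
    using Zp_pair.smith_index_join_cases_2[OF P refl] involution_complex.moore_indices[OF C refl]
      involution_complex.klein_indices[OF D refl] by simp
qed

text \<open>Equations with I - 1 are written with + 1 on the other side, because subtraction of
  naturals stops at 0. The two existence claims of (3) concern p = 2 and complexes of their own; the
  examples have vertices.\<close>

theorem theorem2:
  fixes p :: nat
    and K :: "'a set set" and t :: "'a \<Rightarrow> 'a"
    and L :: "'b set set" and u :: "'b \<Rightarrow> 'b"
  assumes "prime p" and "Zp_complex p K t" and "Zp_complex p L u"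
  shows
    "(smith_index_p p K t + 1 = smith_index p K t \<and>
      smith_index_p p L u + 1 = smith_index p L u \<longrightarrow>
        smith_index p (complex_join K L) (map_sum t u) + 1 \<le> smith_index p K t + smith_index p L u)
   \<and> (p = 2 \<and> smith_index_p p K t = smith_index p K t \<and>
      smith_index_p p L u = smith_index p L u \<longrightarrow>
        smith_index_p p (complex_join K L) (map_sum t u) = smith_index p (complex_join K L) (map_sum t u) \<and>
        smith_index p (complex_join K L) (map_sum t u) = smith_index p K t + smith_index p L u)
   \<and> (p = 2 \<and> smith_index_p p K t + 1 = smith_index p K t \<and>
      smith_index_p p L u = smith_index p L u \<longrightarrow>
        smith_index p (complex_join K L) (map_sum t u) = smith_index p K t + smith_index p L u \<or>
        smith_index p (complex_join K L) (map_sum t u) + 1 = smith_index p K t + smith_index p L u)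
   \<and> (\<exists>(K' :: nat set set) t' (L' :: nat set set) u'.
        Zp_complex 2 K' t' \<and> Zp_complex 2 L' u' \<and> K' \<noteq> {{}} \<and> L' \<noteq> {{}} \<and>
        smith_index_p 2 K' t' + 1 = smith_index 2 K' t' \<and>
        smith_index_p 2 L' u' = smith_index 2 L' u' \<and>
        smith_index 2 (complex_join K' L') (map_sum t' u') = smith_index 2 K' t' + smith_index 2 L' u')
   \<and> (\<exists>(K' :: nat set set) t' (L' :: nat set set) u'.
        Zp_complex 2 K' t' \<and> Zp_complex 2 L' u' \<and> K' \<noteq> {{}} \<and> L' \<noteq> {{}} \<and>
        smith_index_p 2 K' t' + 1 = smith_index 2 K' t' \<and>
        smith_index_p 2 L' u' = smith_index 2 L' u' \<and>
        smith_index 2 (complex_join K' L') (map_sum t' u') + 1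
          = smith_index 2 K' t' + smith_index 2 L' u')
   \<and> (p > 2 \<and> smith_index_p p K t = smith_index p K t \<and>
      smith_index_p p L u = smith_index p L u \<and>
      smith_index p K t - 1 > 0 \<and> smith_index p L u - 1 > 0 \<and>
      ((even (smith_index p K t - 1) \<and>
        (\<exists>c. smith_dual p K t (smith_index p K t - 1) c \<and> boundary_equivariant_mod p K t c)) \<or>
       (even (smith_index p L u - 1) \<and>
        (\<exists>c. smith_dual p L u (smith_index p L u - 1) c \<and> boundary_equivariant_mod p L u c)))
      \<longrightarrow>
        smith_index_p p (complex_join K L) (map_sum t u) = smith_index p (complex_join K L) (map_sum t u) \<and>
        smith_index p (complex_join K L) (map_sum t u) = smith_index p K t + smith_index p L u)"
proof -
  note prime = assms(1) and K = assms(2) and L = assms(3)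
  have A: "Zp_action p K t" and B: "Zp_action p L u"
    using prime_gt_0_nat[OF prime] Zp_action.intro[OF K] Zp_action.intro[OF L] by blast+
  have P: "Zp_pair p K t L u" using A B by (rule Zp_pair.intro)
  let ?M = "triangle_complex moore_triangles" and ?B = "triangle_complex klein_triangles"
  have ZM: "Zp_complex 2 ?M opp" and ZB: "Zp_complex 2 ?B opp"
    using involution_complex.Zp_complex_K moore_involution_complex klein_involution_complex by blast+
  have "0 \<in> \<Union>?M" "0 \<in> \<Union>?B" "0 \<in> \<Union>two_points"
    unfolding involution_complex.vertices'[OF moore_involution_complex]
      involution_complex.vertices'[OF klein_involution_complex] by (simp_all add: two_points_def)
  then have nonempty: "?M \<noteq> {{}}" "?B \<noteq> {{}}" "two_points \<noteq> {{}}" by auto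
  note iM = involution_complex.moore_indices[OF moore_involution_complex refl]
  note iB = involution_complex.klein_indices[OF klein_involution_complex refl]
  show ?thesis
  proof (intro conjI impI)
    show "smith_index p (complex_join K L) (map_sum t u) + 1 \<le> smith_index p K t + smith_index p L u"
      if "smith_index_p p K t + 1 = smith_index p K t \<and> smith_index_p p L u + 1 = smith_index p L u"
      using Zp_pair.smith_index_join_less[OF P] that by blast
  next
    assume a: "p = 2 \<and> smith_index_p p K t = smith_index p K t \<and> smith_index_p p L u = smith_index p L u"
    show "smith_index_p p (complex_join K L) (map_sum t u) = smith_index p (complex_join K L) (map_sum t u)"
      "smith_index p (complex_join K L) (map_sum t u) = smith_index p K t + smith_index p L u"
      using Zp_pair.smith_index_join_eq_2[OF P] a by blast+
  next
    assume "p = 2 \<and> smith_index_p p K t + 1 = smith_index p K t \<and> smith_index_p p L u = smith_index p L u"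
    then show "smith_index p (complex_join K L) (map_sum t u) = smith_index p K t + smith_index p L u \<or>
        smith_index p (complex_join K L) (map_sum t u) + 1 = smith_index p K t + smith_index p L u"
      using Zp_pair.smith_index_join_cases_2[OF P] by blast
  next
    show "\<exists>(K' :: nat set set) t' (L' :: nat set set) u'.
        Zp_complex 2 K' t' \<and> Zp_complex 2 L' u' \<and> K' \<noteq> {{}} \<and> L' \<noteq> {{}} \<and>
        smith_index_p 2 K' t' + 1 = smith_index 2 K' t' \<and>
        smith_index_p 2 L' u' = smith_index 2 L' u' \<and>
        smith_index 2 (complex_join K' L') (map_sum t' u') = smith_index 2 K' t' + smith_index 2 L' u'"
      by (rule exI[of _ ?M], rule exI[of _ opp], rule exI[of _ two_points], rule exI[of _ "transpose 0 1"])
        (simp only: ZM Zp_complex_two_points nonempty iM two_points_indices moore_suspension_index, simp)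
  next
    show "\<exists>(K' :: nat set set) t' (L' :: nat set set) u'.
        Zp_complex 2 K' t' \<and> Zp_complex 2 L' u' \<and> K' \<noteq> {{}} \<and> L' \<noteq> {{}} \<and>
        smith_index_p 2 K' t' + 1 = smith_index 2 K' t' \<and>
        smith_index_p 2 L' u' = smith_index 2 L' u' \<and>
        smith_index 2 (complex_join K' L') (map_sum t' u') + 1
          = smith_index 2 K' t' + smith_index 2 L' u'"
      by (rule exI[of _ ?M], rule exI[of _ opp], rule exI[of _ ?B], rule exI[of _ opp])
        (simp only: ZM ZB nonempty iM iB moore_klein_index, simp)
  next
    assume a: "p > 2 \<and> smith_index_p p K t = smith_index p K t \<and>
      smith_index_p p L u = smith_index p L u \<and>
      smith_index p K t - 1 > 0 \<and> smith_index p L u - 1 > 0 \<and>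
      ((even (smith_index p K t - 1) \<and>
        (\<exists>c. smith_dual p K t (smith_index p K t - 1) c \<and> boundary_equivariant_mod p K t c)) \<or>
       (even (smith_index p L u - 1) \<and>
        (\<exists>c. smith_dual p L u (smith_index p L u - 1) c \<and> boundary_equivariant_mod p L u c)))"
    then have e: "smith_index_p p K t = smith_index p K t" "smith_index_p p L u = smith_index p L u"
      and pos: "0 < smith_index p K t - 1" "0 < smith_index p L u - 1"
      by simp_all
    from a have dual: "(even (smith_index p K t - 1) \<and>
        (\<exists>c. smith_dual p K t (smith_index p K t - 1) c \<and> boundary_equivariant_mod p K t c)) \<or>
       (even (smith_index p L u - 1) \<and>
        (\<exists>c. smith_dual p L u (smith_index p L u - 1) c \<and> boundary_equivariant_mod p L u c))"
      by (elim conjE)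
    note r = Zp_pair.smith_index_join_eq_odd[OF P prime e(1) pos(1) e(2) pos(2) dual]
    show "smith_index_p p (complex_join K L) (map_sum t u) = smith_index p (complex_join K L) (map_sum t u)"
      by (rule conjunct1[OF r])
    show "smith_index p (complex_join K L) (map_sum t u) = smith_index p K t + smith_index p L u"
      by (rule conjunct2[OF r])
  qed
qed

end
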